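(* Let $(X,\sigma_X)$ be an irreducible one-sided shift of finite type, $(Y,\sigma_Y)$ a subshift and $\pi:(X,\sigma_X)\to(Y,\sigma_Y)$ a (one-block) factor map. Define $F:Y\to\mathbb R$ by $F(y)=\limsup_{n\to\infty}\frac1n\log|\pi^{-1}[y_1\cdots y_n]|$. Then: (a) $F$ is a bounded Borel measurable function and, for all $\phi\in C(Y)$, $$\sup_{\mu\in M(X,\sigma_X)}\Big\{h_\mu(\sigma_X)+\int(-F\circ\pi+\phi\circ\pi)\,d\mu\Big\}=\sup_{m\in M(Y,\sigma_Y)}\Big\{h_m(\sigma_Y)+\int\phi\,dm\Big\};$$ for each $\phi\in C(Y)$ the set of equilibrium states for $-F\circ\pi+\phi\circ\pi$ is nonempty, and $\mu$ is an equilibrium state for $-F\circ\pi+\phi\circ\pi$ if and only if $\pi\mu$ is an equilibrium state for $\phi$ and $\mu$ is a measure of maximal relative entropy over $\pi\mu$. (b) For every subadditive potential $\Phi=\{\phi_n\}_{n=1}^\infty$ on $(Y,\sigma_Y)$, with $\Phi\circ\pi=\{\phi_n\circ\pi\}_{n=1}^\infty$, $$\sup_{\mu\in M(X,\sigma_X)}\Big\{h_\mu(\sigma_X)-\int F\circ\pi\,d\mu+\lim_{n\to\infty}\frac1n\int\phi_n\circ\pi\,d\mu\Big\}=\sup_{m\in M(Y,\sigma_Y)}\Big\{h_m(\sigma_Y)+\lim_{n\to\infty}\frac1n\int\phi_n\,dm\Big\};$$ the set of equilibrium states for $-F\circ\pi+\Phi\circ\pi$ is nonempty; and if $P(\sigma_Y,\Phi)\ne-\infty$,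 then $\mu$ is an equilibrium state for $-F\circ\pi+\Phi\circ\pi$ if and only if $\pi\mu$ is an equilibrium state for $\Phi$ and $\mu$ is a measure of maximal relative entropy over $\pi\mu$.
   Context: A (one-sided) subshift $(X,\sigma_X)$ is a closed shift-invariant subset $X\subseteq\{1,\dots,k\}^{\mathbb N}$ with the shift $\sigma_X$. A factor map $\pi$ is a continuous surjection with $\pi\circ\sigma_X=\sigma_Y\circ\pi$; it is one-block if the $i$-th coordinate of $\pi(x)$ depends only on $x_i$. $M(X,\sigma_X)$ is the set of $\sigma_X$-invariant Borel probability measures, $h_\mu$ is entropy, $\pi\mu$ is the push-forward. $|\pi^{-1}[y_1\cdots y_n]|$ is the number of words $x_1\cdots x_n$ of length $n$ occurring in $X$ that map to $y_1\cdots y_n$. A subadditive potential $\Phi=\{\phi_n\}$ on $(Y,\sigma_Y)$ is a sequence of real-valued continuous functions with $\phi_{n+m}(y)\le\phi_n(y)+\phi_m(\sigma_Y^n y)$ for all $n,m\in\mathbb N$, $y\in Y$. Limits $\lim\frac1n\int\phi_n\,dm$ take values in $[-\infty,\infty)$. Its subadditive topological pressure is $P(\sigma_Y,\Phi)=\lim_{\epsilon\to0}\limsup_{n\to\infty}\frac1n\log\sup\{\sum_{y\in E}e^{\phi_n(y)}:E\text{ is }(n,\epsilon)\text{-separated in }Y\}$, where $d(y,y')=2^{-k}$ if $y,y'$ agree in exactly the first $k$ coordinates and differ in the $(k+1)$-st. An equilibrium state for a bounded Borel function $f$, for $\Phi$, or for $f+\Phi$ is an invariant Borel probability measure attaining,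 over all invariant Borel probability measures $\nu$, the supremum of $h_\nu+\int f\,d\nu$, of $h_\nu+\lim_n\frac1n\int\phi_n\,d\nu$, or of $h_\nu+\int f\,d\nu+\lim_n\frac1n\int\phi_n\,d\nu$, respectively. A measure $\mu\in M(X,\sigma_X)$ is a measure of maximal relative entropy over $m\in M(Y,\sigma_Y)$ if $\pi\mu=m$ and $h_\mu(\sigma_X)=\sup\{h_{\bar\mu}(\sigma_X):\bar\mu\in M(X,\sigma_X),\ \pi\bar\mu=m\}$. *)

theory Defs
  imports "HOL-Probability.Probability"
begin

section \<open>Symbolic dynamics\<close>

text \<open>
  Points are functions of type \<^typ>\<open>nat \<Rightarrow> nat\<close> with the product topology of the discrete topology;
  coordinates are numbered from 0, so that \<open>y\<^sub>1 \<dots> y\<^sub>n\<close> is rendered as \<open>map y [0..<n]\<close>.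
\<close>

definition shift_map :: "(nat \<Rightarrow> nat) \<Rightarrow> (nat \<Rightarrow> nat)" where
  "shift_map x = (\<lambda>i. x (Suc i))"

text \<open>Subshifts are nonempty by convention; shift-invariance means \<open>\<sigma>(X) \<subseteq> X\<close>.\<close>

definition subshift :: "(nat \<Rightarrow> nat) set \<Rightarrow> bool" where
  "subshift X \<longleftrightarrow> X \<noteq> {} \<and> closed X \<and> (\<exists>k. \<forall>x\<in>X. \<forall>i. x i \<in> {1..k}) \<and> shift_map ` X \<subseteq> X"

definition language :: "(nat \<Rightarrow> nat) set \<Rightarrow> nat list set" where
  "language X = {map x [i..<i + n] | x i n. x \<in> X}"

definition shift_of_finite_type :: "(nat \<Rightarrow> nat) set \<Rightarrow> bool" where
  "shift_of_finite_type X \<longleftrightarrow> subshift X \<and>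
     (\<exists>k. \<exists>W :: nat list set. finite W \<and>
        X = {x. (\<forall>i. x i \<in> {1..k}) \<and> (\<forall>i n. map x [i..<i + n] \<notin> W)})"

definition irreducible_shift :: "(nat \<Rightarrow> nat) set \<Rightarrow> bool" where
  "irreducible_shift X \<longleftrightarrow> (\<forall>u\<in>language X. \<forall>v\<in>language X. \<exists>w. u @ w @ v \<in> language X)"

definition factor_map ::
  "(nat \<Rightarrow> nat) set \<Rightarrow> (nat \<Rightarrow> nat) set \<Rightarrow> ((nat \<Rightarrow> nat) \<Rightarrow> (nat \<Rightarrow> nat)) \<Rightarrow> bool" where
  "factor_map X Y \<pi> \<longleftrightarrow> continuous_on X \<pi> \<and> \<pi> ` X = Y \<and>
     (\<forall>x\<in>X. \<pi> (shift_map x) = shift_map (\<pi> x))"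

definition one_block :: "(nat \<Rightarrow> nat) set \<Rightarrow> ((nat \<Rightarrow> nat) \<Rightarrow> (nat \<Rightarrow> nat)) \<Rightarrow> bool" where
  "one_block X \<pi> \<longleftrightarrow> (\<forall>x\<in>X. \<forall>x'\<in>X. \<forall>i. x i = x' i \<longrightarrow> \<pi> x i = \<pi> x' i)"

text \<open>
  The words of \<open>X\<close> mapped to \<open>w\<close> by a one-block map; a word \<open>u\<close> of \<open>X\<close> is mapped to the word
  read off \<open>\<pi> x\<close> at any occurrence of \<open>u\<close> in a point \<open>x\<close>.
\<close>

definition preimage_words ::
  "(nat \<Rightarrow> nat) set \<Rightarrow> ((nat \<Rightarrow> nat) \<Rightarrow> (nat \<Rightarrow> nat)) \<Rightarrow> nat list \<Rightarrow> nat list set" where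
  "preimage_words X \<pi> w = {map x [i..<i + length w] | x i.
     x \<in> X \<and> map (\<pi> x) [i..<i + length w] = w}"

definition growth_ereal ::
  "(nat \<Rightarrow> nat) set \<Rightarrow> ((nat \<Rightarrow> nat) \<Rightarrow> (nat \<Rightarrow> nat)) \<Rightarrow> (nat \<Rightarrow> nat) \<Rightarrow> ereal" where
  "growth_ereal X \<pi> y =
     limsup (\<lambda>n. ereal (ln (real (card (preimage_words X \<pi> (map y [0..<n])))) / real n))"

definition growth ::
  "(nat \<Rightarrow> nat) set \<Rightarrow> ((nat \<Rightarrow> nat) \<Rightarrow> (nat \<Rightarrow> nat)) \<Rightarrow> (nat \<Rightarrow> nat) \<Rightarrow> real" where
  "growth X \<pi> y = real_of_ereal (growth_ereal X \<pi> y)"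

section \<open>Invariant measures and entropy\<close>

definition invariant_measures :: "(nat \<Rightarrow> nat) set \<Rightarrow> (nat \<Rightarrow> nat) measure set" where
  "invariant_measures X = {\<mu>. prob_space \<mu> \<and> sets \<mu> = sets (restrict_space borel X) \<and>
     distr \<mu> \<mu> shift_map = \<mu>}"

definition pushforward ::
  "(nat \<Rightarrow> nat) set \<Rightarrow> ((nat \<Rightarrow> nat) \<Rightarrow> (nat \<Rightarrow> nat)) \<Rightarrow> (nat \<Rightarrow> nat) measure \<Rightarrow> (nat \<Rightarrow> nat) measure" where
  "pushforward Y \<pi> \<mu> = distr \<mu> (restrict_space borel Y) \<pi>"

text \<open>
  The convention \<open>0 log 0 = 0\<close> is covered by \<open>ln 0 = 0\<close>.
\<close>

definition partition_entropy :: "'a measure \<Rightarrow> 'a set set \<Rightarrow> real" where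
  "partition_entropy M P = - (\<Sum>A\<in>P. measure M A * ln (measure M A))"

text \<open>The nonempty cells of the join \<open>P \<or> T\<^sup>-\<^sup>1P \<or> \<dots> \<or> T\<^sup>-\<^sup>(\<^sup>n\<^sup>-\<^sup>1\<^sup>)P\<close>.\<close>

definition iterated_join :: "'a measure \<Rightarrow> ('a \<Rightarrow> 'a) \<Rightarrow> 'a set set \<Rightarrow> nat \<Rightarrow> 'a set set" where
  "iterated_join M T P n =
     {{x \<in> space M. \<forall>i<n. (T ^^ i) x \<in> c i} | c. \<forall>i<n. c i \<in> P} - {{}}"

definition finite_measurable_partition :: "'a measure \<Rightarrow> 'a set set \<Rightarrow> bool" where
  "finite_measurable_partition M P \<longleftrightarrow> finite P \<and> P \<subseteq> sets M \<and> partition_on (space M) P"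

definition ks_entropy :: "'a measure \<Rightarrow> ('a \<Rightarrow> 'a) \<Rightarrow> ereal" where
  "ks_entropy M T = (SUP P\<in>{P. finite_measurable_partition M P}.
     lim (\<lambda>n. ereal (partition_entropy M (iterated_join M T P n) / real n)))"

abbreviation entropy_of :: "(nat \<Rightarrow> nat) measure \<Rightarrow> ereal" where
  "entropy_of \<mu> \<equiv> ks_entropy \<mu> shift_map"

definition max_relative_entropy ::
  "(nat \<Rightarrow> nat) set \<Rightarrow> (nat \<Rightarrow> nat) set \<Rightarrow> ((nat \<Rightarrow> nat) \<Rightarrow> (nat \<Rightarrow> nat)) \<Rightarrow>
   (nat \<Rightarrow> nat) measure \<Rightarrow> (nat \<Rightarrow> nat) measure \<Rightarrow> bool" where
  "max_relative_entropy X Y \<pi> m \<mu> \<longleftrightarrow>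
     \<mu> \<in> invariant_measures X \<and> pushforward Y \<pi> \<mu> = m \<and>
     entropy_of \<mu> = (SUP \<nu>\<in>{\<nu> \<in> invariant_measures X. pushforward Y \<pi> \<nu> = m}. entropy_of \<nu>)"

section \<open>Subadditive potentials, pressure and equilibrium states\<close>

text \<open>Potentials are indexed by \<open>n \<ge> 1\<close>; the value at index 0 is irrelevant throughout.\<close>

definition subadditive_potential ::
  "(nat \<Rightarrow> nat) set \<Rightarrow> (nat \<Rightarrow> (nat \<Rightarrow> nat) \<Rightarrow> real) \<Rightarrow> bool" where
  "subadditive_potential Y \<Phi> \<longleftrightarrow>
     (\<forall>n\<ge>1. continuous_on Y (\<Phi> n)) \<and>
     (\<forall>n\<ge>1. \<forall>m\<ge>1. \<forall>y\<in>Y. \<Phi> (n + m) y \<le> \<Phi> n y + \<Phi> m ((shift_map ^^ n) y))"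

definition mean_integral :: "(nat \<Rightarrow> (nat \<Rightarrow> nat) \<Rightarrow> real) \<Rightarrow> (nat \<Rightarrow> nat) measure \<Rightarrow> ereal" where
  "mean_integral \<Phi> \<mu> = lim (\<lambda>n. ereal ((\<integral>x. \<Phi> n x \<partial>\<mu>) / real n))"

definition symbolic_dist :: "(nat \<Rightarrow> nat) \<Rightarrow> (nat \<Rightarrow> nat) \<Rightarrow> real" where
  "symbolic_dist y z = (if y = z then 0 else (1 / 2) ^ (LEAST k. y k \<noteq> z k))"

text \<open>
  For \<open>\<epsilon> > 0\<close> separated subsets of a subshift are finite by compactness; finiteness is only made
  explicit because sums over infinite sets are 0 by convention.
\<close>

definition separated_sets :: "(nat \<Rightarrow> nat) set \<Rightarrow> nat \<Rightarrow> real \<Rightarrow> (nat \<Rightarrow> nat) set set" where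
  "separated_sets Y n \<epsilon> = {E. finite E \<and> E \<subseteq> Y \<and>
     (\<forall>y\<in>E. \<forall>z\<in>E. y \<noteq> z \<longrightarrow>
        (\<exists>i<n. symbolic_dist ((shift_map ^^ i) y) ((shift_map ^^ i) z) > \<epsilon>))}"

text \<open>
  The inner supremum is one of real numbers; it is finite and positive for \<open>n \<ge> 1\<close> and \<open>\<epsilon> > 0\<close>
  since \<open>Y\<close> is compact and nonempty and \<open>\<Phi> n\<close> is continuous.
\<close>

definition subadditive_pressure ::
  "(nat \<Rightarrow> nat) set \<Rightarrow> (nat \<Rightarrow> (nat \<Rightarrow> nat) \<Rightarrow> real) \<Rightarrow> ereal" where
  "subadditive_pressure Y \<Phi> = Lim (at_right 0) (\<lambda>\<epsilon>.
     limsup (\<lambda>n. ereal (ln (SUP E\<in>separated_sets Y n \<epsilon>. \<Sum>y\<in>E. exp (\<Phi> n y)) / real n)))"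

definition maximizes_over :: "'a set \<Rightarrow> ('a \<Rightarrow> ereal) \<Rightarrow> 'a \<Rightarrow> bool" where
  "maximizes_over S G \<mu> \<longleftrightarrow> \<mu> \<in> S \<and> G \<mu> = (SUP \<nu>\<in>S. G \<nu>)"

definition equilibrium_state ::
  "(nat \<Rightarrow> nat) set \<Rightarrow> ((nat \<Rightarrow> nat) \<Rightarrow> real) \<Rightarrow> (nat \<Rightarrow> nat) measure \<Rightarrow> bool" where
  "equilibrium_state X f =
     maximizes_over (invariant_measures X) (\<lambda>\<nu>. entropy_of \<nu> + ereal (\<integral>x. f x \<partial>\<nu>))"

definition equilibrium_state_seq ::
  "(nat \<Rightarrow> nat) set \<Rightarrow> (nat \<Rightarrow> (nat \<Rightarrow> nat) \<Rightarrow> real) \<Rightarrow> (nat \<Rightarrow> nat) measure \<Rightarrow> bool" where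
  "equilibrium_state_seq X \<Phi> =
     maximizes_over (invariant_measures X) (\<lambda>\<nu>. entropy_of \<nu> + mean_integral \<Phi> \<nu>)"

definition equilibrium_state_sum ::
  "(nat \<Rightarrow> nat) set \<Rightarrow> ((nat \<Rightarrow> nat) \<Rightarrow> real) \<Rightarrow> (nat \<Rightarrow> (nat \<Rightarrow> nat) \<Rightarrow> real) \<Rightarrow>
   (nat \<Rightarrow> nat) measure \<Rightarrow> bool" where
  "equilibrium_state_sum X f \<Phi> =
     maximizes_over (invariant_measures X)
       (\<lambda>\<nu>. entropy_of \<nu> + ereal (\<integral>x. f x \<partial>\<nu>) + mean_integral \<Phi> \<nu>)"

end

theory Submission
  imports Defs
begin

text \<open>
  Both parts follow from the relative variational principle
  \<open>sup {h\<^sub>\<mu> | \<pi>\<mu> = m} = h\<^sub>m + \<integral> F dm\<close>, the supremum being attained, together with the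
  existence of equilibrium states on \<open>Y\<close> (upper semicontinuity of entropy and of the mean
  integral, and compactness). Write \<open>a\<^sub>n(y)\<close> for the number of preimages of the first \<open>n\<close> letters
  of \<open>y\<close>.

  Upper bound: given the \<open>Y\<close>-word \<open>w\<close>, the \<open>X\<close>-word has at most \<open>|\<pi>\<^sup>-\<^sup>1[w]|\<close> values, so its entropy
  exceeds that of \<open>w\<close> by at most \<open>\<integral> log a\<^sub>n dm\<close>. Lower bound: spread \<open>m[w]\<close> evenly over the
  preimages of \<open>w\<close>, realise the words by points of \<open>X\<close>, average along the shift as in Misiurewicz's
  proof of the variational principle, and pass to a limit; it projects to \<open>m\<close> since
  \<open>m\<close> is invariant. Finally \<open>\<integral> F dm = lim (1/n) \<integral> log a\<^sub>n dm\<close>: one inequality is Fatou's lemma, the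
  other the Katznelson--Weiss covering argument.
\<close>

section \<open>Entropy of finite-valued random variables\<close>

text \<open>Entropy is not weakly continuous, but it is the infimum over \<open>q\<close> of
  \<open>block_entropy M q / q\<close>, and each block entropy depends continuously on finitely many
  cylinder weights; mean integrals are infima of the same kind. So limits are taken in estimates at
  fixed block length. As \<open>ks_entropy\<close> ranges over all finite measurable partitions,
  this rests on the Kolmogorov-Sinai theorem. Weak convergence appears only as convergence on
  cylinders, and limit measures are rebuilt from their cylinder weights.

  About \<open>growth\<close> it is only shown that it does not decrease along orbits, which is all
  that the covering argument uses. One inequality, \<open>subadditive_block_bound\<close>, serves
  Fekete's lemma, the Misiurewicz estimate, the covering argument and the construction of a measure
  with finite mean integral.

  Mean integrals may be \<open>-\<infinity>\<close>. If all of them are, every invariant measure is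
  an equilibrium state and nothing about relative entropy follows; the pressure hypothesis excludes
  this case.\<close>

definition eta :: "real \<Rightarrow> real" where
  "eta t = - t * ln t"

lemma eta_0 [simp]: "eta 0 = 0"
  by (simp add: eta_def)

lemma eta_nonneg:
  assumes "0 \<le> t" "t \<le> 1"
  shows "0 \<le> eta t"
  using assms by (cases "t = 0") (auto simp: eta_def mult_nonneg_nonpos)

text \<open>Concavity of \<open>eta\<close> in the form in which it is used: the graph lies below
  the tangent at \<open>s\<close>. It comes from \<open>ln u \<le> u - 1\<close> at
  \<open>u = s / t\<close>.\<close>

lemma eta_le_tangent:
  assumes "0 \<le> t" "0 < s"
  shows "eta t \<le> - t * ln s + s - t"
proof (cases "t = 0")
  case False
  then have "t > 0" using assms by simp
  have "t * ln (s / t) \<le> t * (s / t - 1)"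
    using \<open>t > 0\<close> assms by (intro mult_left_mono ln_le_minus_one) auto
  then show ?thesis
    using \<open>t > 0\<close> assms by (simp add: eta_def ln_div algebra_simps)
qed (use assms in auto)

text \<open>Jensen's inequality: with the tangent taken at the mean \<open>s\<close>, the terms
  \<open>s - t i\<close> add up to zero.\<close>

lemma eta_mean_concave:
  assumes "finite I" "I \<noteq> {}" and "\<And>i. i \<in> I \<Longrightarrow> 0 \<le> t i"
  shows "(\<Sum>i\<in>I. eta (t i)) \<le> card I * eta ((\<Sum>i\<in>I. t i) / card I)"
proof -
  define s where "s = (\<Sum>i\<in>I. t i) / card I"
  have c: "real (card I) > 0" using assms by (simp add: card_gt_0_iff)
  have s0: "s \<ge> 0" unfolding s_def by (intro divide_nonneg_nonneg sum_nonneg assms) auto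
  have sum: "(\<Sum>i\<in>I. t i) = card I * s" using c by (simp add: s_def)
  show ?thesis
  proof (cases "s = 0")
    case True
    then have "\<forall>i\<in>I. t i = 0"
      using sum sum_nonneg_eq_0_iff[OF assms(1), of t] assms(3) by simp
    then show ?thesis by simp
  next
    case False
    have "(\<Sum>i\<in>I. eta (t i)) \<le> (\<Sum>i\<in>I. - t i * ln s + s - t i)"
      by (intro sum_mono eta_le_tangent) (use False s0 assms in auto)
    also have "\<dots> = card I * eta s"
      using sum by (simp add: sum.distrib sum_subtractf sum_negf sum_distrib_right[symmetric] eta_def)
    finally show ?thesis by (simp add: s_def)
  qed
qed

text \<open>Dividing a mass among \<open>card I\<close> cells raises the entropy most when the cells
  are equal. \<open>I\<close> will be the fibre over a word.\<close>

lemma sum_eta_le_card: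
  assumes "finite I" and "\<And>i. i \<in> I \<Longrightarrow> 0 \<le> t i"
  shows "(\<Sum>i\<in>I. eta (t i)) \<le> eta (\<Sum>i\<in>I. t i) + (\<Sum>i\<in>I. t i) * ln (card I)"
proof (cases "(\<Sum>i\<in>I. t i) = 0")
  case True
  then have "\<forall>i\<in>I. t i = 0"
    using sum_nonneg_eq_0_iff[OF assms(1), of t] assms(2) by simp
  then show ?thesis by simp
next
  case False
  then have I: "I \<noteq> {}" and c: "real (card I) > 0"
    using assms(1) by (auto simp: card_gt_0_iff)
  have pos: "(\<Sum>i\<in>I. t i) > 0" using False sum_nonneg[of I t] assms(2) by force
  have "(\<Sum>i\<in>I. eta (t i)) \<le> card I * eta ((\<Sum>i\<in>I. t i) / card I)"
    by (rule eta_mean_concave[OF assms(1) I assms(2)])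
  also have "\<dots> = eta (\<Sum>i\<in>I. t i) + (\<Sum>i\<in>I. t i) * ln (card I)"
    using c pos by (simp add: eta_def ln_div algebra_simps)
  finally show ?thesis .
qed

text \<open>Gibbs' inequality for one atom: \<open>p\<close> is compared with
  \<open>q * r / s\<close>, the value it would have if the first two variables were independent
  given the third. The bounds by \<open>q\<close>, \<open>r\<close> and \<open>s\<close> make all
  logarithms meaningful as soon as \<open>p\<close> is positive.\<close>

lemma gibbs_submodular_term:
  fixes p q r s :: real
  assumes "0 \<le> p" "p \<le> q" "p \<le> r" "p \<le> s"
  shows "p - q * r / s \<le> p * (ln p + ln s - ln q - ln r)"
proof (cases "p = 0")
  case True
  then show ?thesis using assms by simp
next
  case False
  then have pos: "p > 0" "q > 0" "r > 0" "s > 0" using assms by auto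
  have "p * ln (q * r / (s * p)) \<le> p * (q * r / (s * p) - 1)"
    using pos by (intro mult_left_mono ln_le_minus_one) auto
  then show ?thesis using pos by (simp add: ln_div ln_mult algebra_simps)
qed

text \<open>Nonnegativity of conditional mutual information: given the third variable, the entropy
  of the pair is at most the sum of the two entropies.\<close>

lemma eta_sum_submodular:
  fixes p :: "'a \<Rightarrow> 'b \<Rightarrow> 'c \<Rightarrow> real"
  assumes fin: "finite A" "finite B" "finite C"
    and nn: "\<And>a b c. a \<in> A \<Longrightarrow> b \<in> B \<Longrightarrow> c \<in> C \<Longrightarrow> 0 \<le> p a b c"
  shows "(\<Sum>a\<in>A. \<Sum>b\<in>B. \<Sum>c\<in>C. eta (p a b c)) + (\<Sum>c\<in>C. eta (\<Sum>a\<in>A. \<Sum>b\<in>B. p a b c))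
    \<le> (\<Sum>a\<in>A. \<Sum>c\<in>C. eta (\<Sum>b\<in>B. p a b c)) + (\<Sum>b\<in>B. \<Sum>c\<in>C. eta (\<Sum>a\<in>A. p a b c))"
proof -
  define q where "q a c = (\<Sum>b\<in>B. p a b c)" for a c
  define r where "r b c = (\<Sum>a\<in>A. p a b c)" for b c
  define s where "s c = (\<Sum>a\<in>A. \<Sum>b\<in>B. p a b c)" for c
  have s_q: "s c = (\<Sum>a\<in>A. q a c)" for c by (simp add: s_def q_def)
  have s_r: "s c = (\<Sum>b\<in>B. r b c)" for c unfolding s_def r_def by (rule sum.swap)
  have pq: "p a b c \<le> q a c" if "a \<in> A" "b \<in> B" "c \<in> C" for a b c
    unfolding q_def using that fin nn by (intro member_le_sum) auto
  have pr: "p a b c \<le> r b c" if "a \<in> A" "b \<in> B" "c \<in> C" for a b c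
    unfolding r_def using that fin nn by (intro member_le_sum[of a A "\<lambda>a. p a b c"]) auto
  have q0: "0 \<le> q a c" if "a \<in> A" "c \<in> C" for a c
    unfolding q_def using that nn by (intro sum_nonneg) auto
  have qs: "q a c \<le> s c" if "a \<in> A" "c \<in> C" for a c
    unfolding s_q using that fin q0 by (intro member_le_sum[of a A "\<lambda>a. q a c"]) auto
  \<comment> \<open>For fixed \<open>c\<close>, both \<open>p\<close> and \<open>q * r / s\<close>
    have total mass \<open>s c\<close>. Division by zero gives zero, so \<open>s c = 0\<close> needs
    no separate case.\<close>
  have "0 = (\<Sum>c\<in>C. s c - s c * s c / s c)" by simp
  also have "\<dots> = (\<Sum>c\<in>C. s c - (\<Sum>a\<in>A. \<Sum>b\<in>B. q a c * r b c / s c))"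
  proof (intro sum.cong refl)
    fix c assume "c \<in> C"
    have "s c * s c = (\<Sum>a\<in>A. \<Sum>b\<in>B. q a c * r b c)"
      by (subst s_q, subst s_r, rule sum_product)
    then show "s c - s c * s c / s c = s c - (\<Sum>a\<in>A. \<Sum>b\<in>B. q a c * r b c / s c)"
      by (simp add: sum_divide_distrib)
  qed
  also have "\<dots> = (\<Sum>c\<in>C. \<Sum>a\<in>A. \<Sum>b\<in>B. p a b c - q a c * r b c / s c)"
    by (simp add: sum_subtractf s_def)
  also have "\<dots> \<le> (\<Sum>c\<in>C. \<Sum>a\<in>A. \<Sum>b\<in>B. p a b c * (ln (p a b c) + ln (s c) - ln (q a c) - ln (r b c)))"
    by (intro sum_mono gibbs_submodular_term) (use nn pq pr order.trans[OF pq qs] in auto)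
  also have "\<dots> = (\<Sum>c\<in>C. (\<Sum>a\<in>A. \<Sum>b\<in>B. p a b c * ln (p a b c)) + s c * ln (s c)
      - (\<Sum>a\<in>A. q a c * ln (q a c)) - (\<Sum>b\<in>B. r b c * ln (r b c)))"
  proof (intro sum.cong refl)
    fix c
    have 1: "(\<Sum>a\<in>A. \<Sum>b\<in>B. p a b c * ln (r b c)) = (\<Sum>b\<in>B. r b c * ln (r b c))"
      by (subst sum.swap) (simp add: r_def sum_distrib_right)
    have 2: "s c * ln (s c) = (\<Sum>a\<in>A. \<Sum>b\<in>B. p a b c * ln (s c))"
      by (simp add: s_def sum_distrib_right)
    have 3: "(\<Sum>a\<in>A. q a c * ln (q a c)) = (\<Sum>a\<in>A. \<Sum>b\<in>B. p a b c * ln (q a c))"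
      by (simp add: q_def sum_distrib_right)
    show "(\<Sum>a\<in>A. \<Sum>b\<in>B. p a b c * (ln (p a b c) + ln (s c) - ln (q a c) - ln (r b c))) =
      (\<Sum>a\<in>A. \<Sum>b\<in>B. p a b c * ln (p a b c)) + s c * ln (s c)
      - (\<Sum>a\<in>A. q a c * ln (q a c)) - (\<Sum>b\<in>B. r b c * ln (r b c))"
      unfolding 1[symmetric] 2 3
      by (simp add: algebra_simps sum.distrib sum_subtractf)
  qed
  finally have *: "(\<Sum>c\<in>C. \<Sum>a\<in>A. q a c * ln (q a c)) + (\<Sum>c\<in>C. \<Sum>b\<in>B. r b c * ln (r b c))
      \<le> (\<Sum>c\<in>C. \<Sum>a\<in>A. \<Sum>b\<in>B. p a b c * ln (p a b c)) + (\<Sum>c\<in>C. s c * ln (s c))"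
    by (simp add: sum.distrib sum_subtractf)
  have 1: "(\<Sum>c\<in>C. \<Sum>a\<in>A. \<Sum>b\<in>B. p a b c * ln (p a b c)) = (\<Sum>a\<in>A. \<Sum>b\<in>B. \<Sum>c\<in>C. p a b c * ln (p a b c))"
    by (subst sum.swap, subst (2) sum.swap) simp
  have 2: "(\<Sum>c\<in>C. \<Sum>a\<in>A. q a c * ln (q a c)) = (\<Sum>a\<in>A. \<Sum>c\<in>C. q a c * ln (q a c))"
    "(\<Sum>c\<in>C. \<Sum>b\<in>B. r b c * ln (r b c)) = (\<Sum>b\<in>B. \<Sum>c\<in>C. r b c * ln (r b c))"
    by (rule sum.swap)+
  show ?thesis
    using * unfolding 1 2 by (simp add: eta_def sum_negf q_def r_def s_def)
qed

text \<open>A random variable takes the place of a partition: joins become tuples or lists of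
  values, and the value type is free. Meaningful for finite range only, since a sum over an infinite
  set is 0.\<close>

definition Ent :: "'a measure \<Rightarrow> ('a \<Rightarrow> 'b) \<Rightarrow> real" where
  "Ent M f = (\<Sum>v\<in>f ` space M. eta (measure M (f -` {v} \<inter> space M)))"

section \<open>Shannon inequalities for simple functions\<close>

context prob_space
begin

lemma Ent_superset:
  assumes "finite S" "f ` space M \<subseteq> S"
  shows "Ent M f = (\<Sum>v\<in>S. eta (prob (f -` {v} \<inter> space M)))"
  unfolding Ent_def
proof (rule sum.mono_neutral_left[OF assms])
  show "\<forall>v\<in>S - f ` space M. eta (prob (f -` {v} \<inter> space M)) = 0"
  proof
    fix v assume "v \<in> S - f ` space M"
    then have "f -` {v} \<inter> space M = {}" by auto
    then show "eta (prob (f -` {v} \<inter> space M)) = 0" by simp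
  qed
qed

text \<open>Identifies \<open>Ent\<close> with the library entropy in nats, which supplies data
  processing and the bound by the logarithm of the number of values.\<close>

lemma Ent_eq_entropy:
  assumes "simple_function M f"
  shows "Ent M f = entropy (exp 1) (count_space (f ` space M)) f"
proof -
  interpret information_space M "exp 1" by standard (simp add: one_less_exp_iff)
  show ?thesis
    using entropy_simple_distributed[OF simple_distributedI[OF assms measure_nonneg refl]]
    by (simp add: Ent_def eta_def sum_negf log_def)
qed

lemma Ent_data_processing:
  assumes "simple_function M f"
  shows "Ent M (g \<circ> f) \<le> Ent M f"
proof -
  interpret information_space M "exp 1" by standard (simp add: one_less_exp_iff)
  show ?thesis
    using entropy_data_processing[OF assms, of g] simple_function_compose[OF assms, of g]
    by (simp add: Ent_eq_entropy assms)
qed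

lemma Ent_le_card:
  assumes "simple_function M f" "f ` space M \<subseteq> S" "finite S"
  shows "Ent M f \<le> ln (card S)"
proof -
  interpret information_space M "exp 1" by standard (simp add: one_less_exp_iff)
  have "Ent M f \<le> ln (card (f ` space M))"
    using entropy_le_card[OF simple_distributedI[OF assms(1) measure_nonneg refl]]
    by (simp add: Ent_eq_entropy assms log_def)
  also have "\<dots> \<le> ln (card S)"
    using not_empty assms by (intro ln_mono) (auto simp: card_gt_0_iff card_mono finite_subset)
  finally show ?thesis .
qed

lemma Ent_nonneg: "0 \<le> Ent M f"
  unfolding Ent_def by (intro sum_nonneg eta_nonneg) auto

lemma prob_marginal:
  assumes "simple_function M X" "simple_function M Y"
  shows "prob (X -` {x} \<inter> space M) = (\<Sum>y\<in>Y ` space M. prob ((\<lambda>z. (X z, Y z)) -` {(x, y)} \<inter> space M))"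
proof -
  note XY = simple_function_Pair[OF assms]
  have "prob (X -` {x} \<inter> space M) = prob (\<Union>y\<in>Y ` space M. (\<lambda>z. (X z, Y z)) -` {(x, y)} \<inter> space M)"
    by (intro arg_cong[where f = prob]) auto
  also have "\<dots> = (\<Sum>y\<in>Y ` space M. prob ((\<lambda>z. (X z, Y z)) -` {(x, y)} \<inter> space M))"
    by (intro finite_measure_finite_Union)
      (auto simp: disjoint_family_on_def simple_functionD[OF assms(2)] intro!: simple_functionD(2)[OF XY])
  finally show ?thesis .
qed

lemma Ent_submodular:
  assumes X: "simple_function M X" and Y: "simple_function M Y" and Z: "simple_function M Z"
  shows "Ent M (\<lambda>z. (X z, Y z, Z z)) + Ent M Z \<le> Ent M (\<lambda>z. (X z, Z z)) + Ent M (\<lambda>z. (Y z, Z z))"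
proof -
  let ?A = "X ` space M" and ?B = "Y ` space M" and ?C = "Z ` space M"
  define p where "p a b c = prob ((\<lambda>z. (X z, Y z, Z z)) -` {(a, b, c)} \<inter> space M)" for a b c
  note fin = simple_functionD(1)[OF X] simple_functionD(1)[OF Y] simple_functionD(1)[OF Z]
  have 1: "Ent M (\<lambda>z. (X z, Y z, Z z)) = (\<Sum>a\<in>?A. \<Sum>b\<in>?B. \<Sum>c\<in>?C. eta (p a b c))"
    by (subst Ent_superset[of "?A \<times> ?B \<times> ?C"])
      (use fin in \<open>auto simp: p_def sum.cartesian_product\<close>)
  have xz: "prob ((\<lambda>z. (X z, Z z)) -` {(a, c)} \<inter> space M) = (\<Sum>b\<in>?B. p a b c)" for a c
    by (subst prob_marginal[OF simple_function_Pair[OF X Z] Y])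
      (auto simp: p_def intro!: sum.cong arg_cong[where f = prob])
  have yz: "prob ((\<lambda>z. (Y z, Z z)) -` {(b, c)} \<inter> space M) = (\<Sum>a\<in>?A. p a b c)" for b c
    by (subst prob_marginal[OF simple_function_Pair[OF Y Z] X])
      (auto simp: p_def intro!: sum.cong arg_cong[where f = prob])
  have z: "prob (Z -` {c} \<inter> space M) = (\<Sum>a\<in>?A. \<Sum>b\<in>?B. p a b c)" for c
  proof -
    have "prob (Z -` {c} \<inter> space M) = (\<Sum>a\<in>?A. prob ((\<lambda>z. (Z z, X z)) -` {(c, a)} \<inter> space M))"
      by (rule prob_marginal[OF Z X])
    also have "\<dots> = (\<Sum>a\<in>?A. prob ((\<lambda>z. (X z, Z z)) -` {(a, c)} \<inter> space M))"
      by (auto intro!: sum.cong arg_cong[where f = prob])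
    finally show ?thesis by (simp add: xz)
  qed
  have 2: "Ent M (\<lambda>z. (X z, Z z)) = (\<Sum>a\<in>?A. \<Sum>c\<in>?C. eta (\<Sum>b\<in>?B. p a b c))"
    by (subst Ent_superset[of "?A \<times> ?C"])
      (use fin in \<open>auto simp: xz sum.cartesian_product intro!: sum.cong\<close>)
  have 3: "Ent M (\<lambda>z. (Y z, Z z)) = (\<Sum>b\<in>?B. \<Sum>c\<in>?C. eta (\<Sum>a\<in>?A. p a b c))"
    by (subst Ent_superset[of "?B \<times> ?C"])
      (use fin in \<open>auto simp: yz sum.cartesian_product intro!: sum.cong\<close>)
  have 4: "Ent M Z = (\<Sum>c\<in>?C. eta (\<Sum>a\<in>?A. \<Sum>b\<in>?B. p a b c))"
    by (simp add: Ent_def z)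
  show ?thesis unfolding 1 2 3 4
    by (rule eta_sum_submodular[OF fin]) (simp add: p_def)
qed

lemma Ent_Pair_le:
  assumes X: "simple_function M X" and Y: "simple_function M Y"
  shows "Ent M (\<lambda>z. (X z, Y z)) \<le> Ent M X + Ent M Y"
proof -
  \<comment> \<open>Conditioning on a constant turns submodularity into subadditivity.\<close>
  have Z: "simple_function M (\<lambda>z. ())" by simp
  have "Ent M (\<lambda>z. (X z, Y z)) \<le> Ent M (\<lambda>z. (X z, Y z, ()))"
    using Ent_data_processing[OF simple_function_Pair[OF X simple_function_Pair[OF Y Z]], of "\<lambda>(x, y, z). (x, y)"]
    by (simp add: comp_def)
  moreover have "Ent M (\<lambda>z. (X z, ())) \<le> Ent M X" "Ent M (\<lambda>z. (Y z, ())) \<le> Ent M Y"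
    using Ent_data_processing[OF X, of "\<lambda>x. (x, ())"] Ent_data_processing[OF Y, of "\<lambda>x. (x, ())"]
    by (simp_all add: comp_def)
  ultimately show ?thesis
    using Ent_submodular[OF X Y Z] Ent_nonneg[of "\<lambda>z. ()"] by linarith
qed

end

section \<open>Subadditivity and a covering bound\<close>

text \<open>Telescoping \<open>G\<^sub>n = g 0 (n + 1) + \<dots> + g 0 (n + q)\<close> avoids splitting \<open>[0, n)\<close> into blocks.\<close>

lemma subadditive_block_bound:
  fixes g :: "nat \<Rightarrow> nat \<Rightarrow> real"
  assumes sub: "\<And>a b c. a < b \<Longrightarrow> b < c \<Longrightarrow> g a c \<le> g a b + g b c"
    and bdd: "\<And>a b. a < b \<Longrightarrow> b \<le> a + q \<Longrightarrow> \<bar>g a b\<bar> \<le> C"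
    and "q < n" "0 < q"
  shows "real q * g 0 n \<le> (\<Sum>j<n. g j (j + q)) + (3 * real q + 2) * C"
proof -
  define G where "G m = (\<Sum>r=1..q. g 0 (m + r))" for m
  \<comment> \<open>Passing from \<open>m\<close> to \<open>Suc m\<close> drops the term at
    \<open>m + 1\<close> and adds the one at \<open>m + 1 + q\<close>; by subadditivity their
    difference is at most one block of length \<open>q\<close>.\<close>
  have G_Suc: "G (Suc m) \<le> G m + g (Suc m) (Suc m + q)" for m
  proof -
    have "(\<Sum>r=1..q. g 0 (Suc m + r)) + g 0 (Suc m) = (\<Sum>r=0..q. g 0 (Suc m + r))"
      by (subst sum.atLeast_Suc_atMost[of 0 q]) auto
    also have "\<dots> = (\<Sum>r=1..Suc q. g 0 (m + r))"
      by (simp only: One_nat_def sum.shift_bounds_cl_Suc_ivl add_Suc_right add_Suc)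
    also have "\<dots> = G m + g 0 (Suc m + q)" by (simp add: G_def)
    finally have "G (Suc m) + g 0 (Suc m) = G m + g 0 (Suc m + q)" by (simp add: G_def)
    moreover have "g 0 (Suc m + q) \<le> g 0 (Suc m) + g (Suc m) (Suc m + q)"
      by (rule sub) (use \<open>0 < q\<close> in auto)
    ultimately show ?thesis by linarith
  qed
  have C: "C \<ge> 0" using bdd[of 0 1] \<open>0 < q\<close> by linarith
  have G_le: "G m \<le> G 0 + (\<Sum>j=1..m. g j (j + q))" for m
  proof (induction m)
    case (Suc m)
    then show ?case using G_Suc[of m] by simp
  qed simp
  have "G 0 \<le> (\<Sum>r=1..q. C)"
    unfolding G_def using bdd[of 0] by (intro sum_mono) (force simp: abs_le_iff)
  then have G0: "G 0 \<le> q * C" by simp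
  define m where "m = n - q - 1"
  have m: "m + q + 1 = n" using \<open>q < n\<close> by (simp add: m_def)
  \<comment> \<open>\<open>n\<close> is \<open>m + q + 1\<close>, so each of the \<open>q\<close>
    points \<open>m + r\<close> leaves a remainder of length at most \<open>q\<close>, which costs
    at most \<open>C\<close>.\<close>
  have "q * g 0 n = (\<Sum>r=1..q. g 0 n)" by simp
  also have "\<dots> \<le> (\<Sum>r=1..q. g 0 (m + r) + C)"
  proof (intro sum_mono)
    fix r assume r: "r \<in> {1..q}"
    have "g 0 n \<le> g 0 (m + r) + g (m + r) n" by (rule sub) (use r m in auto)
    moreover have "g (m + r) n \<le> C" using bdd[of "m + r" n] r m by auto
    ultimately show "g 0 n \<le> g 0 (m + r) + C" by simp
  qed
  also have "\<dots> = G m + q * C" by (simp add: G_def sum.distrib)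
  also have "\<dots> \<le> (\<Sum>j=1..m. g j (j + q)) + 2 * real q * C" using G_le[of m] G0 by (simp add: algebra_simps)
  \<comment> \<open>The starting points outside \<open>{1..m}\<close> are \<open>0\<close> and the
    last \<open>q\<close>, with terms at least \<open>- C\<close>. Rounding \<open>q + 1\<close> up
    to \<open>q + 2\<close> and adding the \<open>2 * q\<close> already spent gives the constant
    \<open>3 * q + 2\<close>.\<close>
  also have "(\<Sum>j=1..m. g j (j + q)) \<le> (\<Sum>j<n. g j (j + q)) + (real q + 2) * C"
  proof -
    have sub: "{1..m} \<subseteq> {..<n}" using m by auto
    have "card ({..<n} - {1..m}) = q + 1"
      using m by (subst card_Diff_subset[OF _ sub]) auto
    moreover have ge: "- C \<le> g j (j + q)" for j
      using bdd[of j "j + q"] \<open>0 < q\<close> by (simp add: abs_le_iff)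
    moreover have "(\<Sum>j\<in>{..<n} - {1..m}. g j (j + q)) \<ge> (\<Sum>j\<in>{..<n} - {1..m}. - C)"
      using ge by (intro sum_mono) auto
    ultimately have "(\<Sum>j\<in>{..<n} - {1..m}. g j (j + q)) \<ge> - (real q + 1) * C" by (simp add: algebra_simps)
    moreover have "(\<Sum>j<n. g j (j + q)) = (\<Sum>j=1..m. g j (j + q)) + (\<Sum>j\<in>{..<n} - {1..m}. g j (j + q))"
      by (subst sum.subset_diff[OF sub]) auto
    ultimately show ?thesis using C by (auto simp: algebra_simps)
  qed
  finally show ?thesis by (simp add: algebra_simps)
qed

text \<open>The block bound with \<open>g a b = u (b - a)\<close> gives
  \<open>q * u n \<le> n * u q + K\<close>, hence a limsup of at most \<open>u q / q\<close> for
  each \<open>q\<close>. Values in \<open>ereal\<close> admit the limit \<open>-\<infinity>\<close>,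
  and the infimum over \<open>q \<ge> 1\<close> avoids the default value of
  \<open>u 0 / 0\<close>.\<close>

lemma fekete_subadditive:
  fixes u :: "nat \<Rightarrow> real"
  assumes "\<And>m n. 0 < m \<Longrightarrow> 0 < n \<Longrightarrow> u (m + n) \<le> u m + u n"
  shows "(\<lambda>n. ereal (u n / n)) \<longlonglongrightarrow> (INF q\<in>{1..}. ereal (u q / q))"
proof -
  let ?L = "INF q\<in>{1..}. ereal (u q / q)"
  have up: "limsup (\<lambda>n. ereal (u n / n)) \<le> ereal (u q / q)" if q: "q \<in> {1..}" for q
  proof -
    define C where "C = (\<Sum>i\<le>q. \<bar>u i\<bar>)"
    define K where "K = (3 * real q + 2) * C"
    have "u n / n \<le> u q / q + (K / q) * (1 / n)" if "q < n" for n
    proof -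
      have "real q * u (n - 0) \<le> (\<Sum>j<n. u (j + q - j)) + (3 * real q + 2) * C"
      proof (rule subadditive_block_bound[where g = "\<lambda>a b. u (b - a)"])
        show "u (c - a) \<le> u (b - a) + u (c - b)" if "a < b" "b < c" for a b c
          using assms[of "b - a" "c - b"] that by simp
        show "\<bar>u (b - a)\<bar> \<le> C" if "a < b" "b \<le> a + q" for a b
          unfolding C_def using that by (intro member_le_sum) auto
      qed (use that q in auto)
      then have "q * u n \<le> n * u q + K" by (simp add: K_def)
      then show ?thesis using q that by (simp add: field_simps)
    qed
    then have "eventually (\<lambda>n. ereal (u n / n) \<le> ereal (u q / q + (K / q) * (1 / n))) sequentially"
      by (intro eventually_sequentiallyI[of "Suc q"]) auto
    moreover have "(\<lambda>n. ereal (u q / q + (K / q) * (1 / real n))) \<longlonglongrightarrow> ereal (u q / q + (K / q) * 0)"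
      by (intro tendsto_ereal tendsto_add tendsto_mult tendsto_const lim_1_over_n)
    then have "limsup (\<lambda>n. ereal (u q / q + (K / q) * (1 / real n))) = ereal (u q / q + (K / q) * 0)"
      by (rule lim_imp_Limsup[OF sequentially_bot])
    ultimately show ?thesis
      using Limsup_mono[of "\<lambda>n. ereal (u n / n)" _ sequentially] by fastforce
  qed
  have "?L \<le> liminf (\<lambda>n. ereal (u n / n))"
    by (rule Liminf_bounded) (intro eventually_sequentiallyI[of 1] INF_lower, auto)
  moreover have "limsup (\<lambda>n. ereal (u n / n)) \<le> ?L"
    by (intro INF_greatest up)
  moreover have "liminf (\<lambda>n. ereal (u n / n)) \<le> limsup (\<lambda>n. ereal (u n / n))"
    by (rule Liminf_le_Limsup) simp
  ultimately show ?thesis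
    by (intro Liminf_eq_Limsup) auto
qed

section \<open>Measure-preserving maps and coverings of orbits\<close>

lemma measure_preserving_funpow:
  assumes T: "T \<in> measurable M M" and inv: "distr M M T = M"
  shows "T ^^ j \<in> measurable M M" "distr M M (T ^^ j) = M"
proof -
  show m: "T ^^ j \<in> measurable M M" for j using T by (rule measurable_compose_n)
  show "distr M M (T ^^ j) = M"
  proof (induction j)
    case (Suc j)
    have "distr M M (T ^^ Suc j) = distr (distr M M (T ^^ j)) M T"
      by (subst distr_distr[OF T m]) simp
    then show ?case using Suc inv by (simp add: comp_def)
  qed (simp add: id_def)
qed

text \<open>An orbit segment of length \<open>L\<close> is cut greedily into pieces of bounded
  length on which the sum of \<open>f\<close> is at least the length times \<open>F x - e\<close>;
  invariance turns the pointwise bound into one for integrals. Monotonicity of \<open>F\<close>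
  along orbits carries the target value from one piece to the next.\<close>

lemma (in prob_space) covering_integral_bound:
  fixes f F :: "'a \<Rightarrow> real" and K :: real
  assumes T [measurable]: "T \<in> measurable M M" and inv: "distr M M T = M"
    and f [measurable]: "f \<in> borel_measurable M" and F [measurable]: "F \<in> borel_measurable M"
    and f_bd: "\<And>x. x \<in> space M \<Longrightarrow> 0 \<le> f x \<and> f x \<le> K"
    and F_bd: "\<And>x. x \<in> space M \<Longrightarrow> 0 \<le> F x \<and> F x \<le> K"
    and F_T: "\<And>x. x \<in> space M \<Longrightarrow> F x \<le> F (T x)"
    and ex: "\<And>x e. x \<in> space M \<Longrightarrow> 0 < e \<Longrightarrow> \<exists>n\<ge>1. n * (F x - e) \<le> (\<Sum>j<n. f ((T ^^ j) x))"
  shows "(\<integral>x. F x \<partial>M) \<le> (\<integral>x. f x \<partial>M)"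
proof (rule field_le_epsilon)
  fix e' :: real assume "e' > 0"
  obtain x0 where "x0 \<in> space M" using not_empty by blast
  then have K: "K \<ge> 0" using f_bd by force
  \<comment> \<open>The two losses are \<open>e\<close> from the averages and \<open>K * e\<close>
    from the exceptional set; the \<open>+ 1\<close> covers \<open>K = 0\<close>.\<close>
  define e where "e = e' / (K + 1)"
  have e: "e > 0" "(K + 1) * e = e'" using K \<open>e' > 0\<close> by (auto simp: e_def)
  note Tn [measurable] = measure_preserving_funpow(1)[OF T inv]
  define E where "E N = {x \<in> space M. \<exists>n\<in>{1..N}. n * (F x - e) \<le> (\<Sum>j<n. f ((T ^^ j) x))}" for N
  have fT [measurable]: "(\<lambda>x. f ((T ^^ j) x)) \<in> borel_measurable M" for j
    by (rule measurable_compose[OF Tn f])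
  have E [measurable]: "E N \<in> sets M" for N
  proof -
    have "E N = (\<Union>n\<in>{1..N}. {x \<in> space M. n * (F x - e) \<le> (\<Sum>j<n. f ((T ^^ j) x))})"
      by (auto simp: E_def)
    also have "\<dots> \<in> sets M" by (intro sets.finite_UN) measurable
    finally show ?thesis .
  qed
  have incE: "incseq E" unfolding incseq_def E_def by force
  \<comment> \<open>The length of a good piece depends on the point; exhaustion makes one bound
    \<open>N\<close> valid up to measure \<open>e\<close>.\<close>
  have "(\<Union>N. E N) = space M"
  proof (intro equalityI subsetI)
    fix x assume x: "x \<in> space M"
    then obtain n where "n \<ge> 1" "n * (F x - e) \<le> (\<Sum>j<n. f ((T ^^ j) x))"
      using ex[OF x e(1)] by blast
    then have "x \<in> E n" using x by (auto simp: E_def)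
    then show "x \<in> (\<Union>N. E N)" by blast
  qed (auto simp: E_def)
  then have "(\<lambda>N. prob (E N)) \<longlonglongrightarrow> 1"
    using finite_Lim_measure_incseq[OF _ incE] E prob_space by (auto simp: image_subset_iff)
  then have "eventually (\<lambda>N. prob (E N) > 1 - e) sequentially"
    using e(1) by (intro order_tendstoD(1)) auto
  then obtain N where N: "prob (E N) > 1 - e"
    using eventually_sequentially by auto
  \<comment> \<open>Raising \<open>f\<close> by \<open>K\<close> on the exceptional set makes a
    single step a good piece there, because \<open>F \<le> K\<close>.\<close>
  define h where "h x = f x + K * indicator (space M - E N) x" for x
  have h [measurable]: "h \<in> borel_measurable M" unfolding h_def by measurable
  have h0: "0 \<le> h x" "f x \<le> h x" if "x \<in> space M" for x
    using f_bd[OF that] K by (auto simp: h_def)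
  have sp: "(T ^^ j) x \<in> space M" if "x \<in> space M" for j x
    using measurable_space[OF Tn that] .
  have F_Tn: "F x \<le> F ((T ^^ j) x)" if "x \<in> space M" for j x
  proof (induction j)
    case (Suc j)
    then show ?case using F_T[OF sp[OF that], of j] by simp
  qed simp
  \<comment> \<open>The term \<open>- N\<close> accounts for the last piece: once
    \<open>L \<le> N\<close> the left side is at most zero and the right side is
    nonnegative.\<close>
  have key: "(real L - real N) * F x - L * e \<le> (\<Sum>j<L. h ((T ^^ j) x))" if "x \<in> space M" for L x
    using that
  proof (induction L arbitrary: x rule: less_induct)
    case (less L)
    note x = less.prems
    have nonneg: "0 \<le> (\<Sum>j<L. h ((T ^^ j) x))" if "x \<in> space M" for L x
      using h0 sp that by (intro sum_nonneg) auto
    show ?case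
    proof (cases "L \<le> N")
      case True
      have "(real L - real N) * F x \<le> 0"
        using True F_bd[OF x] by (intro mult_nonpos_nonneg) auto
      moreover have "0 \<le> L * e" using e by simp
      ultimately show ?thesis using nonneg[OF x, of L] by linarith
    next
      case False
      obtain n where n: "1 \<le> n" "n \<le> L" "n * F x - n * e \<le> (\<Sum>j<n. h ((T ^^ j) x))"
      proof (cases "x \<in> E N")
        case True
        then obtain n where "n \<in> {1..N}" "n * (F x - e) \<le> (\<Sum>j<n. f ((T ^^ j) x))"
          by (auto simp: E_def)
        moreover have "(\<Sum>j<n. f ((T ^^ j) x)) \<le> (\<Sum>j<n. h ((T ^^ j) x))"
          using h0 sp[OF x] by (intro sum_mono) auto
        ultimately show ?thesis using that[of n] False by (auto simp: algebra_simps)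
      next
        case False
        then have "F x \<le> h x" using x F_bd[OF x] f_bd[OF x] by (auto simp: h_def)
        then show ?thesis using that[of 1] \<open>\<not> L \<le> N\<close> e by simp
      qed
      have split: "(\<Sum>j<L. h ((T ^^ j) x)) = (\<Sum>j<n. h ((T ^^ j) x)) + (\<Sum>j<L - n. h ((T ^^ j) ((T ^^ n) x)))"
      proof -
        have "(\<Sum>j<L. h ((T ^^ j) x)) = (\<Sum>j<n. h ((T ^^ j) x)) + (\<Sum>j=n..<L. h ((T ^^ j) x))"
          using n(2) by (metis (no_types) atLeast0LessThan sum.atLeastLessThan_concat zero_le)
        also have "(\<Sum>j=n..<L. h ((T ^^ j) x)) = (\<Sum>j<L - n. h ((T ^^ (j + n)) x))"
          using n(2) sum.shift_bounds_nat_ivl[of "\<lambda>j. h ((T ^^ j) x)" 0 n "L - n"]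
          by (simp add: atLeast0LessThan)
        finally show ?thesis by (simp add: funpow_add)
      qed
      have IH: "(real (L - n) - real N) * F ((T ^^ n) x) - (L - n) * e
          \<le> (\<Sum>j<L - n. h ((T ^^ j) ((T ^^ n) x)))"
        by (rule less.IH[OF _ sp[OF x]]) (use n in auto)
      \<comment> \<open>\<open>F x \<le> F ((T ^^ n) x)\<close> may be multiplied only by a
        nonnegative factor; otherwise the left side is already at most zero.\<close>
      have "(real (L - n) - real N) * F x - (L - n) * e \<le> (\<Sum>j<L - n. h ((T ^^ j) ((T ^^ n) x)))"
      proof (cases "L - n \<le> N")
        case True
        then have "(real (L - n) - real N) * F x \<le> 0"
          using F_bd[OF x] by (intro mult_nonpos_nonneg) auto
        moreover have "0 \<le> (L - n) * e" using e by simp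
        ultimately show ?thesis using nonneg[OF sp[OF x], of n "L - n"] by linarith
      next
        case False
        then have "(real (L - n) - real N) * F x \<le> (real (L - n) - real N) * F ((T ^^ n) x)"
          using F_Tn[OF x] by (intro mult_left_mono) auto
        then show ?thesis using IH by linarith
      qed
      then show ?thesis unfolding split using n
        by (simp add: of_nat_diff algebra_simps)
    qed
  qed
  have int: "integrable M F" "integrable M f" "integrable M h"
  proof -
    show 1: "integrable M F" "integrable M f"
      using F_bd f_bd by (auto intro!: integrable_const_bound[of _ K] AE_I2)
    show "integrable M h"
      unfolding h_def using 1(2)
      by (intro Bochner_Integration.integrable_add integrable_mult_right integrable_real_indicator)
        (auto simp: emeasure_eq_measure)
  qed
  note inv_n = measure_preserving_funpow(2)[OF T inv]
  have int_hj: "integrable M (\<lambda>x. h ((T ^^ j) x))" "(\<integral>x. h ((T ^^ j) x) \<partial>M) = (\<integral>x. h x \<partial>M)" for j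
  proof -
    show "(\<integral>x. h ((T ^^ j) x) \<partial>M) = (\<integral>x. h x \<partial>M)"
      using integral_distr[OF Tn[of j] h] by (simp add: inv_n)
    show "integrable M (\<lambda>x. h ((T ^^ j) x))"
      using integrable_distr_eq[OF Tn[of j] h] int(3) by (simp add: inv_n)
  qed
  \<comment> \<open>\<open>key\<close> is integrated and divided by \<open>L\<close>; the defect
    \<open>N / L\<close> vanishes as \<open>L\<close> grows.\<close>
  have L: "(1 - real N * (1 / real L)) * (\<integral>x. F x \<partial>M) - e \<le> (\<integral>x. h x \<partial>M)" if "L > 0" for L
  proof -
    have "(\<integral>x. (real L - real N) * F x - L * e \<partial>M) \<le> (\<integral>x. (\<Sum>j<L. h ((T ^^ j) x)) \<partial>M)"
      using int int_hj key by (intro integral_mono) auto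
    also have "\<dots> = L * (\<integral>x. h x \<partial>M)" using int_hj by simp
    also have "(\<integral>x. (real L - real N) * F x - L * e \<partial>M) = (real L - real N) * (\<integral>x. F x \<partial>M) - L * e"
      using int by (simp add: prob_space)
    finally show ?thesis using that by (simp add: field_simps)
  qed
  have "(\<lambda>L. (1 - real N * (1 / real L)) * (\<integral>x. F x \<partial>M) - e) \<longlonglongrightarrow> (1 - real N * 0) * (\<integral>x. F x \<partial>M) - e"
    by (intro tendsto_intros lim_1_over_n)
  then have "(1 - real N * 0) * (\<integral>x. F x \<partial>M) - e \<le> (\<integral>x. h x \<partial>M)"
    by (rule LIMSEQ_le_const2) (use L in \<open>auto intro!: exI[of _ 1]\<close>)
  also have "(\<integral>x. h x \<partial>M) = (\<integral>x. f x \<partial>M) + K * prob (space M - E N)"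
    unfolding h_def using int by (subst Bochner_Integration.integral_add) (auto simp: less_top[symmetric])
  also have "K * prob (space M - E N) \<le> K * e"
    using N K by (intro mult_left_mono) (auto simp: prob_compl)
  finally show "(\<integral>x. F x \<partial>M) \<le> (\<integral>x. f x \<partial>M) + e'"
    using e(2) by (simp add: algebra_simps)
qed

section \<open>Cylinder sets\<close>

definition prefix_word :: "nat \<Rightarrow> (nat \<Rightarrow> nat) \<Rightarrow> nat list" where
  "prefix_word n x = map x [0..<n]"

definition cyl :: "(nat \<Rightarrow> nat) set \<Rightarrow> nat list \<Rightarrow> (nat \<Rightarrow> nat) set" where
  "cyl X w = {x \<in> X. prefix_word (length w) x = w}"

lemma cyl_subset: "cyl X w \<subseteq> X"
  unfolding cyl_def by blast

definition words :: "nat \<Rightarrow> nat \<Rightarrow> nat list set" where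
  "words k n = {w. set w \<subseteq> {1..k} \<and> length w = n}"

lemma length_prefix_word [simp]: "length (prefix_word n x) = n"
  by (simp add: prefix_word_def)

lemma prefix_word_eq_iff: "prefix_word n x = prefix_word n y \<longleftrightarrow> (\<forall>i<n. x i = y i)"
  by (auto simp: prefix_word_def)

lemma take_prefix_word: "m \<le> n \<Longrightarrow> take m (prefix_word n x) = prefix_word m x"
  by (simp add: prefix_word_def take_map)

lemma prefix_word_Suc: "prefix_word (Suc n) x = prefix_word n x @ [x n]"
  by (simp add: prefix_word_def)

lemma shift_map_funpow: "(shift_map ^^ j) x = (\<lambda>i. x (i + j))"
proof (induction j)
  case (Suc j)
  then show ?case unfolding funpow.simps o_apply Suc by (simp add: shift_map_def)
qed simp

lemma prefix_word_Suc_Cons: "prefix_word (Suc n) x = x 0 # prefix_word n (shift_map x)"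
proof -
  have "[0..<Suc n] = 0 # map Suc [0..<n]"
    unfolding map_Suc_upt by (rule upt_conv_Cons) simp
  then show ?thesis by (simp add: prefix_word_def shift_map_def del: upt_Suc)
qed

lemma prefix_word_shift: "prefix_word n ((shift_map ^^ j) x) = map x [j..<j + n]"
  by (simp add: prefix_word_def shift_map_funpow list_eq_iff_nth_eq add.commute)

lemma prefix_word_add: "prefix_word (m + n) x = prefix_word m x @ prefix_word n ((shift_map ^^ m) x)"
  unfolding prefix_word_shift using upt_add_eq_append[of 0 m n] by (simp add: prefix_word_def)

lemma finite_words [simp]: "finite (words k n)"
  unfolding words_def by (rule finite_lists_length_eq) simp

lemma card_words: "card (words k n) = k ^ n"
  unfolding words_def using card_lists_length_eq[of "{1..k}" n] by simp

text \<open>A basic open box restricts finitely many coordinates, hence contains the cylinder around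
  each of its points given by a long enough prefix.\<close>

lemma open_fun_prefix:
  fixes U :: "(nat \<Rightarrow> nat) set"
  assumes "open U" "x \<in> U"
  obtains n where "\<And>y. prefix_word n y = prefix_word n x \<Longrightarrow> y \<in> U"
proof -
  have "openin (product_topology (\<lambda>i. euclidean) UNIV) U"
    using assms by (simp add: open_fun_def)
  from product_topology_open_contains_basis[OF this assms(2)]
  obtain V where V: "x \<in> Pi\<^sub>E UNIV V" "finite {i. V i \<noteq> (UNIV :: nat set)}" "Pi\<^sub>E UNIV V \<subseteq> U"
    by auto
  define n where "n = Suc (Max (insert 0 {i. V i \<noteq> UNIV}))"
  have n: "i < n" if "V i \<noteq> UNIV" for i
    using that V(2) Max_ge[of "insert 0 {i. V i \<noteq> UNIV}" i] by (auto simp: n_def less_Suc_eq_le)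
  show thesis
  proof (rule that[of n])
    fix y assume "prefix_word n y = prefix_word n x"
    then have "\<forall>i<n. y i = x i" by (simp add: prefix_word_eq_iff)
    then have "y i \<in> V i" for i
      using V(1) n[of i] by (cases "V i = UNIV") (auto simp: PiE_iff)
    then show "y \<in> U" using V(3) by auto
  qed
qed

lemma clopen_prefix_set: "open {x. prefix_word n x \<in> S}" "closed {x. prefix_word n x \<in> S}"
proof -
  have op: "open {x. prefix_word n x \<in> S}" for S
  proof -
    have "open {x. prefix_word n x = w}" for w
    proof (cases "length w = n")
      case True
      have "{x. prefix_word n x = w} = (\<Inter>i<n. (\<lambda>x. x i) -` {w ! i})"
        using True by (auto simp: prefix_word_def list_eq_iff_nth_eq)
      moreover have "open ((\<lambda>x :: nat \<Rightarrow> nat. x i) -` {w ! i})" for i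
        by (rule open_vimage) (auto intro: discrete_topology_class.open_discrete)
      ultimately show ?thesis by (auto intro!: open_INT)
    next
      case False
      then have "{x. prefix_word n x = w} = {}" by auto
      then show ?thesis by simp
    qed
    then have "open (\<Union>w\<in>S. {x. prefix_word n x = w})" by blast
    moreover have "(\<Union>w\<in>S. {x. prefix_word n x = w}) = {x. prefix_word n x \<in> S}" by auto
    ultimately show ?thesis by simp
  qed
  show "open {x. prefix_word n x \<in> S}" by (rule op)
  have "- {x. prefix_word n x \<in> S} = {x. prefix_word n x \<in> - S}" by auto
  then show "closed {x. prefix_word n x \<in> S}" using op[of "- S"] by (simp add: closed_def)
qed

text \<open>Every open set is a union of cylinders, and there are only countably many words.\<close>

lemma sets_restrict_borel_cyl:
  "sets (restrict_space borel X) = sigma_sets X (range (cyl X))"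
proof
  have cyl: "cyl X w \<in> sets (restrict_space borel X)" for w
  proof -
    have "cyl X w = X \<inter> {x. prefix_word (length w) x \<in> {w}}" by (auto simp: cyl_def)
    then show ?thesis
      using clopen_prefix_set(1)[of "length w" "{w}"]
      by (auto simp: sets_restrict_space intro!: imageI borel_open)
  qed
  then have "sigma_sets (space (restrict_space borel X)) (range (cyl X)) \<subseteq> sets (restrict_space borel X)"
    by (intro sets.sigma_sets_subset) auto
  then show "sigma_sets X (range (cyl X)) \<subseteq> sets (restrict_space borel X)"
    by (simp add: space_restrict_space)
  have *: "X \<inter> A \<in> sigma_sets X (range (cyl X))" if "A \<in> sigma_sets UNIV {S. open S}" for A
    using that
  proof induction
    case (Basic U)
    have "X \<inter> U = (\<Union>w\<in>{w. cyl X w \<subseteq> U}. cyl X w)"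
    proof (intro equalityI subsetI)
      fix x assume x: "x \<in> X \<inter> U"
      then obtain n where "\<And>y. prefix_word n y = prefix_word n x \<Longrightarrow> y \<in> U"
        using Basic open_fun_prefix by blast
      then have "cyl X (prefix_word n x) \<subseteq> U" "x \<in> cyl X (prefix_word n x)"
        using x by (auto simp: cyl_def)
      then show "x \<in> (\<Union>w\<in>{w. cyl X w \<subseteq> U}. cyl X w)" by blast
    next
      fix x assume "x \<in> (\<Union>w\<in>{w. cyl X w \<subseteq> U}. cyl X w)"
      then obtain w where "cyl X w \<subseteq> U" "x \<in> cyl X w" by blast
      then show "x \<in> X \<inter> U" using cyl_subset[of X w] by blast
    qed
    also have "\<dots> \<in> sigma_sets X (range (cyl X))"
    proof -
      interpret sigma_algebra X "sigma_sets X (range (cyl X))"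
        by (rule sigma_algebra_sigma_sets) (simp add: image_subset_iff cyl_subset)
      show ?thesis
        by (rule countable_UN') (auto intro: sigma_sets.Basic)
    qed
    finally show ?case .
  next
    case Empty
    then show ?case by (simp add: sigma_sets.Empty)
  next
    case (Compl a)
    have "X \<inter> (UNIV - a) = X - (X \<inter> a)" by auto
    then show ?case using Compl by (simp add: sigma_sets.Compl)
  next
    case (Union a)
    have *: "X \<inter> \<Union> (range a) = (\<Union>i. X \<inter> a i)" by auto
    show ?case unfolding * by (rule sigma_sets.Union) (rule Union(2))
  qed
  show "sets (restrict_space borel X) \<subseteq> sigma_sets X (range (cyl X))"
  proof
    fix A assume "A \<in> sets (restrict_space borel X)"
    then obtain B where "B \<in> sets borel" "A = X \<inter> B" by (auto simp: sets_restrict_space)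
    moreover have "sets borel = sigma_sets UNIV {S :: (nat \<Rightarrow> nat) set. open S}"
      unfolding borel_def by (rule sets_measure_of) simp
    ultimately show "A \<in> sigma_sets X (range (cyl X))" using * by simp
  qed
qed

lemma cyl_Int: "cyl X v \<inter> cyl X w \<in> insert {} (range (cyl X))"
proof -
  have aux: "cyl X v \<inter> cyl X w \<in> insert {} (range (cyl X))" if "length v \<le> length w" for v w
  proof -
    have "take (length v) w = v \<longleftrightarrow> prefix_word (length v) x = v" if "x \<in> cyl X w" for x
      using that take_prefix_word[OF \<open>length v \<le> length w\<close>, of x] by (simp add: cyl_def)
    then have "cyl X v \<inter> cyl X w = (if take (length v) w = v then cyl X w else {})"
      by (auto simp: cyl_def)
    then show ?thesis by simp
  qed
  show ?thesis
    using aux[of v w] aux[of w v] by (metis Int_commute linear)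
qed

text \<open>Cylinders together with the empty set are stable under intersection: two cylinders are
  nested or disjoint. The cylinder of the empty word is \<open>X\<close> itself and serves as the
  exhausting sequence.\<close>

lemma measure_eqI_cyl:
  assumes M: "finite_measure M" "sets M = sets (restrict_space borel X)"
    and N: "finite_measure N" "sets N = sets (restrict_space borel X)"
    and eq: "\<And>w. measure M (cyl X w) = measure N (cyl X w)"
  shows "M = N"
proof (rule measure_eqI_generator_eq[where \<Omega> = X and E = "insert {} (range (cyl X))" and A = "\<lambda>_. X"])
  have ss: "sigma_sets X (insert {} (range (cyl X))) = sigma_sets X (range (cyl X))"
    by (intro sigma_sets_eqI) (auto intro: sigma_sets.Empty)
  show "Int_stable (insert {} (range (cyl X)))"
    unfolding Int_stable_def using cyl_Int[of X] by auto
  show "sets M = sigma_sets X (insert {} (range (cyl X)))" "sets N = sigma_sets X (insert {} (range (cyl X)))"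
    using M N by (simp_all add: ss sets_restrict_borel_cyl)
  have "cyl X [] = X" by (auto simp: cyl_def prefix_word_def)
  then show "range (\<lambda>_. X) \<subseteq> insert {} (range (cyl X))" by (metis image_subset_iff insertI2 rangeI)
  show "emeasure M A = emeasure N A" if "A \<in> insert {} (range (cyl X))" for A
    using that eq finite_measure.emeasure_eq_measure[OF M(1)] finite_measure.emeasure_eq_measure[OF N(1)]
    by auto
  show "emeasure M X \<noteq> \<infinity>" for i
    using finite_measure.emeasure_finite[OF M(1)] by simp
qed (simp_all add: image_subset_iff cyl_subset)

lemma measurable_prefix_word:
  assumes "sets M = sets (restrict_space borel X)"
  shows "prefix_word n \<in> measurable M (count_space UNIV)"
proof -
  have sp: "space M = X" using sets_eq_imp_space_eq[OF assms] by (simp add: space_restrict_space)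
  have "prefix_word n -` {w} \<inter> space M \<in> sets M" for w
  proof -
    have "prefix_word n -` {w} \<inter> space M = X \<inter> {x. prefix_word n x \<in> {w}}" using sp by auto
    then show ?thesis
      using clopen_prefix_set(1)[of n "{w}"]
      by (auto simp: assms sets_restrict_space intro!: imageI borel_open)
  qed
  then show ?thesis by (simp add: measurable_count_space_eq_countable)
qed

text \<open>The alphabet size, bound by an existential quantifier in \<open>subshift\<close>,
  becomes a parameter: it enters the estimates as \<open>ln k\<close> and makes the words of a given
  length a finite set.\<close>

locale subshift_loc =
  fixes X :: "(nat \<Rightarrow> nat) set" and k :: nat
  assumes ne: "X \<noteq> {}" and closed_X: "closed X"
    and letters: "\<And>x i. x \<in> X \<Longrightarrow> x i \<in> {1..k}"
    and shift_X: "\<And>x. x \<in> X \<Longrightarrow> shift_map x \<in> X"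
begin

lemma k_pos: "k \<ge> 1"
proof -
  obtain x where "x \<in> X" using ne by blast
  from letters[OF this, of 0] show ?thesis by simp
qed

lemma shift_pow_X: "x \<in> X \<Longrightarrow> (shift_map ^^ j) x \<in> X"
  by (induction j) (auto intro: shift_X)

lemma prefix_word_words: "x \<in> X \<Longrightarrow> prefix_word n x \<in> words k n"
  using letters by (auto simp: words_def prefix_word_def)

lemma compact_X: "compact X"
proof -
  have "compact (Pi\<^sub>E UNIV (\<lambda>_::nat. {1..k}))"
    using compactin_PiE[of "\<lambda>_. euclidean" UNIV "\<lambda>_::nat. {1..k}"]
    by (simp add: finite_imp_compact euclidean_product_topology)
  moreover have "X \<subseteq> Pi\<^sub>E UNIV (\<lambda>_::nat. {1..k})"
    using letters by auto
  ultimately show ?thesis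
    using closed_X compact_Int_closed[of "Pi\<^sub>E UNIV (\<lambda>_::nat. {1..k})" X] by (simp add: inf.absorb2)
qed

end

section \<open>Invariant measures from cylinder weights\<close>

context subshift_loc
begin

lemma space_eq_X: "sets M = sets (restrict_space borel X) \<Longrightarrow> space M = X"
  using sets_eq_imp_space_eq[of M "restrict_space borel X"] by (simp add: space_restrict_space)

lemma cyl_in_sets: "cyl X w \<in> sets (restrict_space borel X)"
  by (simp add: sets_restrict_borel_cyl)

lemma prefix_set_in_sets:
  assumes "sets M = sets (restrict_space borel X)"
  shows "{x \<in> X. prefix_word n x \<in> S} \<in> sets M"
proof -
  have "{x \<in> X. prefix_word n x \<in> S} = X \<inter> {x. prefix_word n x \<in> S}" by blast
  then show ?thesis
    by (auto simp: assms sets_restrict_space intro!: imageI borel_open clopen_prefix_set)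
qed

lemma cyl_disjoint: "length v = length w \<Longrightarrow> v \<noteq> w \<Longrightarrow> cyl X v \<inter> cyl X w = {}"
  unfolding cyl_def by auto

lemma cyl_Cons: "shift_map -` cyl X w \<inter> X = (\<Union>a\<in>{1..k}. cyl X (a # w))"
proof (intro equalityI subsetI)
  fix x assume "x \<in> shift_map -` cyl X w \<inter> X"
  then have "x \<in> X" "prefix_word (length w) (shift_map x) = w" by (simp_all add: cyl_def)
  then have "x \<in> cyl X (x 0 # w)" by (simp add: cyl_def prefix_word_Suc_Cons)
  then show "x \<in> (\<Union>a\<in>{1..k}. cyl X (a # w))" using letters[OF \<open>x \<in> X\<close>] by blast
next
  fix x assume "x \<in> (\<Union>a\<in>{1..k}. cyl X (a # w))"
  then obtain a where "x \<in> cyl X (a # w)" by blast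
  then show "x \<in> shift_map -` cyl X w \<inter> X"
    using shift_X by (simp add: cyl_def prefix_word_Suc_Cons)
qed

lemma cyl_snoc: "cyl X w = (\<Union>a\<in>{1..k}. cyl X (w @ [a]))"
proof (intro equalityI subsetI)
  fix x assume "x \<in> cyl X w"
  then have "x \<in> X" "x \<in> cyl X (w @ [x (length w)])" by (simp_all add: cyl_def prefix_word_Suc)
  then show "x \<in> (\<Union>a\<in>{1..k}. cyl X (w @ [a]))" using letters[OF \<open>x \<in> X\<close>] by blast
next
  fix x assume "x \<in> (\<Union>a\<in>{1..k}. cyl X (w @ [a]))"
  then obtain a where "x \<in> cyl X (w @ [a])" by blast
  then show "x \<in> cyl X w" by (simp add: cyl_def prefix_word_Suc)
qed

lemma measurable_shift:
  assumes "sets M = sets (restrict_space borel X)"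
  shows "shift_map \<in> measurable M M"
proof (rule measurable_sigma_sets[of _ X "range (cyl X)"])
  show "sets M = sigma_sets X (range (cyl X))" by (simp add: assms sets_restrict_borel_cyl)
  show "range (cyl X) \<subseteq> Pow X" by (simp add: image_subset_iff cyl_subset)
  show "shift_map \<in> space M \<rightarrow> X" by (simp add: space_eq_X[OF assms] shift_X)
  show "shift_map -` y \<inter> space M \<in> sets M" if "y \<in> range (cyl X)" for y
    using that cyl_in_sets by (auto simp: space_eq_X[OF assms] cyl_Cons assms)
qed

lemma measure_cyl_Cons:
  assumes M: "finite_measure M" "sets M = sets (restrict_space borel X)"
  shows "measure M (shift_map -` cyl X w \<inter> X) = (\<Sum>a\<in>{1..k}. measure M (cyl X (a # w)))"
  unfolding cyl_Cons
  by (rule finite_measure.finite_measure_finite_Union[OF M(1)])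
    (simp_all add: M(2) cyl_in_sets image_subset_iff disjoint_family_on_def cyl_disjoint)

lemma measure_cyl_snoc:
  assumes M: "finite_measure M" "sets M = sets (restrict_space borel X)"
  shows "measure M (cyl X w) = (\<Sum>a\<in>{1..k}. measure M (cyl X (w @ [a])))"
  by (subst cyl_snoc, rule finite_measure.finite_measure_finite_Union[OF M(1)])
    (simp_all add: M(2) cyl_in_sets image_subset_iff disjoint_family_on_def cyl_disjoint)

lemma measure_distr_shift_cyl:
  assumes "sets M = sets (restrict_space borel X)"
  shows "measure (distr M M shift_map) (cyl X w) = measure M (shift_map -` cyl X w \<inter> X)"
  using measure_distr[OF measurable_shift[OF assms], of "cyl X w"]
  by (simp add: assms cyl_in_sets space_eq_X[OF assms])

text \<open>Prepending a letter enumerates the shift preimage of a cylinder, so invariance becomes a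
  family of linear equations between weights, which survives pointwise limits.\<close>

lemma invariant_iff:
  "M \<in> invariant_measures X \<longleftrightarrow> prob_space M \<and> sets M = sets (restrict_space borel X) \<and>
    (\<forall>w. measure M (cyl X w) = (\<Sum>a\<in>{1..k}. measure M (cyl X (a # w))))"
proof (cases "prob_space M \<and> sets M = sets (restrict_space borel X)")
  case True
  then have p: "prob_space M" and s: "sets M = sets (restrict_space borel X)" by auto
  interpret prob_space M by (rule p)
  have "distr M M shift_map = M \<longleftrightarrow> (\<forall>w. measure M (cyl X w) = measure (distr M M shift_map) (cyl X w))"
    using measure_eqI_cyl[of "distr M M shift_map" X M] s measurable_shift[OF s] finite_measure_axioms
    by (auto simp: finite_measure_distr)
  then show ?thesis using True
    by (simp add: invariant_measures_def measure_distr_shift_cyl measure_cyl_Cons finite_measure_axioms)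
qed (auto simp: invariant_measures_def)

text \<open>Kolmogorov extension by Caratheodory: sets decided by finitely many letters form an
  algebra of compact sets, so continuity at the empty set is automatic. \<open>p_snoc\<close> makes
  the content well defined, \<open>p_Cons\<close> is invariance, and \<open>supp\<close> keeps the
  mass on \<open>X\<close>.\<close>

lemma exists_invariant_measure_cyl:
  fixes p :: "nat list \<Rightarrow> real"
  assumes nn: "\<And>w. 0 \<le> p w" and p_Nil: "p [] = 1"
    and p_snoc: "\<And>w. p w = (\<Sum>a\<in>{1..k}. p (w @ [a]))"
    and p_Cons: "\<And>w. p w = (\<Sum>a\<in>{1..k}. p (a # w))"
    and supp: "\<And>w. cyl X w = {} \<Longrightarrow> p w = 0"
  shows "\<exists>M\<in>invariant_measures X. \<forall>w. measure M (cyl X w) = p w"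
proof -
  define det where "det n A \<longleftrightarrow> A \<subseteq> X \<and>
    (\<forall>x\<in>X. \<forall>y\<in>X. prefix_word n x = prefix_word n y \<longrightarrow> (x \<in> A \<longleftrightarrow> y \<in> A))" for n A
  define alg where "alg = {A. \<exists>n. det n A}"
  \<comment> \<open>The content of \<open>A\<close> seen at resolution \<open>n\<close>. It is
    meaningful only for lengths that decide \<open>A\<close>, and for those it does not depend on
    \<open>n\<close>.\<close>
  define g where "g n A = (\<Sum>w\<in>prefix_word n ` A. p w)" for n A
  have det_Suc: "det (Suc n) A" if "det n A" for n A
    using that unfolding det_def prefix_word_Suc append1_eq_conv by blast
  have det_mono: "det m A" if "det n A" "n \<le> m" for n m A
    using that(2,1) by (induction rule: dec_induct) (auto intro: det_Suc)
  have fin: "finite (prefix_word n ` A)" if "A \<subseteq> X" for n A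
    by (rule finite_subset[of _ "words k n"]) (use that prefix_word_words in auto)
  have g_Suc: "g (Suc n) A = g n A" if d: "det n A" for n A
  proof -
    have AX: "A \<subseteq> X" using d by (simp add: det_def)
    let ?e = "\<lambda>(w, a). w @ [a]"
    let ?B = "prefix_word n ` A \<times> {1..k}"
    have "g n A = (\<Sum>w\<in>prefix_word n ` A. \<Sum>a\<in>{1..k}. p (w @ [a]))"
      unfolding g_def by (intro sum.cong refl p_snoc)
    also have "\<dots> = (\<Sum>z\<in>?B. p (?e z))"
      by (simp add: sum.cartesian_product split_beta)
    also have "\<dots> = (\<Sum>v\<in>?e ` ?B. p v)"
      by (subst sum.reindex) (auto simp: inj_on_def comp_def)
    \<comment> \<open>A one-letter extension outside the image is the prefix of no point of
      \<open>X\<close>: such a point would share its first \<open>n\<close> letters with a point of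
      \<open>A\<close> and so lie in \<open>A\<close>. Hence \<open>supp\<close> gives it weight
      zero.\<close>
    also have "\<dots> = (\<Sum>v\<in>prefix_word (Suc n) ` A. p v)"
    proof (rule sum.mono_neutral_right)
      show "finite (?e ` ?B)" using fin[OF AX] by auto
      show "prefix_word (Suc n) ` A \<subseteq> ?e ` ?B"
        using AX letters by (force simp: prefix_word_Suc)
      show "\<forall>v\<in>?e ` ?B - prefix_word (Suc n) ` A. p v = 0"
      proof
        fix v assume "v \<in> ?e ` ?B - prefix_word (Suc n) ` A"
        then obtain x a where v: "x \<in> A" "v = prefix_word n x @ [a]" "v \<notin> prefix_word (Suc n) ` A"
          by auto
        have "y \<notin> cyl X v" for y
        proof
          assume "y \<in> cyl X v"
          then have y: "y \<in> X" "prefix_word (Suc n) y = v" by (auto simp: cyl_def v(2))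
          then have "prefix_word n y = prefix_word n x" by (simp add: prefix_word_Suc v(2))
          then have "y \<in> A" using d v(1) y(1) AX unfolding det_def by blast
          then show False using v(3) y(2) by blast
        qed
        then show "p v = 0" using supp by blast
      qed
    qed
    finally show ?thesis by (simp add: g_def)
  qed
  have g_mono: "g m A = g n A" if "det n A" "n \<le> m" for n m A
    using that(2,1)
  proof (induction rule: dec_induct)
    case (step m)
    then show ?case using g_Suc[OF det_mono[OF step(4) step(1)]] by simp
  qed simp
  have g_eq: "g n A = g m A" if "det n A" "det m A" for n m A
    using g_mono[OF that(1), of "max n m"] g_mono[OF that(2), of "max n m"] by simp
  define f where "f A = ennreal (g (SOME n. det n A) A)" for A
  have f_eq: "f A = ennreal (g n A)" if "det n A" for n A
    unfolding f_def using someI[of "\<lambda>n. det n A", OF that] that g_eq by metis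
  have alg_algebra: "algebra X alg"
    unfolding algebra_iff_Int
  proof (intro conjI ballI)
    show "alg \<subseteq> Pow X" by (auto simp: alg_def det_def)
    show "{} \<in> alg" by (auto simp: alg_def det_def)
    show "X - A \<in> alg" if "A \<in> alg" for A
      using that unfolding alg_def det_def by blast
    show "A \<inter> B \<in> alg" if "A \<in> alg" "B \<in> alg" for A B
    proof -
      obtain n m where "det n A" "det m B" using \<open>A \<in> alg\<close> \<open>B \<in> alg\<close> by (auto simp: alg_def)
      then have "det (max n m) A" "det (max n m) B" using det_mono by auto
      then have "det (max n m) (A \<inter> B)" unfolding det_def by blast
      then show ?thesis by (auto simp: alg_def)
    qed
  qed
  interpret alg: algebra X alg by (rule alg_algebra)
  have pos: "positive alg f"
  proof -
    have "det 0 {}" by (auto simp: det_def)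
    from f_eq[OF this] show ?thesis by (simp add: positive_def g_def)
  qed
  have add: "additive alg f"
    unfolding additive_def
  proof (intro ballI impI)
    fix A B assume "A \<in> alg" "B \<in> alg" and disj: "A \<inter> B = {}"
    then obtain n m where "det n A" "det m B" by (auto simp: alg_def)
    then have d: "det (max n m) A" "det (max n m) B" using det_mono by auto
    define N where "N = max n m"
    have dN: "det N A" "det N B" using d by (auto simp: N_def)
    have AB: "A \<subseteq> X" "B \<subseteq> X" using dN by (auto simp: det_def)
    have dU: "det N (A \<union> B)" using dN unfolding det_def by blast
    have "prefix_word N ` A \<inter> prefix_word N ` B = {}"
    proof (rule ccontr)
      assume "prefix_word N ` A \<inter> prefix_word N ` B \<noteq> {}"
      then obtain x y where xy: "x \<in> A" "y \<in> B" "prefix_word N x = prefix_word N y" by auto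
      then have "y \<in> A" using dN(1) AB unfolding det_def by blast
      then show False using xy disj by blast
    qed
    then have "g N (A \<union> B) = g N A + g N B"
      unfolding g_def image_Un by (intro sum.union_disjoint fin AB)
    moreover have "0 \<le> g N A" "0 \<le> g N B" unfolding g_def by (auto intro: sum_nonneg nn)
    ultimately show "f (A \<union> B) = f A + f B"
      by (simp add: f_eq[OF dN(1)] f_eq[OF dN(2)] f_eq[OF dU] ennreal_plus)
  qed
  have cl: "closed A" if "A \<in> alg" for A
  proof -
    obtain n where "det n A" using \<open>A \<in> alg\<close> by (auto simp: alg_def)
    then have "A = X \<inter> {x. prefix_word n x \<in> prefix_word n ` A}"
      unfolding det_def by blast
    then show ?thesis using closed_Int[OF closed_X clopen_prefix_set(2)] by metis
  qed
  have cont: "(\<lambda>i. f (A i)) \<longlonglongrightarrow> 0" if A: "range A \<subseteq> alg" "decseq A" "(\<Inter>i. A i) = {}" for A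
  proof -
    \<comment> \<open>Finite intersection property: a decreasing sequence of closed subsets of the
      compact \<open>X\<close> with empty intersection reaches the empty set.\<close>
    have "\<exists>i. A i = {}"
    proof (rule ccontr)
      assume *: "\<nexists>i. A i = {}"
      have "X \<inter> (\<Inter>i\<in>UNIV. A i) \<noteq> {}"
      proof (rule compact_imp_fip_image[OF compact_X])
        show "closed (A i)" for i using A(1) cl by blast
        fix I :: "nat set" assume I: "finite I"
        have "A (Max (insert 0 I)) \<subseteq> A i" if "i \<in> I" for i
          by (rule decseqD[OF A(2)]) (rule Max_ge, use I that in auto)
        moreover have "A (Max (insert 0 I)) \<subseteq> X" using A(1) by (auto simp: alg_def det_def)
        ultimately show "X \<inter> (\<Inter>i\<in>I. A i) \<noteq> {}"
          using * by blast
      qed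
      then show False using A(3) by simp
    qed
    then obtain i where i: "A i = {}" by blast
    have "A j = {}" if "i \<le> j" for j
      using decseqD[OF A(2) that] i by simp
    then have "\<forall>\<^sub>F j in sequentially. f (A j) = 0"
      using pos by (intro eventually_sequentiallyI[of i]) (simp add: positive_def)
    then show ?thesis by (rule tendsto_eventually)
  qed
  have "\<exists>\<mu> :: (nat \<Rightarrow> nat) set \<Rightarrow> ennreal. (\<forall>s\<in>alg. \<mu> s = f s) \<and> measure_space X (sigma_sets X alg) \<mu>"
    by (rule alg.caratheodory_empty_continuous[OF pos add _ cont]) (simp add: f_def)
  then obtain \<mu> :: "(nat \<Rightarrow> nat) set \<Rightarrow> ennreal"
    where \<mu>: "\<And>s. s \<in> alg \<Longrightarrow> \<mu> s = f s" "measure_space X (sigma_sets X alg) \<mu>"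
    by blast
  have det_cyl: "det (length w) (cyl X w)" for w
    unfolding det_def cyl_def by auto
  have ss: "sigma_sets X alg = sigma_sets X (range (cyl X))"
  proof (rule sigma_sets_eqI)
    fix A assume "A \<in> alg"
    then obtain n where "det n A" by (auto simp: alg_def)
    then have "A = {x \<in> X. prefix_word n x \<in> prefix_word n ` A}"
      unfolding det_def by blast
    then show "A \<in> sigma_sets X (range (cyl X))"
      unfolding sets_restrict_borel_cyl[symmetric] using prefix_set_in_sets[OF refl] by metis
  next
    fix A assume "A \<in> range (cyl X)"
    then have "A \<in> alg" using det_cyl by (auto simp: alg_def)
    then show "A \<in> sigma_sets X alg" by (rule sigma_sets.Basic)
  qed
  define M where "M = measure_of X (range (cyl X)) \<mu>"
  have sub: "range (cyl X) \<subseteq> Pow X" by (simp add: image_subset_iff cyl_subset)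
  have sets_M: "sets M = sets (restrict_space borel X)"
    by (simp add: M_def sets_measure_of[OF sub] sets_restrict_borel_cyl)
  have emeas: "emeasure M (cyl X w) = ennreal (p w)" for w
  proof -
    have "emeasure M (cyl X w) = \<mu> (cyl X w)"
    proof (rule emeasure_measure_of[OF M_def sub])
      show "positive (sets M) \<mu>" "countably_additive (sets M) \<mu>"
        using \<mu>(2) by (simp_all add: measure_space_def sets_M sets_restrict_borel_cyl ss)
    qed (simp add: sets_M cyl_in_sets)
    also have "\<dots> = ennreal (g (length w) (cyl X w))"
    proof -
      have "cyl X w \<in> alg" unfolding alg_def using det_cyl by blast
      from \<mu>(1)[OF this] show ?thesis by (simp add: f_eq[OF det_cyl])
    qed
    also have "g (length w) (cyl X w) = p w"
    proof (cases "cyl X w = {}")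
      case True
      then show ?thesis by (simp add: g_def supp)
    next
      case False
      moreover have "prefix_word (length w) x = w" if "x \<in> cyl X w" for x
        using that by (simp add: cyl_def)
      ultimately have "prefix_word (length w) ` cyl X w = {w}"
        by (metis (no_types, lifting) image_cong image_constant_conv)
      then show ?thesis by (simp add: g_def)
    qed
    finally show ?thesis .
  qed
  have cyl_Nil: "cyl X [] = X" by (simp add: cyl_def prefix_word_def)
  have "prob_space M"
    by (rule prob_spaceI) (use emeas[of "[]"] in \<open>simp add: space_eq_X[OF sets_M] cyl_Nil p_Nil\<close>)
  moreover have meas: "measure M (cyl X w) = p w" for w
    using emeas[of w] nn by (simp add: measure_def)
  ultimately have "M \<in> invariant_measures X"
    unfolding invariant_iff meas using p_Cons sets_M by blast
  then show ?thesis using meas by (intro bexI[of _ M]) simp_all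
qed

text \<open>Cylinder weights form a point of the cube \<open>[0,1]\<close> indexed by the countable
  set of words, which is sequentially compact. The limit weights satisfy the linear equations of an
  invariant measure; \<open>inv\<close> asks for invariance only in the limit.\<close>

lemma convergent_subsequence_cyl:
  fixes M :: "nat \<Rightarrow> (nat \<Rightarrow> nat) measure"
  assumes M: "\<And>n. prob_space (M n)" "\<And>n. sets (M n) = sets (restrict_space borel X)"
    and inv: "\<And>w. (\<lambda>n. measure (M n) (cyl X w) - measure (M n) (shift_map -` cyl X w \<inter> X)) \<longlonglongrightarrow> 0"
  obtains r m where "strict_mono (r :: nat \<Rightarrow> nat)" "m \<in> invariant_measures X"
    "\<And>w. (\<lambda>n. measure (M (r n)) (cyl X w)) \<longlonglongrightarrow> measure m (cyl X w)"
proof -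
  define q where "q n w = measure (M n) (cyl X w)" for n w
  have "compact (Pi\<^sub>E UNIV (\<lambda>_::nat list. {0..1::real}))"
    using compactin_PiE[of "\<lambda>_. euclidean" UNIV "\<lambda>_::nat list. {0..1::real}"]
    by (simp add: euclidean_product_topology)
  then have "seq_compact (Pi\<^sub>E UNIV (\<lambda>_::nat list. {0..1::real}))"
    by (rule compact_imp_seq_compact)
  moreover have "\<forall>n. q n \<in> Pi\<^sub>E UNIV (\<lambda>_::nat list. {0..1::real})"
    using prob_space.prob_le_1[OF M(1)] by (auto simp: q_def)
  ultimately obtain p and r :: "nat \<Rightarrow> nat" where r: "strict_mono r" "(q \<circ> r) \<longlonglongrightarrow> p"
    by (rule seq_compactE)
  have lim: "(\<lambda>n. q (r n) w) \<longlonglongrightarrow> p w" for w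
    using continuous_on_tendsto_compose[OF continuous_on_product_coordinates[of w] r(2)]
    by (simp add: comp_def)
  note fm = prob_space.finite_measure[OF M(1)]
  have nn: "0 \<le> p w" for w
    by (rule LIMSEQ_le_const[OF lim]) (auto simp: q_def)
  have Nil: "p [] = 1"
  proof -
    have "q n [] = 1" for n
    proof -
      have "cyl X [] = space (M n)"
        by (subst space_eq_X[OF M(2)]) (simp add: cyl_def prefix_word_def)
      then show ?thesis by (simp add: q_def prob_space.prob_space[OF M(1)])
    qed
    then have "(\<lambda>n. q (r n) []) \<longlonglongrightarrow> 1" by simp
    then show ?thesis using lim LIMSEQ_unique by blast
  qed
  have snoc: "p w = (\<Sum>a\<in>{1..k}. p (w @ [a]))" for w
  proof -
    have "(\<lambda>n. \<Sum>a\<in>{1..k}. q (r n) (w @ [a])) \<longlonglongrightarrow> (\<Sum>a\<in>{1..k}. p (w @ [a]))"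
      by (intro tendsto_sum lim)
    then have "(\<lambda>n. q (r n) w) \<longlonglongrightarrow> (\<Sum>a\<in>{1..k}. p (w @ [a]))"
      unfolding q_def by (simp add: measure_cyl_snoc[OF fm M(2), of _ w])
    then show ?thesis using lim LIMSEQ_unique by blast
  qed
  have Cons: "p w = (\<Sum>a\<in>{1..k}. p (a # w))" for w
  proof -
    have "(\<lambda>n. q (r n) w - (\<Sum>a\<in>{1..k}. q (r n) (a # w))) \<longlonglongrightarrow> p w - (\<Sum>a\<in>{1..k}. p (a # w))"
      by (intro tendsto_diff tendsto_sum lim)
    moreover have "(\<lambda>n. q (r n) w - (\<Sum>a\<in>{1..k}. q (r n) (a # w))) \<longlonglongrightarrow> 0"
      using LIMSEQ_subseq_LIMSEQ[OF inv[of w] r(1)]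
      unfolding q_def measure_cyl_Cons[OF fm M(2)] comp_def .
    ultimately show ?thesis using LIMSEQ_unique by fastforce
  qed
  have supp: "p w = 0" if "cyl X w = {}" for w
    by (rule LIMSEQ_unique[OF lim]) (simp add: q_def that)
  have "\<exists>m\<in>invariant_measures X. \<forall>w. measure m (cyl X w) = p w"
  proof (rule exists_invariant_measure_cyl)
    show "p w = (\<Sum>a\<in>{1..k}. p (w @ [a]))" for w by (rule snoc)
    show "p w = (\<Sum>a\<in>{1..k}. p (a # w))" for w by (rule Cons)
  qed (fact nn Nil supp)+
  then obtain m where m: "m \<in> invariant_measures X" "\<forall>w. measure m (cyl X w) = p w" by blast
  show thesis
    by (rule that[OF r(1) m(1)]) (use lim m(2) in \<open>simp add: q_def\<close>)
qed

end

section \<open>Itineraries of finite partitions\<close>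

text \<open>The level sets of this list-valued function are the cells of
  \<open>iterated_join\<close> when \<open>f\<close> labels the cells of the partition.\<close>

definition itinerary :: "('a \<Rightarrow> 'a) \<Rightarrow> ('a \<Rightarrow> 'b) \<Rightarrow> nat \<Rightarrow> 'a \<Rightarrow> 'b list" where
  "itinerary T f n x = map (\<lambda>i. f ((T ^^ i) x)) [0..<n]"

text \<open>An explicit modulus at 0, where \<open>ln\<close> has no limit; it comes from
  \<open>ln (1 / s) \<le> 1 / s - 1\<close> at \<open>s = sqrt t\<close>.\<close>

lemma eta_le_sqrt:
  assumes "0 \<le> t"
  shows "eta t \<le> 2 * sqrt t"
proof (cases "t = 0")
  case False
  then have t: "t > 0" using assms by simp
  define s where "s = sqrt t"
  have s: "s > 0" "t = s * s" using t by (auto simp: s_def)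
  have "ln (1 / s) \<le> 1 / s - 1" using s by (intro ln_le_minus_one) auto
  then have "- ln s \<le> 1 / s" using s by (simp add: ln_div)
  then have "2 * (s * s) * (- ln s) \<le> 2 * (s * s) * (1 / s)"
    using s by (intro mult_left_mono) auto
  then show ?thesis using s unfolding s_def[symmetric] by (simp add: eta_def ln_mult)
qed simp

context prob_space
begin

text \<open>Attained itineraries correspond one to one to nonempty cells.\<close>

lemma Ent_itinerary_partition:
  assumes T: "T \<in> measurable M M" and f: "simple_function M f"
    and P: "P = (\<lambda>v. f -` {v} \<inter> space M) ` (f ` space M)"
  shows "partition_entropy M (iterated_join M T P n) = Ent M (itinerary T f n)"
proof -
  let ?F = "itinerary T f n"
  have sp: "(T ^^ j) x \<in> space M" if "x \<in> space M" for j x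
    using that by (induction j) (auto intro: measurable_space[OF T])
  have cell: "iterated_join M T P n = (\<lambda>v. ?F -` {v} \<inter> space M) ` (?F ` space M)"
  proof (intro equalityI subsetI)
    fix A assume "A \<in> iterated_join M T P n"
    then obtain c where c: "\<forall>i<n. c i \<in> P" "A = {x \<in> space M. \<forall>i<n. (T ^^ i) x \<in> c i}" "A \<noteq> {}"
      by (auto simp: iterated_join_def)
    then obtain x where x: "x \<in> space M" "\<forall>i<n. (T ^^ i) x \<in> c i" by blast
    have "c i = f -` {f ((T ^^ i) x)} \<inter> space M" if "i < n" for i
      using c(1) x(2) that unfolding P by fastforce
    then have "A = {y \<in> space M. \<forall>i<n. f ((T ^^ i) y) = f ((T ^^ i) x)}"
      using c(2) sp by auto
    also have "\<dots> = ?F -` {?F x} \<inter> space M"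
      by (auto simp: itinerary_def)
    finally show "A \<in> (\<lambda>v. ?F -` {v} \<inter> space M) ` (?F ` space M)" using x(1) by blast
  next
    fix A assume "A \<in> (\<lambda>v. ?F -` {v} \<inter> space M) ` (?F ` space M)"
    then obtain x where x: "x \<in> space M" "A = ?F -` {?F x} \<inter> space M" by blast
    define c where "c i = f -` {f ((T ^^ i) x)} \<inter> space M" for i
    have "A = {y \<in> space M. \<forall>i<n. (T ^^ i) y \<in> c i}"
      using sp unfolding x(2) by (auto simp: itinerary_def c_def)
    moreover have "\<forall>i<n. c i \<in> P" using sp[OF x(1)] unfolding P c_def by blast
    moreover have "x \<in> A" using x by simp
    ultimately show "A \<in> iterated_join M T P n" unfolding iterated_join_def by blast
  qed
  have "inj_on (\<lambda>v. ?F -` {v} \<inter> space M) (?F ` space M)"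
    by (auto simp: inj_on_def)
  then show ?thesis
    unfolding partition_entropy_def cell Ent_def
    by (subst sum.reindex) (simp_all add: eta_def sum_negf)
qed

lemma partition_of_simple_function:
  assumes f: "simple_function M f"
  shows "finite_measurable_partition M ((\<lambda>v. f -` {v} \<inter> space M) ` (f ` space M))"
  unfolding finite_measurable_partition_def
proof (intro conjI)
  show "partition_on (space M) ((\<lambda>v. f -` {v} \<inter> space M) ` (f ` space M))"
    by (rule partition_onI) (auto simp: disjnt_def)
qed (use simple_functionD[OF f] in auto)

lemma simple_function_of_partition:
  assumes P: "finite_measurable_partition M P"
  obtains f :: "'a \<Rightarrow> 'a set" where "simple_function M f" "P = (\<lambda>v. f -` {v} \<inter> space M) ` (f ` space M)"
proof -
  have part: "partition_on (space M) P" and fin: "finite P" and meas: "P \<subseteq> sets M"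
    using P by (auto simp: finite_measurable_partition_def)
  define f where "f x = (THE A. A \<in> P \<and> x \<in> A)" for x
  have f: "f x = A" if "A \<in> P" "x \<in> A" for x A
    unfolding f_def
  proof (rule the_equality)
    show "B = A" if "B \<in> P \<and> x \<in> B" for B
      using that \<open>A \<in> P\<close> \<open>x \<in> A\<close> partition_onD2[OF part] by (auto simp: disjoint_def)
  qed (use that in simp)
  have un: "\<Union>P = space M" using partition_onD1[OF part] by simp
  have cell: "f -` {A} \<inter> space M = A" if "A \<in> P" for A
  proof (intro equalityI subsetI)
    fix x assume x: "x \<in> f -` {A} \<inter> space M"
    then obtain B where B: "B \<in> P" "x \<in> B" using un by blast
    then show "x \<in> A" using f[OF B] x by simp
  next
    fix x assume "x \<in> A"
    then show "x \<in> f -` {A} \<inter> space M" using f[OF that] un that by blast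
  qed
  have rng: "f ` space M = P"
  proof (intro equalityI subsetI)
    fix A assume A: "A \<in> P"
    then obtain x where x: "x \<in> A" using partition_onD3[OF part] by (metis all_not_in_conv)
    then have "x \<in> space M" using un A by blast
    then show "A \<in> f ` space M" using f[OF A x] by blast
  next
    fix A assume "A \<in> f ` space M"
    then obtain x where x: "x \<in> space M" "A = f x" by blast
    then obtain B where "B \<in> P" "x \<in> B" using un by blast
    then show "A \<in> P" using f x by blast
  qed
  have "(\<lambda>v. f -` {v} \<inter> space M) ` P = (\<lambda>A. A) ` P" by (rule image_cong[OF refl cell])
  then have 1: "P = (\<lambda>v. f -` {v} \<inter> space M) ` (f ` space M)" by (simp add: rng)
  have "f -` {A} \<inter> space M \<in> sets M" if "A \<in> P" for A
    unfolding cell[OF that] using that meas by blast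
  then have 2: "simple_function M f"
    unfolding simple_function_def rng using fin by blast
  show thesis by (rule that[OF 2 1])
qed

lemma simple_function_itinerary:
  assumes T: "T \<in> measurable M M" and f: "simple_function M f"
  shows "simple_function M (itinerary T f n)" "simple_function M (\<lambda>x. f ((T ^^ n) x))"
proof -
  have Tn: "T ^^ j \<in> measurable M M" for j
    using T by (rule measurable_compose_n)
  have fT: "simple_function M (\<lambda>x. f ((T ^^ n) x))" for n
    unfolding simple_function_def
  proof (intro conjI ballI)
    show "finite ((\<lambda>x. f ((T ^^ n) x)) ` space M)"
      by (rule finite_subset[OF _ simple_functionD(1)[OF f]]) (use measurable_space[OF Tn] in auto)
    fix v
    have "(\<lambda>x. f ((T ^^ n) x)) -` {v} \<inter> space M = (T ^^ n) -` (f -` {v} \<inter> space M) \<inter> space M"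
      using measurable_space[OF Tn] by auto
    also have "\<dots> \<in> sets M" by (rule measurable_sets[OF Tn simple_functionD(2)[OF f]])
    finally show "(\<lambda>x. f ((T ^^ n) x)) -` {v} \<inter> space M \<in> sets M" .
  qed
  show "simple_function M (\<lambda>x. f ((T ^^ n) x))" by (rule fT)
  show "simple_function M (itinerary T f n)"
  proof (induction n)
    case 0
    show ?case by (simp add: itinerary_def)
  next
    case (Suc n)
    have eq: "itinerary T f (Suc n) = (\<lambda>(l, v). l @ [v]) \<circ> (\<lambda>x. (itinerary T f n x, f ((T ^^ n) x)))"
      by (auto simp: itinerary_def)
    show ?case
      unfolding eq by (rule simple_function_compose[OF simple_function_Pair[OF Suc fT[of n]]])
  qed
qed

lemma Ent_const: "Ent M (\<lambda>x. c) = 0"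
proof -
  have "(\<lambda>x. c) ` space M = {c}" using not_empty by auto
  moreover have "(\<lambda>x. c) -` {c} \<inter> space M = space M" by auto
  ultimately show ?thesis by (simp add: Ent_def eta_def prob_space)
qed

lemma Ent_le_if_factor:
  assumes "simple_function M f" "\<And>x. x \<in> space M \<Longrightarrow> h x = \<phi> (f x)"
  shows "Ent M h \<le> Ent M f"
proof -
  have im: "h ` space M = (\<phi> \<circ> f) ` space M" using assms(2) by auto
  have vi: "h -` {v} \<inter> space M = (\<phi> \<circ> f) -` {v} \<inter> space M" for v using assms(2) by auto
  have "Ent M h = Ent M (\<phi> \<circ> f)" unfolding Ent_def im vi ..
  then show ?thesis using Ent_data_processing[OF assms(1), of \<phi>] by simp
qed

lemma Ent_comp_measure_preserving:
  assumes T: "T \<in> measurable M M" and inv: "distr M M T = M" and f: "simple_function M f"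
  shows "Ent M (\<lambda>x. f (T x)) = Ent M f"
proof -
  have "prob ((\<lambda>x. f (T x)) -` {v} \<inter> space M) = prob (f -` {v} \<inter> space M)" for v
  proof -
    have "prob (f -` {v} \<inter> space M) = measure (distr M M T) (f -` {v} \<inter> space M)" by (simp add: inv)
    also have "\<dots> = prob (T -` (f -` {v} \<inter> space M) \<inter> space M)"
      by (rule measure_distr[OF T simple_functionD(2)[OF f]])
    also have "T -` (f -` {v} \<inter> space M) \<inter> space M = (\<lambda>x. f (T x)) -` {v} \<inter> space M"
      using measurable_space[OF T] by auto
    finally show ?thesis by simp
  qed
  moreover have "(\<lambda>x. f (T x)) ` space M \<subseteq> f ` space M" using measurable_space[OF T] by auto
  ultimately show ?thesis
    using Ent_superset[OF simple_functionD(1)[OF f], of "\<lambda>x. f (T x)"] by (simp add: Ent_def)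
qed

lemma Ent_comp_measure_preserving_pow:
  assumes T: "T \<in> measurable M M" and inv: "distr M M T = M" and f: "simple_function M f"
  shows "Ent M (\<lambda>x. f ((T ^^ n) x)) = Ent M f"
  by (rule Ent_comp_measure_preserving[OF measure_preserving_funpow[OF T inv] f])

lemma Ent_itinerary_subadditive:
  assumes T: "T \<in> measurable M M" and inv: "distr M M T = M" and f: "simple_function M f"
  shows "Ent M (itinerary T f (m + n)) \<le> Ent M (itinerary T f m) + Ent M (itinerary T f n)"
proof -
  note sm = simple_function_itinerary(1)[OF T f]
  note sn = simple_function_itinerary(2)[OF T sm[of n], of m]
  have "Ent M (itinerary T f (m + n)) \<le> Ent M (\<lambda>x. (itinerary T f m x, itinerary T f n ((T ^^ m) x)))"
  proof (rule Ent_le_if_factor[OF simple_function_Pair[OF sm sn], where \<phi> = "\<lambda>(u, v). u @ v"])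
    show "itinerary T f (m + n) x = (case (itinerary T f m x, itinerary T f n ((T ^^ m) x)) of (u, v) \<Rightarrow> u @ v)" for x
      by (rule nth_equalityI) (auto simp: itinerary_def nth_append funpow_add[symmetric, THEN fun_cong, simplified comp_def])
  qed
  also have "\<dots> \<le> Ent M (itinerary T f m) + Ent M (\<lambda>x. itinerary T f n ((T ^^ m) x))"
    by (rule Ent_Pair_le[OF sm sn])
  finally show ?thesis by (simp add: Ent_comp_measure_preserving_pow[OF T inv sm])
qed

lemma Ent_itinerary_lim:
  assumes T: "T \<in> measurable M M" and inv: "distr M M T = M" and f: "simple_function M f"
  shows "(\<lambda>n. ereal (Ent M (itinerary T f n) / n)) \<longlonglongrightarrow> (INF q\<in>{1..}. ereal (Ent M (itinerary T f q) / q))"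
  by (rule fekete_subadditive) (rule Ent_itinerary_subadditive[OF assms])

text \<open>The increment is \<open>H(f | g)\<close>. In each step the new letter of
  \<open>f\<close> is conditioned on the new letter of \<open>g\<close> alone, and the new letter of
  \<open>g\<close> on the past of \<open>g\<close> alone; forgetting part of a condition only raises
  entropy.\<close>

lemma Ent_itinerary_Pair_le:
  assumes T: "T \<in> measurable M M" and inv: "distr M M T = M"
    and f: "simple_function M f" and g: "simple_function M g"
  shows "Ent M (itinerary T (\<lambda>x. (f x, g x)) n)
    \<le> Ent M (itinerary T g n) + n * (Ent M (\<lambda>x. (f x, g x)) - Ent M g)"
proof (induction n)
  case 0
  have "itinerary T (\<lambda>x. (f x, g x)) 0 = (\<lambda>x. [])" "itinerary T g 0 = (\<lambda>x. [])"
    by (auto simp: itinerary_def)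
  then show ?case by (simp add: Ent_const)
next
  case (Suc n)
  let ?FG = "itinerary T (\<lambda>x. (f x, g x))" and ?G = "itinerary T g"
  let ?f = "\<lambda>x. f ((T ^^ n) x)" and ?g = "\<lambda>x. g ((T ^^ n) x)"
  note fg = simple_function_Pair[OF f g]
  note s = simple_function_itinerary(1)[OF T fg, of n] simple_function_itinerary(1)[OF T g]
    simple_function_itinerary(2)[OF T f, of n] simple_function_itinerary(2)[OF T g, of n]
  have "Ent M (?FG (Suc n)) \<le> Ent M (\<lambda>x. (?f x, ?FG n x, ?g x))"
    by (rule Ent_le_if_factor[OF simple_function_Pair[OF s(3) simple_function_Pair[OF s(1) s(4)]],
          where \<phi> = "\<lambda>(a, l, b). l @ [(a, b)]"])
      (simp add: itinerary_def)
  moreover have "Ent M (\<lambda>x. (?f x, ?FG n x, ?g x)) + Ent M ?g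
      \<le> Ent M (\<lambda>x. (?f x, ?g x)) + Ent M (\<lambda>x. (?FG n x, ?g x))"
    by (rule Ent_submodular[OF s(3,1,4)])
  \<comment> \<open>\<open>?G n\<close> is a function of \<open>?FG n\<close>; adjoining it only
    brings the pair into the form required by submodularity.\<close>
  moreover have "Ent M (\<lambda>x. (?FG n x, ?g x)) \<le> Ent M (\<lambda>x. (?FG n x, ?g x, ?G n x))"
    by (rule Ent_le_if_factor[OF simple_function_Pair[OF s(1) simple_function_Pair[OF s(4) s(2)]],
          where \<phi> = "\<lambda>(a, b, c). (a, b)"]) simp
  moreover have "Ent M (\<lambda>x. (?FG n x, ?g x, ?G n x)) + Ent M (?G n)
      \<le> Ent M (\<lambda>x. (?FG n x, ?G n x)) + Ent M (\<lambda>x. (?g x, ?G n x))"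
    by (rule Ent_submodular[OF s(1,4,2)])
  moreover have "Ent M (\<lambda>x. (?FG n x, ?G n x)) \<le> Ent M (?FG n)"
    by (rule Ent_le_if_factor[OF s(1), where \<phi> = "\<lambda>l. (l, map snd l)"]) (simp add: itinerary_def)
  moreover have "Ent M (\<lambda>x. (?g x, ?G n x)) \<le> Ent M (?G (Suc n))"
    by (rule Ent_le_if_factor[OF s(2), where \<phi> = "\<lambda>l. (last l, butlast l)"]) (simp add: itinerary_def)
  moreover have "Ent M (\<lambda>x. (?f x, ?g x)) = Ent M (\<lambda>x. (f x, g x))"
    by (rule Ent_comp_measure_preserving_pow[OF T inv fg])
  moreover have "Ent M ?g = Ent M g"
    by (rule Ent_comp_measure_preserving_pow[OF T inv g])
  ultimately show ?case using Suc by (simp add: algebra_simps)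
qed

text \<open>Makes \<open>H(f | g)\<close> small when \<open>f\<close> and \<open>g\<close> rarely
  differ. An off-diagonal value has probability at most \<open>e\<close> and costs at most
  \<open>2 * sqrt e\<close>; the probability of a diagonal one is within \<open>e\<close> of the
  corresponding one for \<open>g\<close>.\<close>

lemma Ent_Pair_diff_le:
  fixes e :: real
  assumes f: "simple_function M f" and g: "simple_function M g"
    and V: "finite V" "f ` space M \<subseteq> V" "g ` space M \<subseteq> V"
    and e: "prob {x \<in> space M. f x \<noteq> g x} \<le> e"
  shows "Ent M (\<lambda>x. (f x, g x)) - Ent M g \<le> (card V)\<^sup>2 * (2 * sqrt e) + card V * e"
proof -
  define p where "p a b = prob ((\<lambda>x. (f x, g x)) -` {(a, b)} \<inter> space M)" for a b
  define q where "q b = prob (g -` {b} \<inter> space M)" for b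
  have neq [measurable]: "{x \<in> space M. f x \<noteq> g x} \<in> sets M"
  proof -
    have "{x \<in> space M. f x \<noteq> g x} = (\<Union>v\<in>f ` space M. (f -` {v} \<inter> space M) - (g -` {v} \<inter> space M))"
      by auto
    also have "\<dots> \<in> sets M"
      using simple_functionD[OF f] simple_functionD[OF g] by (intro sets.finite_UN sets.Diff) auto
    finally show ?thesis .
  qed
  have e0: "0 \<le> e" using e measure_nonneg[of M] by (meson order_trans)
  note sets_fg = simple_functionD(2)[OF simple_function_Pair[OF f g]]
  have off: "p a b \<le> e" if "a \<noteq> b" for a b
  proof -
    have "p a b \<le> prob {x \<in> space M. f x \<noteq> g x}"
      unfolding p_def using that by (intro finite_measure_mono neq) auto
    then show ?thesis using e by simp
  qed
  have diag: "q b - p b b \<le> e" "p b b \<le> q b" for b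
  proof -
    have "q b \<le> prob (((\<lambda>x. (f x, g x)) -` {(b, b)} \<inter> space M) \<union> {x \<in> space M. f x \<noteq> g x})"
      unfolding q_def by (intro finite_measure_mono sets.Un neq sets_fg) auto
    also have "\<dots> \<le> p b b + prob {x \<in> space M. f x \<noteq> g x}"
      unfolding p_def by (rule measure_Un_le[OF sets_fg neq])
    finally show "q b - p b b \<le> e" using e by simp
    show "p b b \<le> q b"
      unfolding p_def q_def by (intro finite_measure_mono simple_functionD[OF g]) auto
  qed
  \<comment> \<open>The tangent at \<open>q b\<close> bounds the increase of \<open>eta\<close> by
    \<open>q b - p b b\<close>, because \<open>ln (q b) \<le> 0\<close>.\<close>
  have eta_diag: "eta (p b b) \<le> eta (q b) + e" for b
  proof (cases "q b = 0")
    case True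
    then have "p b b = 0" using diag(2)[of b] measure_nonneg[of M] by (simp add: p_def order_antisym)
    then show ?thesis using True e0 by simp
  next
    case False
    then have q: "0 < q b" "q b \<le> 1" by (simp_all add: q_def zero_less_measure_iff)
    have "eta (p b b) \<le> - p b b * ln (q b) + q b - p b b"
      by (rule eta_le_tangent) (use q in \<open>auto simp: p_def\<close>)
    also have "\<dots> = eta (q b) + (q b - p b b) * ln (q b) + (q b - p b b)"
      by (simp add: eta_def algebra_simps)
    also have "\<dots> \<le> eta (q b) + 0 + e"
      using diag[of b] q by (intro add_mono mult_nonneg_nonpos) auto
    finally show ?thesis by simp
  qed
  have "Ent M (\<lambda>x. (f x, g x)) = (\<Sum>(a, b)\<in>V \<times> V. eta (p a b))"
    by (subst Ent_superset[of "V \<times> V"]) (use V in \<open>auto simp: p_def intro!: sum.cong\<close>)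
  also have "\<dots> \<le> (\<Sum>(a, b)\<in>V \<times> V. 2 * sqrt e + (if a = b then eta (q b) + e else 0))"
  proof (intro sum_mono, clarify)
    fix a b
    show "eta (p a b) \<le> 2 * sqrt e + (if a = b then eta (q b) + e else 0)"
    proof (cases "a = b")
      case True
      have "eta (p a b) \<le> 2 * sqrt e + (eta (q b) + e)"
        unfolding True using eta_diag[of b] real_sqrt_ge_zero[OF e0] by linarith
      then show ?thesis using True by simp
    next
      case False
      have "eta (p a b) \<le> 2 * sqrt (p a b)" by (rule eta_le_sqrt) (simp add: p_def)
      also have "\<dots> \<le> 2 * sqrt e" using off[OF False] by simp
      finally show ?thesis using False by simp
    qed
  qed
  also have "\<dots> = (card V)\<^sup>2 * (2 * sqrt e) + (\<Sum>b\<in>V. eta (q b) + e)"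
  proof -
    have "(\<Sum>a\<in>V. \<Sum>b\<in>V. if a = b then eta (q b) + e else 0) = (\<Sum>a\<in>V. eta (q a) + e)"
      by (intro sum.cong refl) (simp add: V(1))
    then show ?thesis
      by (simp add: sum.cartesian_product[symmetric] sum.distrib card_cartesian_product power2_eq_square)
  qed
  also have "(\<Sum>b\<in>V. eta (q b) + e) = Ent M g + card V * e"
    using Ent_superset[OF V(1,3)] by (simp add: sum.distrib q_def)
  finally show ?thesis by simp
qed

end

section \<open>The Kolmogorov--Sinai theorem for one-sided subshifts\<close>

lemma (in prob_space) Ent_itinerary_real_lim:
  assumes T: "T \<in> measurable M M" and inv: "distr M M T = M" and f: "simple_function M f"
  obtains l where "(\<lambda>n. Ent M (itinerary T f n) / n) \<longlonglongrightarrow> l"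
    "ereal l = (INF q\<in>{1..}. ereal (Ent M (itinerary T f q) / q))" "0 \<le> l"
proof -
  let ?L = "INF q\<in>{1..}. ereal (Ent M (itinerary T f q) / q)"
  have "0 \<le> ?L" by (intro INF_greatest) (simp add: Ent_nonneg)
  moreover have "?L \<le> ereal (Ent M (itinerary T f 1) / 1)"
    by (rule INF_lower2[of 1]) auto
  ultimately obtain l where l: "?L = ereal l"
    by (cases ?L) auto
  then show thesis
    using that[of l] Ent_itinerary_lim[OF assms] \<open>0 \<le> ?L\<close> by simp
qed

section \<open>Approximation by functions of a finite prefix\<close>

context subshift_loc
begin

lemma simple_function_prefix_word:
  assumes "sets M = sets (restrict_space borel X)"
  shows "simple_function M (prefix_word n)"
  unfolding simple_function_def
proof (intro conjI ballI)
  show "finite (prefix_word n ` space M)"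
    by (rule finite_subset[of _ "words k n"]) (auto simp: space_eq_X[OF assms] prefix_word_words)
  show "prefix_word n -` {w} \<inter> space M \<in> sets M" for w
    by (rule measurable_sets[OF measurable_prefix_word[OF assms]]) simp
qed

text \<open>The sets approximable in measure by sets
  \<open>{x \<in> X. prefix_word N x \<in> S}\<close> contain the cylinders and are closed under
  complements and countable unions.\<close>

lemma approx_by_cylinders:
  assumes M: "finite_measure M" "sets M = sets (restrict_space borel X)"
    and A: "A \<in> sets M" and e: "0 < (e :: real)"
  shows "\<exists>N S. measure M ((A - {x \<in> X. prefix_word N x \<in> S}) \<union> ({x \<in> X. prefix_word N x \<in> S} - A)) < e"
proof -
  interpret finite_measure M by (rule M)
  define C where "C N S = {x \<in> X. prefix_word N x \<in> S}" for N and S :: "nat list set"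
  have C_sets [measurable]: "C N S \<in> sets M" for N S
    unfolding C_def by (rule prefix_set_in_sets[OF M(2)])
  \<comment> \<open>Prefix sets of different lengths are compared after rewriting both at the larger
    length.\<close>
  have C_up: "C N S = C N' {w. take N w \<in> S}" if "N \<le> N'" for N N' S
    using take_prefix_word[OF that] by (auto simp: C_def)
  define apx where "apx A \<longleftrightarrow> A \<in> sets M \<and> (\<forall>e>0. \<exists>N S. measure M ((A - C N S) \<union> (C N S - A)) < e)" for A
  have apx_Un: "apx (A \<union> B)" if "apx A" "apx B" for A B
    unfolding apx_def
  proof (intro conjI allI impI)
    have [measurable]: "A \<in> sets M" "B \<in> sets M" using that by (auto simp: apx_def)
    show "A \<union> B \<in> sets M" by measurable
    fix e :: real assume "e > 0"
    then have "e / 2 > 0" by simp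
    obtain N S where N: "measure M ((A - C N S) \<union> (C N S - A)) < e / 2"
      using \<open>apx A\<close> \<open>e / 2 > 0\<close> unfolding apx_def by blast
    obtain N' S' where N': "measure M ((B - C N' S') \<union> (C N' S' - B)) < e / 2"
      using \<open>apx B\<close> \<open>e / 2 > 0\<close> unfolding apx_def by blast
    define K where "K = max N N'"
    define U where "U = {w. take N w \<in> S} \<union> {w. take N' w \<in> S'}"
    have "C K U = C N S \<union> C N' S'"
      using C_up[of N K S] C_up[of N' K S'] by (auto simp: C_def K_def U_def)
    then have "measure M ((A \<union> B - C K U) \<union> (C K U - (A \<union> B)))
        \<le> measure M (((A - C N S) \<union> (C N S - A)) \<union> ((B - C N' S') \<union> (C N' S' - B)))"
      by (intro finite_measure_mono) auto
    also have "\<dots> \<le> measure M ((A - C N S) \<union> (C N S - A)) + measure M ((B - C N' S') \<union> (C N' S' - B))"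
      by (intro measure_Un_le) auto
    also have "\<dots> < e" using N N' by simp
    finally show "\<exists>N S. measure M ((A \<union> B - C N S) \<union> (C N S - (A \<union> B))) < e" by blast
  qed
  have "apx A" if "A \<in> sigma_sets X (range (cyl X))" for A
    using that
  proof induction
    case (Basic A)
    then obtain w where w: "A = cyl X w" by blast
    have "A = C (length w) {w}" unfolding w by (simp add: cyl_def C_def)
    then have "measure M ((A - C (length w) {w}) \<union> (C (length w) {w} - A)) = 0" by simp
    then show ?case
      unfolding apx_def using cyl_in_sets[of w] M(2) w by (metis)
  next
    case Empty
    have "measure M (({} - C 0 {}) \<union> (C 0 {} - {})) = 0" by (simp add: C_def)
    then show ?case unfolding apx_def by (metis sets.empty_sets)
  next
    case (Compl a)
    have "(X - a - C N (- S)) \<union> (C N (- S) - (X - a)) = (a - C N S) \<union> (C N S - a)" for N S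
      using Compl.IH sets.sets_into_space[of a M] unfolding apx_def C_def
      by (auto simp: space_eq_X[OF M(2)])
    moreover have "X - a \<in> sets M"
      using Compl.IH sets.compl_sets[of a M] by (simp add: apx_def space_eq_X[OF M(2)])
    ultimately show ?case using Compl.IH unfolding apx_def by metis
  next
    case (Union a)
    \<comment> \<open>A finite subunion is approximable by induction and, by continuity from below,
      misses less than \<open>e / 2\<close> of the measure.\<close>
    define U where "U n = (\<Union>i<n. a i)" for n :: nat
    have am [measurable]: "a i \<in> sets M" for i using Union.IH by (simp add: apx_def)
    have Um [measurable]: "U n \<in> sets M" for n unfolding U_def by measurable
    have apx_U: "apx (U n)" for n
    proof (induction n)
      case 0
      have "measure M (({} - C 0 {}) \<union> (C 0 {} - {})) = 0" by (simp add: C_def)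
      then show ?case unfolding apx_def U_def lessThan_0 by (metis sets.empty_sets UN_empty)
    next
      case (Suc n)
      have "U (Suc n) = a n \<union> U n" by (auto simp: U_def lessThan_Suc)
      then show ?case using apx_Un[OF Union.IH Suc] by simp
    qed
    have UU: "(\<Union>n. U n) = (\<Union>i. a i)" unfolding U_def by blast
    show ?case unfolding apx_def
    proof (intro conjI allI impI)
      show "\<Union> (range a) \<in> sets M" by measurable
      fix e :: real assume "e > 0"
      have "(\<lambda>n. measure M (U n)) \<longlonglongrightarrow> measure M (\<Union>n. U n)"
      proof (rule finite_Lim_measure_incseq)
        show "incseq U" unfolding incseq_def U_def by (intro allI impI UN_mono) auto
      qed auto
      then have "\<forall>\<^sub>F n in sequentially. measure M (\<Union>n. U n) - e / 2 < measure M (U n)"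
        using \<open>e > 0\<close> by (intro order_tendstoD(1)) auto
      then obtain n where n: "measure M (\<Union>n. U n) - e / 2 < measure M (U n)"
        using eventually_sequentially by auto
      obtain N S where NS: "measure M ((U n - C N S) \<union> (C N S - U n)) < e / 2"
        using apx_U[of n] \<open>e > 0\<close> unfolding apx_def by (metis half_gt_zero)
      have "measure M ((\<Union>i. a i) - U n) = measure M (\<Union>n. U n) - measure M (U n)"
        unfolding UU[symmetric] by (intro finite_measure_Diff) auto
      then have d: "measure M ((\<Union>i. a i) - U n) < e / 2" using n by simp
      have "measure M (((\<Union>i. a i) - C N S) \<union> (C N S - (\<Union>i. a i)))
          \<le> measure M (((\<Union>i. a i) - U n) \<union> ((U n - C N S) \<union> (C N S - U n)))"
        unfolding U_def by (intro finite_measure_mono) auto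
      also have "\<dots> \<le> measure M ((\<Union>i. a i) - U n) + measure M ((U n - C N S) \<union> (C N S - U n))"
        by (intro measure_Un_le) auto
      also have "\<dots> < e" using d NS by simp
      finally show "\<exists>N S. measure M ((\<Union> (range a) - C N S) \<union> (C N S - \<Union> (range a))) < e" by blast
    qed
  qed
  then have "apx A" using A M(2) by (simp add: sets_restrict_borel_cyl)
  then show ?thesis using e unfolding apx_def C_def by blast
qed

text \<open>Each level set is approximated separately. Outside the union of the errors exactly one
  value is compatible with the prefix, and \<open>\<phi>\<close> picks it; elsewhere it takes some
  value of \<open>f\<close>, so that no new values arise.\<close>

lemma approx_simple_function:
  assumes M: "prob_space M" "sets M = sets (restrict_space borel X)"
    and f: "simple_function M f" and e: "0 < (e :: real)"
  obtains N \<phi> where "\<And>w. \<phi> w \<in> f ` space M"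
    "measure M {x \<in> space M. f x \<noteq> \<phi> (prefix_word N x)} \<le> e"
proof -
  interpret prob_space M by (rule M)
  let ?V = "f ` space M"
  have V: "finite ?V" "?V \<noteq> {}" using simple_functionD(1)[OF f] not_empty by auto
  define C where "C N S = {x \<in> X. prefix_word N x \<in> S}" for N and S :: "nat list set"
  define A where "A v = f -` {v} \<inter> space M" for v
  have A [measurable]: "A v \<in> sets M" for v unfolding A_def by (rule simple_functionD[OF f])
  have C [measurable]: "C N S \<in> sets M" for N S
    unfolding C_def by (rule prefix_set_in_sets[OF M(2)])
  have "card ?V > 0" using V by (simp add: card_gt_0_iff)
  then have "e / card ?V > 0" using e by simp
  then have "\<forall>v. \<exists>N S. prob ((A v - C N S) \<union> (C N S - A v)) < e / card ?V"
    using approx_by_cylinders[OF finite_measure_axioms M(2) A] unfolding C_def by blast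
  then obtain N S where NS: "\<And>v. prob ((A v - C (N v) (S v)) \<union> (C (N v) (S v) - A v)) < e / card ?V"
    by metis
  define K where "K = (\<Sum>v\<in>?V. N v)"
  define D where "D v = (A v - C (N v) (S v)) \<union> (C (N v) (S v) - A v)" for v
  have NK: "N v \<le> K" if "v \<in> ?V" for v unfolding K_def using that V by (intro member_le_sum) auto
  define R where "R w = {v \<in> ?V. take (N v) w \<in> S v}" for w
  define \<phi> where "\<phi> w = (if R w = {} then SOME v. v \<in> ?V else SOME v. v \<in> R w)" for w
  have \<phi>: "\<phi> w \<in> ?V" for w
  proof (cases "R w = {}")
    case True
    then show ?thesis unfolding \<phi>_def using some_in_eq[of ?V] V(2) by simp
  next
    case False
    then have "\<phi> w = (SOME v. v \<in> R w)" unfolding \<phi>_def by (simp only: if_False)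
    moreover have "(SOME v. v \<in> R w) \<in> R w" using False by (simp only: some_in_eq not_False_eq_True)
    moreover have "R w \<subseteq> ?V" unfolding R_def by blast
    ultimately show ?thesis by auto
  qed
  have sub: "{x \<in> space M. f x \<noteq> \<phi> (prefix_word K x)} \<subseteq> (\<Union>v\<in>?V. D v)"
  proof
    fix x assume x: "x \<in> {x \<in> space M. f x \<noteq> \<phi> (prefix_word K x)}"
    then have xs: "x \<in> space M" "x \<in> X" by (simp_all add: space_eq_X[OF M(2)])
    show "x \<in> (\<Union>v\<in>?V. D v)"
    proof (rule ccontr)
      assume n: "x \<notin> (\<Union>v\<in>?V. D v)"
      have "v \<in> R (prefix_word K x) \<longleftrightarrow> f x = v" if "v \<in> ?V" for v
      proof -
        have "x \<notin> D v" using n that by blast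
        then have "x \<in> A v \<longleftrightarrow> x \<in> C (N v) (S v)" by (auto simp: D_def)
        then show ?thesis using that xs NK[OF that]
          by (simp add: A_def C_def R_def take_prefix_word)
      qed
      then have "R (prefix_word K x) = {f x}" using xs by (auto simp: R_def)
      then show False using x by (simp add: \<phi>_def)
    qed
  qed
  have Dm: "D v \<in> sets M" for v unfolding D_def by measurable
  have "prob {x \<in> space M. f x \<noteq> \<phi> (prefix_word K x)} \<le> prob (\<Union>v\<in>?V. D v)"
    using sub V Dm by (intro finite_measure_mono sets.finite_UN) auto
  also have "\<dots> \<le> (\<Sum>v\<in>?V. prob (D v))"
    using V Dm by (intro measure_UNION_le) auto
  also have "\<dots> \<le> (\<Sum>v\<in>?V. e / card ?V)"
    using NS by (intro sum_mono) (simp add: D_def less_imp_le)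
  also have "\<dots> = e" using \<open>card ?V > 0\<close> by simp
  finally show thesis using that \<phi> by blast
qed

lemma simple_function_head:
  assumes "sets M = sets (restrict_space borel X)"
  shows "simple_function M (\<lambda>x. x 0)"
proof -
  have "(\<lambda>x. x 0) = hd \<circ> prefix_word 1" by (auto simp: prefix_word_def)
  then show ?thesis
    using simple_function_compose[OF simple_function_prefix_word[OF assms, of 1], of hd] by simp
qed

lemma itinerary_head: "itinerary shift_map (\<lambda>x. x 0) n = prefix_word n"
  by (auto simp: itinerary_def prefix_word_def shift_map_funpow)

lemma invariantD:
  assumes "M \<in> invariant_measures X"
  shows "prob_space M" "sets M = sets (restrict_space borel X)" "distr M M shift_map = M"
    "shift_map \<in> measurable M M" "space M = X"
  using assms measurable_shift space_eq_X by (auto simp: invariant_measures_def)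

end

text \<open>Entropy of the \<open>n\<close>-fold join of the partition by the zeroth letter, see
  \<open>itinerary_head\<close>.\<close>

definition block_entropy :: "(nat \<Rightarrow> nat) measure \<Rightarrow> nat \<Rightarrow> real" where
  "block_entropy M n = Ent M (prefix_word n)"

context subshift_loc
begin

lemma block_entropy_words:
  assumes "prob_space M" "sets M = sets (restrict_space borel X)"
  shows "block_entropy M n = (\<Sum>w\<in>words k n. eta (measure M (cyl X w)))"
proof -
  interpret prob_space M by (rule assms)
  have "prefix_word n -` {w} \<inter> space M = cyl X w" if "w \<in> words k n" for w
    using that by (auto simp: words_def cyl_def space_eq_X[OF assms(2)])
  moreover have "prefix_word n ` space M \<subseteq> words k n"
    by (auto simp: space_eq_X[OF assms(2)] prefix_word_words)
  ultimately show ?thesis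
    unfolding block_entropy_def by (subst Ent_superset[of "words k n"]) simp_all
qed

lemma block_entropy_subadditive:
  assumes "M \<in> invariant_measures X"
  shows "block_entropy M (m + n) \<le> block_entropy M m + block_entropy M n"
proof -
  note M = invariantD[OF assms]
  interpret prob_space M by (rule M)
  show ?thesis
    using Ent_itinerary_subadditive[OF M(4,3) simple_function_head[OF M(2)]] by (simp add: block_entropy_def itinerary_head)
qed

text \<open>\<open>f\<close> is approximated by a function \<open>g\<close> of the first
  \<open>N\<close> letters with \<open>H(f | g) \<le> d\<close>; the \<open>g\<close>-itinerary of
  length \<open>n\<close> is read off the first \<open>n + N\<close> letters.\<close>

lemma Ent_itinerary_le_block_entropy:
  assumes M: "M \<in> invariant_measures X" and f: "simple_function M f" and d: "0 < (d :: real)"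
  obtains N where "\<And>n. Ent M (itinerary shift_map f n) \<le> block_entropy M (n + N) + n * d"
proof -
  note MM = invariantD[OF M]
  interpret prob_space M by (rule MM)
  let ?V = "f ` space M"
  have V: "finite ?V" using simple_functionD(1)[OF f] .
  \<comment> \<open>Collects the coefficients of \<open>Ent_Pair_diff_le\<close> after
    \<open>e\<close> is replaced by \<open>sqrt e\<close>, which is no smaller since
    \<open>e \<le> 1\<close>; then \<open>sqrt e \<le> d / c\<close> bounds the total by
    \<open>d\<close>.\<close>
  define c where "c = 2 * (real (card ?V))\<^sup>2 + card ?V + 1"
  have c: "c > 0" by (simp add: c_def add_nonneg_pos)
  define e where "e = min 1 ((d / c)\<^sup>2)"
  have e: "0 < e" "e \<le> 1" "sqrt e \<le> d / c"
    using d c by (auto simp: e_def intro: real_le_lsqrt)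
  obtain N \<phi> where \<phi>: "\<And>w. \<phi> w \<in> ?V" "prob {x \<in> space M. f x \<noteq> \<phi> (prefix_word N x)} \<le> e"
    by (rule approx_simple_function[OF MM(1,2) f e(1)]) blast
  define g where "g = (\<lambda>x. \<phi> (prefix_word N x))"
  have g: "simple_function M g"
    using simple_function_compose[OF simple_function_prefix_word[OF MM(2), of N], of \<phi>]
    by (simp add: g_def comp_def)
  have "Ent M (\<lambda>x. (f x, g x)) - Ent M g \<le> (card ?V)\<^sup>2 * (2 * sqrt e) + card ?V * e"
    by (rule Ent_Pair_diff_le[OF f g V]) (use \<phi> in \<open>auto simp: g_def\<close>)
  also have "\<dots> \<le> (card ?V)\<^sup>2 * (2 * sqrt e) + card ?V * sqrt e"
  proof -
    have "e = sqrt e * sqrt e" using e by simp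
    also have "\<dots> \<le> 1 * sqrt e" using e by (intro mult_right_mono) auto
    finally show ?thesis by (intro add_left_mono mult_left_mono) auto
  qed
  also have "\<dots> \<le> c * sqrt e" using e by (simp add: c_def algebra_simps)
  also have "\<dots> \<le> c * (d / c)" using e c by (intro mult_left_mono) auto
  also have "\<dots> = d" using c by simp
  finally have diff: "Ent M (\<lambda>x. (f x, g x)) - Ent M g \<le> d" .
  have "Ent M (itinerary shift_map f n) \<le> block_entropy M (n + N) + n * d" for n
  proof -
    note fg = simple_function_Pair[OF f g]
    have "Ent M (itinerary shift_map f n) \<le> Ent M (itinerary shift_map (\<lambda>x. (f x, g x)) n)"
      by (rule Ent_le_if_factor[OF simple_function_itinerary(1)[OF MM(4) fg], where \<phi> = "map fst"])
        (simp add: itinerary_def)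
    also have "\<dots> \<le> Ent M (itinerary shift_map g n) + n * (Ent M (\<lambda>x. (f x, g x)) - Ent M g)"
      by (rule Ent_itinerary_Pair_le[OF MM(4,3) f g])
    also have "\<dots> \<le> Ent M (itinerary shift_map g n) + n * d"
      using diff by (intro add_left_mono mult_left_mono) auto
    also have "Ent M (itinerary shift_map g n) \<le> block_entropy M (n + N)"
      unfolding block_entropy_def
    proof (rule Ent_le_if_factor[OF simple_function_prefix_word[OF MM(2)],
          where \<phi> = "\<lambda>w. map (\<lambda>i. \<phi> (take N (drop i w))) [0..<n]"])
      fix x
      have "prefix_word N ((shift_map ^^ i) x) = take N (drop i (prefix_word (n + N) x))" if "i < n" for i
        unfolding prefix_word_shift
        by (rule nth_equalityI) (use that in \<open>auto simp: prefix_word_def\<close>)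
      then show "itinerary shift_map g n x = map (\<lambda>i. \<phi> (take N (drop i (prefix_word (n + N) x)))) [0..<n]"
        by (simp add: itinerary_def g_def)
    qed
    finally show ?thesis by simp
  qed
  then show thesis using that by blast
qed

text \<open>Kolmogorov-Sinai: by the preceding lemma no finite partition has larger entropy than the
  one by the zeroth letter. The last clause, \<open>h\<close> as a lower bound of all block
  averages, is the source of upper semicontinuity.\<close>

theorem entropy_of_block_entropy:
  assumes M: "M \<in> invariant_measures X"
  obtains h where "entropy_of M = ereal h" "0 \<le> h" "(\<lambda>n. block_entropy M n / n) \<longlonglongrightarrow> h"
    "\<And>q. 1 \<le> q \<Longrightarrow> h \<le> block_entropy M q / q"
proof -
  note MM = invariantD[OF M]
  interpret prob_space M by (rule MM)
  note f0 = simple_function_head[OF MM(2)]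
  obtain h where h: "(\<lambda>n. block_entropy M n / n) \<longlonglongrightarrow> h"
    "ereal h = (INF q\<in>{1..}. ereal (block_entropy M q / q))" "0 \<le> h"
    by (rule Ent_itinerary_real_lim[OF MM(4,3) f0, unfolded itinerary_head block_entropy_def[symmetric]])
  have le: "lim (\<lambda>n. ereal (Ent M (itinerary shift_map f n) / n)) \<le> ereal h"
    if f: "simple_function M f" for f :: "(nat \<Rightarrow> nat) \<Rightarrow> (nat \<Rightarrow> nat) set"
  proof -
    obtain l where l: "(\<lambda>n. Ent M (itinerary shift_map f n) / n) \<longlonglongrightarrow> l"
      by (rule Ent_itinerary_real_lim[OF MM(4,3) f])
    \<comment> \<open>Subadditivity splits off the \<open>N\<close> extra letters, whose cost is
      constant in \<open>n\<close> and disappears after division.\<close>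
    have "l \<le> h + d" if d: "0 < d" for d
    proof -
      obtain N where N: "\<And>n. Ent M (itinerary shift_map f n) \<le> block_entropy M (n + N) + n * d"
        by (rule Ent_itinerary_le_block_entropy[OF M f d]) blast
      have "Ent M (itinerary shift_map f n) / n \<le> block_entropy M n / n + block_entropy M N * (1 / n) + d"
        if "1 \<le> n" for n
      proof -
        have "Ent M (itinerary shift_map f n) \<le> block_entropy M n + block_entropy M N + n * d"
          using N[of n] block_entropy_subadditive[OF M, of n N] by simp
        then show ?thesis using that by (simp add: field_simps)
      qed
      moreover have "(\<lambda>n. block_entropy M n / n + block_entropy M N * (1 / real n) + d)
          \<longlonglongrightarrow> h + block_entropy M N * 0 + d"
        by (intro tendsto_intros h(1) lim_1_over_n)
      ultimately have "l \<le> h + block_entropy M N * 0 + d"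
        by (intro LIMSEQ_le[OF l]) auto
      then show ?thesis by simp
    qed
    then have "l \<le> h" by (rule field_le_epsilon)
    moreover have "lim (\<lambda>n. ereal (Ent M (itinerary shift_map f n) / n)) = ereal l"
      using l by (intro limI) simp
    ultimately show ?thesis by simp
  qed
  have "entropy_of M = ereal h"
    unfolding ks_entropy_def
  proof (rule antisym)
    show "(SUP P\<in>{P. finite_measurable_partition M P}.
        lim (\<lambda>n. ereal (partition_entropy M (iterated_join M shift_map P n) / n))) \<le> ereal h"
    proof (intro SUP_least)
      fix P assume "P \<in> {P. finite_measurable_partition M P}"
      then have "finite_measurable_partition M P" by simp
      then obtain f :: "(nat \<Rightarrow> nat) \<Rightarrow> (nat \<Rightarrow> nat) set" where f: "simple_function M f"
        "P = (\<lambda>v. f -` {v} \<inter> space M) ` (f ` space M)"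
        by (rule simple_function_of_partition)
      show "lim (\<lambda>n. ereal (partition_entropy M (iterated_join M shift_map P n) / n)) \<le> ereal h"
        using le[OF f(1)] by (simp add: Ent_itinerary_partition[OF MM(4) f])
    qed
  next
    let ?P = "(\<lambda>v. (\<lambda>x. x 0) -` {v} \<inter> space M) ` ((\<lambda>x. x 0) ` space M)"
    have "ereal h = lim (\<lambda>n. ereal (partition_entropy M (iterated_join M shift_map ?P n) / n))"
      using h(1) by (intro limI[symmetric])
        (simp add: Ent_itinerary_partition[OF MM(4) f0 refl] itinerary_head block_entropy_def)
    also have "\<dots> \<le> (SUP P\<in>{P. finite_measurable_partition M P}.
        lim (\<lambda>n. ereal (partition_entropy M (iterated_join M shift_map P n) / n)))"
      using partition_of_simple_function[OF f0] by (intro SUP_upper) simp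
    finally show "ereal h \<le> (SUP P\<in>{P. finite_measurable_partition M P}.
        lim (\<lambda>n. ereal (partition_entropy M (iterated_join M shift_map P n) / n)))" .
  qed
  moreover have "h \<le> block_entropy M q / q" if "1 \<le> q" for q
  proof -
    have "ereal h \<le> ereal (block_entropy M q / q)"
      unfolding h(2) using that by (intro INF_lower) auto
    then show ?thesis by simp
  qed
  ultimately show thesis using that h by blast
qed

end

section \<open>Equilibrium states of subadditive potentials\<close>

lemma tendsto_eta:
  assumes "t \<longlonglongrightarrow> a" "\<And>n. 0 \<le> t n \<and> t n \<le> 1"
  shows "(\<lambda>n. eta (t n)) \<longlonglongrightarrow> eta a"
proof (cases "a = 0")
  case False
  then show ?thesis unfolding eta_def using assms by (intro tendsto_intros) auto
next
  case True
  have "(\<lambda>n. 2 * sqrt (t n)) \<longlonglongrightarrow> 2 * sqrt 0"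
    using assms True by (intro tendsto_intros) auto
  then have lim: "(\<lambda>n. 2 * sqrt (t n)) \<longlonglongrightarrow> 0" by simp
  have "(\<lambda>n. eta (t n)) \<longlonglongrightarrow> 0"
  proof (rule tendsto_sandwich[OF _ _ tendsto_const lim])
    show "\<forall>\<^sub>F n in sequentially. 0 \<le> eta (t n)"
      using assms(2) by (intro always_eventually allI eta_nonneg) auto
    show "\<forall>\<^sub>F n in sequentially. eta (t n) \<le> 2 * sqrt (t n)"
      using assms(2) by (intro always_eventually allI eta_le_sqrt) auto
  qed
  then show ?thesis using True by simp
qed

section \<open>Weak limits, mean integrals and maximisers\<close>

context subshift_loc
begin

text \<open>The block bound with \<open>g a b = c (b - a) ((shift_map ^^ a) y)\<close>:
  subadditivity along a single orbit.\<close>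

lemma subadditive_orbit_bound:
  fixes c :: "nat \<Rightarrow> (nat \<Rightarrow> nat) \<Rightarrow> real"
  assumes sub: "\<And>m n y. 0 < m \<Longrightarrow> 0 < n \<Longrightarrow> y \<in> X \<Longrightarrow> c (m + n) y \<le> c m y + c n ((shift_map ^^ m) y)"
    and bdd: "\<And>i y. 0 < i \<Longrightarrow> i \<le> q \<Longrightarrow> y \<in> X \<Longrightarrow> \<bar>c i y\<bar> \<le> C"
    and y: "y \<in> X" and "q < n" "0 < q"
  shows "real q * c n y \<le> (\<Sum>j<n. c q ((shift_map ^^ j) y)) + (3 * real q + 2) * C"
proof -
  let ?g = "\<lambda>a b. c (b - a) ((shift_map ^^ a) y)"
  have "real q * ?g 0 n \<le> (\<Sum>j<n. ?g j (j + q)) + (3 * real q + 2) * C"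
  proof (rule subadditive_block_bound)
    fix a b d :: nat assume abd: "a < b" "b < d"
    have "(shift_map ^^ (b - a)) ((shift_map ^^ a) y) = (shift_map ^^ b) y"
      using abd by (simp add: shift_map_funpow add.assoc)
    then show "?g a d \<le> ?g a b + ?g b d"
      using sub[OF _ _ shift_pow_X[OF y], of "b - a" "d - b" a] abd by simp
  next
    fix a b assume "a < b" "b \<le> a + q"
    then show "\<bar>?g a b\<bar> \<le> C" by (intro bdd shift_pow_X y) auto
  qed fact+
  then show ?thesis by simp
qed

text \<open>Uniform continuity: finitely many cylinders of small oscillation cover \<open>X\<close>,
  and the sum of their lengths bounds each of them.\<close>

lemma uniformly_close_on_cylinders:
  fixes \<phi> :: "(nat \<Rightarrow> nat) \<Rightarrow> real"
  assumes "continuous_on X \<phi>" "0 < e"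
  obtains n where "\<And>x y. x \<in> X \<Longrightarrow> y \<in> X \<Longrightarrow> prefix_word n x = prefix_word n y \<Longrightarrow> \<bar>\<phi> x - \<phi> y\<bar> < e"
proof -
  have "\<exists>n. \<forall>y\<in>X. prefix_word n y = prefix_word n x \<longrightarrow> \<bar>\<phi> y - \<phi> x\<bar> < e / 2" if x: "x \<in> X" for x
  proof -
    have "open (ball (\<phi> x) (e / 2))" by simp
    then obtain U where U: "open U" "U \<inter> X = \<phi> -` ball (\<phi> x) (e / 2) \<inter> X"
      using assms(1) unfolding continuous_on_open_invariant by blast
    have "x \<in> U" using U(2) x assms(2) by auto
    then obtain n where n: "\<And>y. prefix_word n y = prefix_word n x \<Longrightarrow> y \<in> U"
      using open_fun_prefix[OF U(1)] by blast
    have "\<bar>\<phi> y - \<phi> x\<bar> < e / 2" if y: "y \<in> X" "prefix_word n y = prefix_word n x" for y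
    proof -
      have "y \<in> \<phi> -` ball (\<phi> x) (e / 2)" using n[OF y(2)] y(1) U(2) by blast
      then show ?thesis by (simp add: dist_real_def abs_minus_commute)
    qed
    then show ?thesis by blast
  qed
  then obtain N where N: "\<And>x y. x \<in> X \<Longrightarrow> y \<in> X \<Longrightarrow> prefix_word (N x) y = prefix_word (N x) x \<Longrightarrow> \<bar>\<phi> y - \<phi> x\<bar> < e / 2"
    by metis
  have op: "open {y. prefix_word (N x) y = prefix_word (N x) x}" for x
    using clopen_prefix_set(1)[of "N x" "{prefix_word (N x) x}"] by simp
  obtain F where F: "finite F" "F \<subseteq> X" "X \<subseteq> (\<Union>x\<in>F. {y. prefix_word (N x) y = prefix_word (N x) x})"
    by (rule compactE_image[OF compact_X, of X "\<lambda>x. {y. prefix_word (N x) y = prefix_word (N x) x}"])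
      (use op in auto)
  define n where "n = (\<Sum>x\<in>F. N x)"
  have "\<bar>\<phi> x - \<phi> y\<bar> < e" if xy: "x \<in> X" "y \<in> X" "prefix_word n x = prefix_word n y" for x y
  proof -
    obtain z where z: "z \<in> F" "prefix_word (N z) x = prefix_word (N z) z" using F(3) xy(1) by blast
    have "N z \<le> n" unfolding n_def using F(1) z(1) by (intro member_le_sum) auto
    then have "prefix_word (N z) x = prefix_word (N z) y" using xy(3) by (simp add: prefix_word_eq_iff)
    then have "\<bar>\<phi> x - \<phi> z\<bar> < e / 2" "\<bar>\<phi> y - \<phi> z\<bar> < e / 2" using N[of z] z xy F(2) by auto
    then show ?thesis by linarith
  qed
  then show thesis using that by blast
qed

lemma continuous_bounded:
  fixes \<phi> :: "(nat \<Rightarrow> nat) \<Rightarrow> real"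
  assumes "continuous_on X \<phi>"
  obtains B where "\<And>x. x \<in> X \<Longrightarrow> \<bar>\<phi> x\<bar> \<le> B"
proof -
  have "bounded (\<phi> ` X)" using compact_X assms by (intro compact_imp_bounded compact_continuous_image)
  then show thesis using that unfolding bounded_iff by auto
qed

lemma continuous_integrable:
  fixes \<phi> :: "(nat \<Rightarrow> nat) \<Rightarrow> real"
  assumes "continuous_on X \<phi>" and M: "finite_measure M" "sets M = sets (restrict_space borel X)"
  shows "\<phi> \<in> borel_measurable M" "integrable M \<phi>"
proof -
  interpret finite_measure M by (rule M)
  show m: "\<phi> \<in> borel_measurable M"
    using borel_measurable_continuous_on_restrict[OF assms(1)] measurable_cong_sets[OF M(2) refl] by blast
  obtain B where "\<And>x. x \<in> X \<Longrightarrow> \<bar>\<phi> x\<bar> \<le> B" by (rule continuous_bounded[OF assms(1)]) blast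
  then show "integrable M \<phi>"
    by (intro integrable_const_bound[OF _ m, of B] AE_I2) (simp add: space_eq_X[OF M(2)])
qed

lemma integral_prefix_word:
  fixes \<psi> :: "nat list \<Rightarrow> real"
  assumes M: "finite_measure M" "sets M = sets (restrict_space borel X)"
  shows "integrable M (\<lambda>x. \<psi> (prefix_word n x))"
    "(\<integral>x. \<psi> (prefix_word n x) \<partial>M) = (\<Sum>w\<in>words k n. \<psi> w * measure M (cyl X w))"
proof -
  interpret finite_measure M by (rule M)
  have eq: "\<psi> (prefix_word n x) = (\<Sum>w\<in>words k n. \<psi> w * indicator (cyl X w) x)" if "x \<in> space M" for x
  proof -
    have x: "x \<in> X" using that by (simp add: space_eq_X[OF M(2)])
    have "(\<Sum>w\<in>words k n. \<psi> w * indicator (cyl X w) x)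
        = (\<Sum>w\<in>words k n. if w = prefix_word n x then \<psi> w else 0)"
      by (intro sum.cong refl) (use x in \<open>auto simp: cyl_def words_def indicator_def\<close>)
    then show ?thesis using prefix_word_words[OF x] by simp
  qed
  have int: "integrable M (\<lambda>x. \<psi> w * indicator (cyl X w) x)" for w
    by (intro integrable_mult_right integrable_real_indicator)
      (simp_all add: M(2) cyl_in_sets emeasure_eq_measure)
  show "integrable M (\<lambda>x. \<psi> (prefix_word n x))"
    by (rule iffD2[OF Bochner_Integration.integrable_cong[OF refl eq]], assumption)
      (intro Bochner_Integration.integrable_sum int)
  have "(\<integral>x. \<psi> (prefix_word n x) \<partial>M) = (\<integral>x. (\<Sum>w\<in>words k n. \<psi> w * indicator (cyl X w) x) \<partial>M)"
    by (rule Bochner_Integration.integral_cong[OF refl eq])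
  also have "\<dots> = (\<Sum>w\<in>words k n. \<psi> w * measure M (cyl X w))"
    using int by (subst Bochner_Integration.integral_sum)
      (auto simp: space_eq_X[OF M(2)] Int_absorb2[OF cyl_subset])
  finally show "(\<integral>x. \<psi> (prefix_word n x) \<partial>M) = (\<Sum>w\<in>words k n. \<psi> w * measure M (cyl X w))" .
qed

lemma integral_close_to_prefix_sum:
  fixes \<phi> :: "(nat \<Rightarrow> nat) \<Rightarrow> real"
  assumes \<phi>: "continuous_on X \<phi>" and M: "prob_space M" "sets M = sets (restrict_space borel X)"
    and close: "\<And>x. x \<in> X \<Longrightarrow> \<bar>\<phi> x - \<psi> (prefix_word n x)\<bar> \<le> e"
  shows "\<bar>(\<integral>x. \<phi> x \<partial>M) - (\<Sum>w\<in>words k n. \<psi> w * measure M (cyl X w))\<bar> \<le> e"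
proof -
  interpret prob_space M by (rule M)
  note 1 = continuous_integrable(2)[OF \<phi> finite_measure_axioms M(2)]
  note 2 = integral_prefix_word[OF finite_measure_axioms M(2), of \<psi> n]
  have "\<bar>(\<integral>x. \<phi> x - \<psi> (prefix_word n x) \<partial>M)\<bar> \<le> (\<integral>x. e \<partial>M)"
    by (rule integral_abs_bound[THEN order_trans], rule integral_mono)
      (use 1 2 close in \<open>auto simp: space_eq_X[OF M(2)]\<close>)
  then show ?thesis using 1 2 by (simp add: prob_space)
qed

text \<open>Convergence on cylinders is weak convergence: \<open>\<phi>\<close> is uniformly close
  to a function of a prefix, whose integral is a finite combination of cylinder weights.\<close>

lemma tendsto_integral_continuous:
  fixes \<phi> :: "(nat \<Rightarrow> nat) \<Rightarrow> real"
  assumes \<phi>: "continuous_on X \<phi>"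
    and M: "\<And>j. prob_space (M j)" "\<And>j. sets (M j) = sets (restrict_space borel X)"
    and m: "prob_space m" "sets m = sets (restrict_space borel X)"
    and lim: "\<And>w. (\<lambda>j. measure (M j) (cyl X w)) \<longlonglongrightarrow> measure m (cyl X w)"
  shows "(\<lambda>j. \<integral>x. \<phi> x \<partial>(M j)) \<longlonglongrightarrow> (\<integral>x. \<phi> x \<partial>m)"
proof (rule LIMSEQ_I)
  fix r :: real assume "0 < r"
  then obtain n where n: "\<And>x y. x \<in> X \<Longrightarrow> y \<in> X \<Longrightarrow> prefix_word n x = prefix_word n y \<Longrightarrow> \<bar>\<phi> x - \<phi> y\<bar> < r / 3"
    using uniformly_close_on_cylinders[OF \<phi>, of "r / 3"] by (metis zero_less_divide_iff zero_less_numeral)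
  \<comment> \<open>Any point of the cylinder will do as a sample; words without such a point have
    weight zero.\<close>
  define \<psi> where "\<psi> w = \<phi> (SOME x. x \<in> X \<and> prefix_word n x = w)" for w
  have close: "\<bar>\<phi> x - \<psi> (prefix_word n x)\<bar> \<le> r / 3" if x: "x \<in> X" for x
  proof -
    have "\<exists>y. y \<in> X \<and> prefix_word n y = prefix_word n x" using x by blast
    from someI_ex[OF this] show ?thesis
      unfolding \<psi>_def by (intro less_imp_le n x) auto
  qed
  define s where "s M = (\<Sum>w\<in>words k n. \<psi> w * measure M (cyl X w))" for M
  have "(\<lambda>j. s (M j)) \<longlonglongrightarrow> s m"
    unfolding s_def by (intro tendsto_intros lim)
  then obtain N where N: "\<And>j. N \<le> j \<Longrightarrow> norm (s (M j) - s m) < r / 3"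
    using LIMSEQ_D[of "\<lambda>j. s (M j)" "s m" "r / 3"] \<open>0 < r\<close> by auto
  have "norm ((\<integral>x. \<phi> x \<partial>(M j)) - (\<integral>x. \<phi> x \<partial>m)) < r" if "N \<le> j" for j
    using integral_close_to_prefix_sum[OF \<phi> M close, of j] integral_close_to_prefix_sum[OF \<phi> m close]
      N[OF that] unfolding s_def[symmetric] real_norm_def by linarith
  then show "\<exists>no. \<forall>j\<ge>no. norm ((\<integral>x. \<phi> x \<partial>(M j)) - (\<integral>x. \<phi> x \<partial>m)) < r" by blast
qed

text \<open>Each block entropy is weakly continuous, being a finite sum of continuous functions of
  cylinder weights.\<close>

lemma tendsto_block_entropy:
  assumes M: "\<And>j. prob_space (M j)" "\<And>j. sets (M j) = sets (restrict_space borel X)"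
    and m: "prob_space m" "sets m = sets (restrict_space borel X)"
    and lim: "\<And>w. (\<lambda>j. measure (M j) (cyl X w)) \<longlonglongrightarrow> measure m (cyl X w)"
  shows "(\<lambda>j. block_entropy (M j) n) \<longlonglongrightarrow> block_entropy m n"
  unfolding block_entropy_words[OF M] block_entropy_words[OF m]
  by (intro tendsto_sum tendsto_eta lim) (simp add: prob_space.prob_le_1[OF M(1)])

lemma shift_pow_measure_preserving:
  assumes "M \<in> invariant_measures X"
  shows "shift_map ^^ j \<in> measurable M M" "distr M M (shift_map ^^ j) = M"
  using measure_preserving_funpow[OF invariantD(4,3)[OF assms]] by simp_all

text \<open>Invariance makes the integrals subadditive in \<open>n\<close>, so Fekete's lemma
  applies. The description as an infimum gives semicontinuity in the measure.\<close>

lemma mean_integral_lim: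
  assumes M: "M \<in> invariant_measures X" and \<Phi>: "subadditive_potential X \<Phi>"
  shows "(\<lambda>n. ereal ((\<integral>x. \<Phi> n x \<partial>M) / n)) \<longlonglongrightarrow> mean_integral \<Phi> M"
    "mean_integral \<Phi> M = (INF q\<in>{1..}. ereal ((\<integral>x. \<Phi> q x \<partial>M) / q))"
proof -
  note MM = invariantD[OF M]
  interpret prob_space M by (rule MM)
  have cont: "continuous_on X (\<Phi> n)" if "0 < n" for n
    using \<Phi> that by (auto simp: subadditive_potential_def)
  note int = continuous_integrable[OF cont finite_measure_axioms MM(2)]
  have "(\<integral>x. \<Phi> (m + n) x \<partial>M) \<le> (\<integral>x. \<Phi> m x \<partial>M) + (\<integral>x. \<Phi> n x \<partial>M)" if "0 < m" "0 < n" for m n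
  proof -
    note T = shift_pow_measure_preserving[OF M, of m]
    have i: "integrable M (\<lambda>x. \<Phi> n ((shift_map ^^ m) x))"
      using integrable_distr_eq[OF T(1) int(1)[OF that(2)]] int(2)[OF that(2)] by (simp add: T(2))
    have "(\<integral>x. \<Phi> (m + n) x \<partial>M) \<le> (\<integral>x. \<Phi> m x + \<Phi> n ((shift_map ^^ m) x) \<partial>M)"
      using \<Phi> that int(2) i
      by (intro integral_mono Bochner_Integration.integrable_add) (auto simp: subadditive_potential_def MM(5))
    also have "\<dots> = (\<integral>x. \<Phi> m x \<partial>M) + (\<integral>x. \<Phi> n ((shift_map ^^ m) x) \<partial>M)"
      using that int(2) i by simp
    also have "(\<integral>x. \<Phi> n ((shift_map ^^ m) x) \<partial>M) = (\<integral>x. \<Phi> n x \<partial>M)"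
      using integral_distr[OF T(1) int(1)[OF that(2)]] by (simp add: T(2))
    finally show ?thesis .
  qed
  then have lim: "(\<lambda>n. ereal ((\<integral>x. \<Phi> n x \<partial>M) / n)) \<longlonglongrightarrow> (INF q\<in>{1..}. ereal ((\<integral>x. \<Phi> q x \<partial>M) / q))"
    by (rule fekete_subadditive)
  show eq: "mean_integral \<Phi> M = (INF q\<in>{1..}. ereal ((\<integral>x. \<Phi> q x \<partial>M) / q))"
    unfolding mean_integral_def by (rule limI[OF lim])
  show "(\<lambda>n. ereal ((\<integral>x. \<Phi> n x \<partial>M) / n)) \<longlonglongrightarrow> mean_integral \<Phi> M"
    unfolding eq by (rule lim)
qed

lemma mean_integral_le:
  assumes "M \<in> invariant_measures X" "subadditive_potential X \<Phi>" "1 \<le> q"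
  shows "mean_integral \<Phi> M \<le> ereal ((\<integral>x. \<Phi> q x \<partial>M) / q)"
  unfolding mean_integral_lim(2)[OF assms(1,2)] using assms(3) by (intro INF_lower) auto

text \<open>A limit of a maximising sequence is a maximiser, because entropy and mean integral are
  infima of weakly continuous quantities. The case in which the supremum is
  \<open>-\<infinity>\<close> is included.\<close>

theorem exists_equilibrium_state_seq:
  assumes ne: "invariant_measures X \<noteq> {}" and \<Phi>: "subadditive_potential X \<Phi>"
  shows "\<exists>m. equilibrium_state_seq X \<Phi> m"
proof -
  let ?E = "\<lambda>m. entropy_of m + mean_integral \<Phi> m"
  let ?S = "SUP m\<in>invariant_measures X. ?E m"
  obtain f where f: "incseq f" "range f \<subseteq> ?E ` invariant_measures X" "?S = (SUP i. f i)"
    using Sup_countable_SUP[of "?E ` invariant_measures X"] ne by blast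
  have "\<forall>i. \<exists>m. m \<in> invariant_measures X \<and> f i = ?E m" using f(2) by blast
  then obtain m where m: "\<And>i. m i \<in> invariant_measures X" "\<And>i. f i = ?E (m i)" by metis
  note mm = invariantD[OF m(1)]
  have "(\<lambda>n. measure (m n) (cyl X w) - measure (m n) (shift_map -` cyl X w \<inter> X)) \<longlonglongrightarrow> 0" for w
    using measure_distr_shift_cyl[OF mm(2)] by (simp add: mm(3))
  from convergent_subsequence_cyl[OF mm(1,2) this]
  obtain r \<mu> where r: "strict_mono (r :: nat \<Rightarrow> nat)" and \<mu>: "\<mu> \<in> invariant_measures X"
    and lim: "\<And>w. (\<lambda>n. measure (m (r n)) (cyl X w)) \<longlonglongrightarrow> measure \<mu> (cyl X w)" by blast
  note \<mu>\<mu> = invariantD[OF \<mu>]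
  have fE: "f = (\<lambda>i. ?E (m i))" by (rule ext) (rule m(2))
  have "f \<longlonglongrightarrow> ?S" unfolding f(3) by (rule LIMSEQ_SUP[OF f(1)])
  then have "(\<lambda>i. ?E (m i)) \<longlonglongrightarrow> ?S" by (simp only: fE)
  then have limS: "(\<lambda>i. ?E (m (r i))) \<longlonglongrightarrow> ?S"
    using LIMSEQ_subseq_LIMSEQ[OF _ r] by (fastforce simp: comp_def)
  \<comment> \<open>Along the sequence \<open>q\<close> and \<open>l\<close> stay fixed; only
    afterwards \<open>q\<close> and then \<open>l\<close> tend to infinity.\<close>
  have S_le: "?S \<le> ereal (block_entropy \<mu> q / q + (\<integral>x. \<Phi> l x \<partial>\<mu>) / l)" if "1 \<le> q" "1 \<le> l" for q l
  proof (rule LIMSEQ_le[OF limS])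
    have cont: "continuous_on X (\<Phi> l)" using \<Phi> that by (simp add: subadditive_potential_def)
    show "(\<lambda>i. ereal (block_entropy (m (r i)) q / q + (\<integral>x. \<Phi> l x \<partial>(m (r i))) / l))
        \<longlonglongrightarrow> ereal (block_entropy \<mu> q / q + (\<integral>x. \<Phi> l x \<partial>\<mu>) / l)"
      using tendsto_block_entropy[OF mm(1,2) \<mu>\<mu>(1,2) lim] that
        tendsto_integral_continuous[OF cont mm(1,2) \<mu>\<mu>(1,2) lim]
      by (intro tendsto_ereal tendsto_add tendsto_divide tendsto_const) auto
    have "?E M \<le> ereal (block_entropy M q / q + (\<integral>x. \<Phi> l x \<partial>M) / l)" if M: "M \<in> invariant_measures X" for M
    proof -
      obtain h where "entropy_of M = ereal h" "h \<le> block_entropy M q / q"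
        using entropy_of_block_entropy[OF M] \<open>1 \<le> q\<close> by metis
      then have "entropy_of M \<le> ereal (block_entropy M q / q)" by simp
      from add_mono[OF this mean_integral_le[OF M \<Phi> \<open>1 \<le> l\<close>]] show ?thesis by simp
    qed
    then show "\<exists>N. \<forall>n\<ge>N. ?E (m (r n)) \<le> ereal (block_entropy (m (r n)) q / q + (\<integral>x. \<Phi> l x \<partial>(m (r n))) / l)"
      using m(1) by blast
  qed
  obtain h where h: "entropy_of \<mu> = ereal h" "(\<lambda>n. block_entropy \<mu> n / n) \<longlonglongrightarrow> h"
    using entropy_of_block_entropy[OF \<mu>] by metis
  have S_le2: "?S \<le> ereal (h + (\<integral>x. \<Phi> l x \<partial>\<mu>) / l)" if "1 \<le> l" for l
  proof (rule LIMSEQ_le_const)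
    show "(\<lambda>q. ereal (block_entropy \<mu> q / q + (\<integral>x. \<Phi> l x \<partial>\<mu>) / l)) \<longlonglongrightarrow> ereal (h + (\<integral>x. \<Phi> l x \<partial>\<mu>) / l)"
      by (intro tendsto_ereal tendsto_add h(2) tendsto_const)
  qed (use S_le that in blast)
  have "?S \<le> ereal h + mean_integral \<Phi> \<mu>"
  proof (rule LIMSEQ_le_const)
    show "(\<lambda>l. ereal h + ereal ((\<integral>x. \<Phi> l x \<partial>\<mu>) / l)) \<longlonglongrightarrow> ereal h + mean_integral \<Phi> \<mu>"
      by (rule tendsto_add_ereal_general[OF _ tendsto_const mean_integral_lim(1)[OF \<mu> \<Phi>]]) simp
    show "\<exists>N. \<forall>n\<ge>N. ?S \<le> ereal h + ereal ((\<integral>x. \<Phi> n x \<partial>\<mu>) / n)"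
      using S_le2 by auto
  qed
  then have "?S \<le> ?E \<mu>" using h(1) by simp
  moreover have "?E \<mu> \<le> ?S" using \<mu> by (rule SUP_upper)
  ultimately show ?thesis
    using \<mu> unfolding equilibrium_state_seq_def maximizes_over_def by (intro exI[of _ \<mu>]) auto
qed

end

section \<open>Averages along orbits\<close>

text \<open>An empirical measure with random starting point. As the image of a single discrete law
  it is a probability measure, for starting points in \<open>X\<close>, even when
  \<open>n = 0\<close>: there \<open>pmf_of_set\<close> is unspecified but still a
  \<open>pmf\<close>.\<close>

definition orbit_average ::
  "(nat \<Rightarrow> nat) set \<Rightarrow> nat \<Rightarrow> 'i pmf \<Rightarrow> ('i \<Rightarrow> (nat \<Rightarrow> nat)) \<Rightarrow> (nat \<Rightarrow> nat) measure" where
  "orbit_average X n W pt = distr (measure_pmf (pmf_of_set {..<n} \<bind> (\<lambda>j. map_pmf (Pair j) W)))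
     (restrict_space borel X) (\<lambda>(j, i). (shift_map ^^ j) (pt i))"

context subshift_loc
begin

lemma orbit_average_measurable:
  assumes "\<And>i. pt i \<in> X"
  shows "(\<lambda>(j, i). (shift_map ^^ j) (pt i)) \<in> measurable (measure_pmf q) (restrict_space borel X)"
  using assms shift_pow_X by (auto simp: space_restrict_space)

lemma prob_space_orbit_average:
  assumes "\<And>i. pt i \<in> X"
  shows "prob_space (orbit_average X n W pt)" "sets (orbit_average X n W pt) = sets (restrict_space borel X)"
  unfolding orbit_average_def
  by (rule prob_space.prob_space_distr[OF prob_space_measure_pmf orbit_average_measurable[OF assms]]) simp

lemma integral_orbit_average:
  fixes \<phi> :: "(nat \<Rightarrow> nat) \<Rightarrow> real"
  assumes pt: "\<And>i. pt i \<in> X" and n: "0 < n" and W: "finite (set_pmf W)"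
    and \<phi>: "\<phi> \<in> borel_measurable (restrict_space borel X)"
  shows "(\<integral>x. \<phi> x \<partial>(orbit_average X n W pt))
    = (\<Sum>j<n. measure_pmf.expectation W (\<lambda>i. \<phi> ((shift_map ^^ j) (pt i)))) / n"
proof -
  have "(\<integral>x. \<phi> x \<partial>(orbit_average X n W pt)) = measure_pmf.expectation
      (pmf_of_set {..<n} \<bind> (\<lambda>j. map_pmf (Pair j) W)) (\<lambda>(j, i). \<phi> ((shift_map ^^ j) (pt i)))"
    unfolding orbit_average_def
    by (subst integral_distr[OF orbit_average_measurable[OF pt] \<phi>]) (simp add: case_prod_unfold)
  also have "\<dots> = (\<Sum>j<n. pmf (pmf_of_set {..<n}) j *\<^sub>R
      measure_pmf.expectation (map_pmf (Pair j) W) (\<lambda>(j, i). \<phi> ((shift_map ^^ j) (pt i))))"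
    using n W by (intro pmf_expectation_bind) (auto simp: set_pmf_of_set lessThan_empty_iff)
  also have "\<dots> = (\<Sum>j<n. (1 / n) * measure_pmf.expectation W (\<lambda>i. \<phi> ((shift_map ^^ j) (pt i))))"
  proof (intro sum.cong refl)
    fix j assume "j \<in> {..<n}"
    then have "pmf (pmf_of_set {..<n}) j = 1 / n" using n by (subst pmf_of_set) auto
    then show "pmf (pmf_of_set {..<n}) j *\<^sub>R
        measure_pmf.expectation (map_pmf (Pair j) W) (\<lambda>(j, i). \<phi> ((shift_map ^^ j) (pt i)))
      = (1 / n) * measure_pmf.expectation W (\<lambda>i. \<phi> ((shift_map ^^ j) (pt i)))" by simp
  qed
  finally show ?thesis by (simp add: sum_divide_distrib)
qed

lemma measure_orbit_average:
  assumes pt: "\<And>i. pt i \<in> X" and n: "0 < n" and W: "finite (set_pmf W)"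
    and A: "A \<in> sets (restrict_space borel X)"
  shows "measure (orbit_average X n W pt) A
    = (\<Sum>j<n. measure_pmf.prob W {i. (shift_map ^^ j) (pt i) \<in> A}) / n"
proof -
  note s = prob_space_orbit_average[OF pt, of n W]
  have AX: "A \<subseteq> X" using sets.sets_into_space[OF A] by (simp add: space_restrict_space)
  have "measure (orbit_average X n W pt) A = (\<integral>x. indicator A x \<partial>(orbit_average X n W pt))"
    using AX by (simp add: space_eq_X[OF s(2)] Int_absorb2)
  also have "\<dots> = (\<Sum>j<n. measure_pmf.expectation W (\<lambda>i. indicator A ((shift_map ^^ j) (pt i)))) / n"
    using A by (intro integral_orbit_average pt n W borel_measurable_indicator)
  also have "(\<lambda>j. measure_pmf.expectation W (\<lambda>i. indicator A ((shift_map ^^ j) (pt i)) :: real))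
      = (\<lambda>j. measure_pmf.prob W {i. (shift_map ^^ j) (pt i) \<in> A})"
  proof
    fix j
    have "(\<lambda>i. indicator A ((shift_map ^^ j) (pt i)) :: real) = indicator {i. (shift_map ^^ j) (pt i) \<in> A}"
      by (auto simp: indicator_def)
    then show "measure_pmf.expectation W (\<lambda>i. indicator A ((shift_map ^^ j) (pt i)))
      = measure_pmf.prob W {i. (shift_map ^^ j) (pt i) \<in> A}" by simp
  qed
  finally show ?thesis .
qed

text \<open>The sums for a cylinder and for its shift preimage telescope: they differ in the times
  \<open>0\<close> and \<open>n\<close> only.\<close>

lemma orbit_average_almost_invariant:
  assumes pt: "\<And>i. pt i \<in> X" and n: "0 < n" and W: "finite (set_pmf W)"
  shows "\<bar>measure (orbit_average X n W pt) (cyl X w)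
    - measure (orbit_average X n W pt) (shift_map -` cyl X w \<inter> X)\<bar> \<le> 1 / n"
proof -
  define f where "f j = measure_pmf.prob W {i. (shift_map ^^ j) (pt i) \<in> cyl X w}" for j
  note s = prob_space_orbit_average[OF pt, of n W]
  have "shift_map -` cyl X w \<inter> X \<in> sets (restrict_space borel X)"
    unfolding cyl_Cons using cyl_in_sets by auto
  from measure_orbit_average[OF pt n W this]
  have "measure (orbit_average X n W pt) (shift_map -` cyl X w \<inter> X) = (\<Sum>j<n. f (Suc j)) / n"
    using shift_pow_X[OF pt] by (simp add: f_def)
  moreover have "measure (orbit_average X n W pt) (cyl X w) = (\<Sum>j<n. f j) / n"
    using measure_orbit_average[OF pt n W cyl_in_sets[of w]] by (simp add: f_def)
  moreover have "(\<Sum>j<n. f (Suc j)) - (\<Sum>j<n. f j) = f n - f 0"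
    using sum_lessThan_telescope[of f n] by (simp add: sum_subtractf)
  moreover have "\<bar>f n - f 0\<bar> \<le> 1"
    unfolding f_def using measure_pmf.prob_le_1[of W] measure_nonneg[of "measure_pmf W"]
    by (smt (verit))
  ultimately show ?thesis
    using n by (simp add: diff_divide_distrib[symmetric] abs_divide divide_right_mono abs_minus_commute)
qed

lemma orbit_average_subsequence:
  fixes W :: "nat \<Rightarrow> 'i pmf"
  assumes pt: "\<And>n i. pt n i \<in> X" and W: "\<And>n. finite (set_pmf (W n))"
  obtains r m where "strict_mono (r :: nat \<Rightarrow> nat)" "m \<in> invariant_measures X"
    "\<And>w. (\<lambda>n. measure (orbit_average X (r n) (W (r n)) (pt (r n))) (cyl X w)) \<longlonglongrightarrow> measure m (cyl X w)"
proof -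
  let ?M = "\<lambda>n. orbit_average X n (W n) (pt n)"
  note s = prob_space_orbit_average[OF pt]
  have "(\<lambda>n. measure (?M n) (cyl X w) - measure (?M n) (shift_map -` cyl X w \<inter> X)) \<longlonglongrightarrow> 0" for w
  proof (rule Lim_null_comparison[OF _ lim_1_over_n])
    show "\<forall>\<^sub>F n in sequentially. norm (measure (?M n) (cyl X w) - measure (?M n) (shift_map -` cyl X w \<inter> X)) \<le> 1 / real n"
      using orbit_average_almost_invariant[OF pt _ W] by (intro eventually_sequentiallyI[of 1]) simp
  qed
  from convergent_subsequence_cyl[of ?M, OF s this] show thesis
    using that by blast
qed

text \<open>Krylov-Bogolyubov: a limit of averages along the orbit of one point.\<close>

lemma invariant_measures_nonempty: "invariant_measures X \<noteq> {}"
proof -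
  obtain x where "x \<in> X" using ne by blast
  then show ?thesis
    using orbit_average_subsequence[of "\<lambda>_ _. x" "\<lambda>_. return_pmf (0 :: nat)"] by auto
qed

text \<open>Points that agree in the first \<open>n + c\<close> letters stay within
  \<open>(1 / 2) ^ c\<close> of each other at the times below \<open>n\<close>.\<close>

lemma separated_card:
  assumes E: "E \<in> separated_sets X n e" and c: "(1 / 2) ^ c \<le> e"
  shows "card E \<le> k ^ (n + c)"
proof -
  have fin: "finite E" and EX: "E \<subseteq> X" using E by (auto simp: separated_sets_def)
  have "inj_on (prefix_word (n + c)) E"
  proof (rule inj_onI, rule ccontr)
    fix y z assume yz: "y \<in> E" "z \<in> E" "prefix_word (n + c) y = prefix_word (n + c) z" "y \<noteq> z"
    then obtain i where i: "i < n" "symbolic_dist ((shift_map ^^ i) y) ((shift_map ^^ i) z) > e"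
      using E unfolding separated_sets_def by blast
    let ?y = "(shift_map ^^ i) y" and ?z = "(shift_map ^^ i) z"
    have "(0 :: real) < (1 / 2) ^ c" by simp
    then have "0 < e" using c by linarith
    then have ne: "?y \<noteq> ?z" using i(2) by (auto simp: symbolic_dist_def)
    define l where "l = (LEAST j. ?y j \<noteq> ?z j)"
    have "\<exists>j. ?y j \<noteq> ?z j" using ne by (auto simp: fun_eq_iff)
    then have l: "?y l \<noteq> ?z l" unfolding l_def by (rule LeastI_ex)
    have "e < (1 / 2) ^ l" using i(2) ne by (simp add: symbolic_dist_def l_def)
    with c have "(1 / 2 :: real) ^ c < (1 / 2) ^ l" by (rule order.strict_trans1)
    then have "l < c" by simp
    moreover have "y (l + i) \<noteq> z (l + i)" using l by (simp add: shift_map_funpow)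
    ultimately show False using yz(3) i(1) by (simp add: prefix_word_eq_iff)
  qed
  then have "card E = card (prefix_word (n + c) ` E)" by (simp add: card_image)
  also have "\<dots> \<le> card (words k (n + c))"
    using EX prefix_word_words by (intro card_mono) auto
  finally show ?thesis by (simp add: card_words)
qed

text \<open>Let \<open>s n\<close> be the maximum of \<open>\<Phi> n\<close>. If
  \<open>s n / n\<close> tended to \<open>-\<infinity>\<close>, the pressure would be
  \<open>-\<infinity>\<close>, as there are only exponentially many separated points. Otherwise
  averages along the orbits of maximising points have a limit measure whose mean integral is at
  least the infimum of \<open>s n / n\<close>.\<close>

lemma exists_finite_mean_integral:
  assumes \<Phi>: "subadditive_potential X \<Phi>" and P: "subadditive_pressure X \<Phi> \<noteq> -\<infinity>"
  obtains m where "m \<in> invariant_measures X" "mean_integral \<Phi> m \<noteq> -\<infinity>"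
proof -
  have cont: "continuous_on X (\<Phi> n)" if "0 < n" for n
    using \<Phi> that by (auto simp: subadditive_potential_def)
  have sub: "\<Phi> (m + n) y \<le> \<Phi> m y + \<Phi> n ((shift_map ^^ m) y)" if "0 < m" "0 < n" "y \<in> X" for m n y
    using \<Phi> that by (auto simp: subadditive_potential_def)
  have "\<exists>y\<in>X. 0 < n \<longrightarrow> (\<forall>z\<in>X. \<Phi> n z \<le> \<Phi> n y)" for n
    using continuous_attains_sup[OF compact_X ne cont, of n] ne by (cases "0 < n") auto
  then obtain y where y: "\<And>n. y n \<in> X" "\<And>n z. 0 < n \<Longrightarrow> z \<in> X \<Longrightarrow> \<Phi> n z \<le> \<Phi> n (y n)"
    by metis
  define s where "s n = \<Phi> n (y n)" for n
  have "s (m + n) \<le> s m + s n" if "0 < m" "0 < n" for m n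
    using sub[OF that y(1), of "m + n"] y(2)[OF that(1) y(1), of "m + n"]
      y(2)[OF that(2) shift_pow_X[OF y(1)], of m "m + n"] by (simp add: s_def)
  then have limS: "(\<lambda>n. ereal (s n / n)) \<longlonglongrightarrow> (INF q\<in>{1..}. ereal (s q / q))"
    by (rule fekete_subadditive)
  have not_inf: "(INF q\<in>{1..}. ereal (s q / q)) \<noteq> -\<infinity>"
  proof
    assume inf: "(INF q\<in>{1..}. ereal (s q / q)) = -\<infinity>"
    have "limsup (\<lambda>n. ereal (ln (SUP E\<in>separated_sets X n e. \<Sum>y\<in>E. exp (\<Phi> n y)) / n)) = -\<infinity>" if e: "0 < e" for e
    proof -
      \<comment> \<open>The number of letters beyond \<open>n\<close> needed to see the scale
        \<open>e\<close>; it is added to the exponent of \<open>k\<close> and does not depend on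
        \<open>n\<close>.\<close>
      obtain c where c: "(1 / 2 :: real) ^ c < e" using real_arch_pow_inv[of e "1 / 2"] e by auto
      have bound: "ln (SUP E\<in>separated_sets X n e. \<Sum>y\<in>E. exp (\<Phi> n y)) / n \<le> (1 + c) * ln k + s n / n"
        if n: "1 \<le> n" for n
      proof -
        let ?S = "SUP E\<in>separated_sets X n e. \<Sum>y\<in>E. exp (\<Phi> n y)"
        have le: "(\<Sum>y\<in>E. exp (\<Phi> n y)) \<le> real (k ^ (n + c)) * exp (s n)" if E: "E \<in> separated_sets X n e" for E
        proof -
          have "(\<Sum>y\<in>E. exp (\<Phi> n y)) \<le> (\<Sum>y\<in>E. exp (s n))"
            using E y(2) n by (intro sum_mono) (auto simp: separated_sets_def s_def)
          also have "\<dots> = card E * exp (s n)" by simp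
          also have "\<dots> \<le> real (k ^ (n + c)) * exp (s n)"
            using separated_card[OF E less_imp_le[OF c]] by (intro mult_right_mono) (simp_all only: of_nat_le_iff exp_ge_zero)
          finally show ?thesis .
        qed
        obtain x where x: "x \<in> X" using ne by blast
        then have x1: "{x} \<in> separated_sets X n e" by (simp add: separated_sets_def)
        have "exp (\<Phi> n x) \<le> ?S"
          using cSUP_upper[OF x1, of "\<lambda>E. \<Sum>y\<in>E. exp (\<Phi> n y)"] le by (force simp: bdd_above_def)
        then have pos: "0 < ?S" by (meson exp_gt_zero less_le_trans)
        have "?S \<le> real (k ^ (n + c)) * exp (s n)"
          using x1 le by (intro cSUP_least) auto
        then have "ln ?S \<le> ln (real (k ^ (n + c)) * exp (s n))" using pos by (rule ln_mono)
        also have "\<dots> = (n + c) * ln k + s n" using k_pos by (simp add: ln_mult ln_realpow)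
        finally have "ln ?S / n \<le> ((n + c) * ln k + s n) / n" by (rule divide_right_mono) simp
        also have "\<dots> = (1 + c / n) * ln k + s n / n" using n by (simp add: field_simps)
        also have "\<dots> \<le> (1 + c) * ln k + s n / n"
        proof -
          have "real c / n \<le> real c / 1" using n by (intro divide_left_mono) auto
          then show ?thesis using k_pos by (intro add_right_mono mult_right_mono) auto
        qed
        finally show ?thesis .
      qed
      have "(\<lambda>n. ereal ((1 + c) * ln k) + ereal (s n / n)) \<longlonglongrightarrow> ereal ((1 + c) * ln k) + -\<infinity>"
        using limS unfolding inf by (intro tendsto_add_ereal_general[OF _ tendsto_const]) auto
      then have "limsup (\<lambda>n. ereal ((1 + c) * ln k) + ereal (s n / n)) = -\<infinity>"
        by (intro lim_imp_Limsup) auto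
      moreover have "limsup (\<lambda>n. ereal (ln (SUP E\<in>separated_sets X n e. \<Sum>y\<in>E. exp (\<Phi> n y)) / n))
          \<le> limsup (\<lambda>n. ereal ((1 + c) * ln k) + ereal (s n / n))"
        using bound by (intro Limsup_mono eventually_sequentiallyI[of 1]) simp
      ultimately show ?thesis by simp
    qed
    then have "\<forall>\<^sub>F e in at_right 0. limsup (\<lambda>n. ereal (ln (SUP E\<in>separated_sets X n e. \<Sum>y\<in>E. exp (\<Phi> n y)) / n)) = -\<infinity>"
      by (auto simp: eventually_at_right_field intro!: exI[of _ 1])
    then have "((\<lambda>e. limsup (\<lambda>n. ereal (ln (SUP E\<in>separated_sets X n e. \<Sum>y\<in>E. exp (\<Phi> n y)) / n))) \<longlongrightarrow> -\<infinity>) (at_right 0)"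
      by (rule tendsto_eventually)
    then have "subadditive_pressure X \<Phi> = -\<infinity>"
      unfolding subadditive_pressure_def by (intro tendsto_Lim) auto
    then show False using P by simp
  qed
  have "(INF q\<in>{1..}. ereal (s q / q)) \<le> ereal (s 1 / 1)" by (rule INF_lower2[of 1]) auto
  then obtain L where L: "(INF q\<in>{1..}. ereal (s q / q)) = ereal L"
    using not_inf by (cases "INF q\<in>{1..}. ereal (s q / q)") auto
  have s_ge: "L \<le> s n / n" if "1 \<le> n" for n
  proof -
    have "ereal L \<le> ereal (s n / n)" unfolding L[symmetric] using that by (intro INF_lower) auto
    then show ?thesis by simp
  qed
  obtain r m where r: "strict_mono (r :: nat \<Rightarrow> nat)" and m: "m \<in> invariant_measures X"
    and lim: "\<And>w. (\<lambda>n. measure (orbit_average X (r n) (return_pmf (0 :: nat)) (\<lambda>_. y (r n))) (cyl X w)) \<longlonglongrightarrow> measure m (cyl X w)"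
    by (rule orbit_average_subsequence[of "\<lambda>n _. y n" "\<lambda>_. return_pmf (0 :: nat)"]) (use y(1) in auto)
  let ?M = "\<lambda>n. orbit_average X n (return_pmf (0 :: nat)) (\<lambda>_. y n)"
  note mm = invariantD[OF m]
  \<comment> \<open>At the maximising point \<open>y n\<close>, the orbit bound estimates
    \<open>l * s n\<close> by the orbit sum of \<open>\<Phi> l\<close> plus a constant, and that sum
    is \<open>n\<close> times an integral against the empirical measure.\<close>
  have "L \<le> (\<integral>x. \<Phi> l x \<partial>m) / l" if l: "1 \<le> l" for l
  proof -
    have "\<exists>B. \<forall>i\<in>{1..l}. \<forall>x\<in>X. \<bar>\<Phi> i x\<bar> \<le> B"
    proof -
      have "\<forall>i\<in>{1..l}. \<exists>B. \<forall>x\<in>X. \<bar>\<Phi> i x\<bar> \<le> B"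
        using continuous_bounded[OF cont] by (metis atLeastAtMost_iff less_eq_Suc_le One_nat_def)
      then obtain B where "\<forall>i\<in>{1..l}. \<forall>x\<in>X. \<bar>\<Phi> i x\<bar> \<le> B i" by metis
      then have "\<bar>\<Phi> i x\<bar> \<le> (\<Sum>i\<in>{1..l}. \<bar>B i\<bar>)" if "i \<in> {1..l}" "x \<in> X" for i x
        using that member_le_sum[of i "{1..l}" "\<lambda>i. \<bar>B i\<bar>"] by fastforce
      then show ?thesis by blast
    qed
    then obtain B where B0: "\<forall>i\<in>{1..l}. \<forall>x\<in>X. \<bar>\<Phi> i x\<bar> \<le> B" by blast
    have B: "\<bar>\<Phi> i x\<bar> \<le> B" if "1 \<le> i" "i \<le> l" "x \<in> X" for i x
      using B0 that by simp
    define K where "K = (3 * real l + 2) * B"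
    have ge: "l * L - K * (1 / n) \<le> (\<integral>x. \<Phi> l x \<partial>(?M n))" if n: "l < n" for n
    proof -
      have 1: "l * s n \<le> (\<Sum>j<n. \<Phi> l ((shift_map ^^ j) (y n))) + K"
        unfolding s_def K_def
        by (rule subadditive_orbit_bound[OF sub _ y(1) n]) (use B l in auto)
      have "(\<integral>x. \<Phi> l x \<partial>(?M n)) = (\<Sum>j<n. \<Phi> l ((shift_map ^^ j) (y n))) / n"
        using n l by (subst integral_orbit_average)
          (auto intro!: y(1) borel_measurable_continuous_on_restrict cont)
      moreover have "l * L \<le> l * (s n / n)" using s_ge[of n] n by (intro mult_left_mono) auto
      ultimately show ?thesis using 1 n by (simp add: field_simps)
    qed
    have "l * L - K * 0 \<le> (\<integral>x. \<Phi> l x \<partial>m)"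
    proof (rule LIMSEQ_le)
      have "(\<lambda>n. 1 / real (r n)) \<longlonglongrightarrow> 0"
        using LIMSEQ_subseq_LIMSEQ[OF lim_1_over_n r] by (simp add: comp_def)
      then show "(\<lambda>n. l * L - K * (1 / real (r n))) \<longlonglongrightarrow> l * L - K * 0" by (intro tendsto_intros)
      show "(\<lambda>n. \<integral>x. \<Phi> l x \<partial>(?M (r n))) \<longlonglongrightarrow> (\<integral>x. \<Phi> l x \<partial>m)"
        by (rule tendsto_integral_continuous[OF _ prob_space_orbit_average mm(1,2) lim])
          (use l cont y(1) in auto)
      show "\<exists>N. \<forall>n\<ge>N. l * L - K * (1 / real (r n)) \<le> (\<integral>x. \<Phi> l x \<partial>(?M (r n)))"
        using ge seq_suble[OF r] by (intro exI[of _ "Suc l"]) (meson Suc_le_lessD le_trans)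
    qed
    then show ?thesis using l by (simp add: field_simps)
  qed
  then have "ereal L \<le> mean_integral \<Phi> m"
    unfolding mean_integral_lim(2)[OF m \<Phi>] by (intro INF_greatest) auto
  then have "mean_integral \<Phi> m \<noteq> -\<infinity>" by (cases "mean_integral \<Phi> m") auto
  then show thesis by (rule that[OF m])
qed

end

section \<open>Fibres of a one-block factor map\<close>

lemma cyl_empty_iff: "cyl Z u = {} \<longleftrightarrow> u \<notin> prefix_word (length u) ` Z"
proof -
  have "x \<in> cyl Z u \<longleftrightarrow> x \<in> Z \<and> u = prefix_word (length u) x" for x
    unfolding cyl_def mem_Collect_eq by (rule conj_cong[OF refl], rule eq_commute)
  then have "cyl Z u \<noteq> {} \<longleftrightarrow> (\<exists>x\<in>Z. u = prefix_word (length u) x)"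
    by (simp only: ex_in_conv[symmetric] Bex_def)
  then show ?thesis unfolding image_iff by argo
qed

lemma (in subshift_loc) sum_words_eq_sum_prefix_words:
  fixes f :: "nat list \<Rightarrow> real"
  assumes "\<And>w. cyl X w = {} \<Longrightarrow> f w = 0"
  shows "(\<Sum>w\<in>words k n. f w) = (\<Sum>w\<in>prefix_word n ` X. f w)"
proof (rule sum.mono_neutral_right[OF finite_words])
  show "prefix_word n ` X \<subseteq> words k n" by (simp add: image_subset_iff prefix_word_words)
  show "\<forall>w\<in>words k n - prefix_word n ` X. f w = 0"
  proof
    fix w assume w: "w \<in> words k n - prefix_word n ` X"
    then have "length w = n" by (simp add: words_def)
    then show "f w = 0" using w by (intro assms) (simp add: cyl_empty_iff)
  qed
qed

locale factor_loc = X: subshift_loc X k + Y: subshift_loc Y l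
  for X :: "(nat \<Rightarrow> nat) set" and k and Y :: "(nat \<Rightarrow> nat) set" and l +
  fixes \<pi> :: "(nat \<Rightarrow> nat) \<Rightarrow> (nat \<Rightarrow> nat)"
  assumes factor: "factor_map X Y \<pi>" and one_block: "one_block X \<pi>"
begin

lemma cont_pi: "continuous_on X \<pi>" and pi_image: "\<pi> ` X = Y"
  and pi_shift: "x \<in> X \<Longrightarrow> \<pi> (shift_map x) = shift_map (\<pi> x)"
  using factor by (auto simp: factor_map_def)

lemma pi_in: "x \<in> X \<Longrightarrow> \<pi> x \<in> Y"
  using pi_image by blast

lemma pi_shift_pow: "x \<in> X \<Longrightarrow> \<pi> ((shift_map ^^ j) x) = (shift_map ^^ j) (\<pi> x)"
  by (induction j) (simp_all add: pi_shift X.shift_pow_X)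

lemma pi_prefix: "x \<in> X \<Longrightarrow> x' \<in> X \<Longrightarrow> prefix_word n x = prefix_word n x' \<Longrightarrow> prefix_word n (\<pi> x) = prefix_word n (\<pi> x')"
  using one_block unfolding one_block_def prefix_word_eq_iff by blast

text \<open>An occurrence at position \<open>i\<close> is moved to position 0 by the shift, which
  commutes with \<open>\<pi>\<close>.\<close>

lemma preimage_words_eq:
  "preimage_words X \<pi> w = prefix_word (length w) ` {x \<in> X. prefix_word (length w) (\<pi> x) = w}"
proof (intro equalityI subsetI)
  fix u assume "u \<in> preimage_words X \<pi> w"
  then obtain x i where x: "x \<in> X" "u = map x [i..<i + length w]" "map (\<pi> x) [i..<i + length w] = w"
    by (auto simp: preimage_words_def)
  let ?x = "(shift_map ^^ i) x"
  have "prefix_word (length w) (\<pi> ?x) = w"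
    unfolding pi_shift_pow[OF x(1)] prefix_word_shift by (rule x(3))
  then have "?x \<in> {x \<in> X. prefix_word (length w) (\<pi> x) = w}" using X.shift_pow_X[OF x(1)] by simp
  moreover have "u = prefix_word (length w) ?x" unfolding prefix_word_shift by (rule x(2))
  ultimately show "u \<in> prefix_word (length w) ` {x \<in> X. prefix_word (length w) (\<pi> x) = w}" by blast
next
  fix u assume "u \<in> prefix_word (length w) ` {x \<in> X. prefix_word (length w) (\<pi> x) = w}"
  then obtain x where "x \<in> X" "prefix_word (length w) (\<pi> x) = w" "u = prefix_word (length w) x" by blast
  then show "u \<in> preimage_words X \<pi> w"
    unfolding preimage_words_def prefix_word_def by (intro CollectI exI[of _ x] exI[of _ 0]) simp
qed

lemma preimage_words_prefix:
  "preimage_words X \<pi> (prefix_word n y) = prefix_word n ` {x \<in> X. prefix_word n (\<pi> x) = prefix_word n y}"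
  unfolding preimage_words_eq length_prefix_word ..

text \<open>The letter map of the one-block code, extended to words. By \<open>pi_prefix\<close> the
  chosen point does not matter for words of \<open>X\<close>; other words get an arbitrary
  value.\<close>

definition word_image :: "nat list \<Rightarrow> nat list" where
  "word_image u = prefix_word (length u) (\<pi> (SOME x. x \<in> X \<and> prefix_word (length u) x = u))"

lemma word_image_prefix: "x \<in> X \<Longrightarrow> word_image (prefix_word n x) = prefix_word n (\<pi> x)"
proof -
  assume x: "x \<in> X"
  define z where "z = (SOME z. z \<in> X \<and> prefix_word n z = prefix_word n x)"
  have "z \<in> X \<and> prefix_word n z = prefix_word n x"
    unfolding z_def by (rule someI[of _ x]) (use x in simp)
  then show ?thesis unfolding word_image_def length_prefix_word z_def[symmetric]
    using pi_prefix x by blast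
qed

abbreviation words_X :: "nat \<Rightarrow> nat list set" where "words_X n \<equiv> prefix_word n ` X"
abbreviation words_Y :: "nat \<Rightarrow> nat list set" where "words_Y n \<equiv> prefix_word n ` Y"

lemma finite_words_XY: "finite (words_X n)" "finite (words_Y n)"
  using finite_subset[of "words_X n" "words k n"] finite_subset[of "words_Y n" "words l n"]
    X.prefix_word_words Y.prefix_word_words by auto

lemma word_image_words: "word_image ` words_X n \<subseteq> words_Y n"
  by (simp add: image_subset_iff word_image_prefix pi_in)

lemma preimage_words_fibre:
  assumes "length w = n"
  shows "preimage_words X \<pi> w = {u \<in> words_X n. word_image u = w}"
proof (intro equalityI subsetI)
  fix u assume "u \<in> preimage_words X \<pi> w"
  then obtain x where "x \<in> X" "prefix_word n (\<pi> x) = w" "u = prefix_word n x"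
    unfolding preimage_words_eq assms by blast
  then show "u \<in> {u \<in> words_X n. word_image u = w}" using word_image_prefix by simp
next
  fix u assume "u \<in> {u \<in> words_X n. word_image u = w}"
  then obtain x where x: "x \<in> X" "u = prefix_word n x" "word_image u = w" by blast
  then have "prefix_word n (\<pi> x) = w" using word_image_prefix[OF x(1), of n] by simp
  then show "u \<in> preimage_words X \<pi> w"
    unfolding preimage_words_eq assms using x(1,2) by (intro image_eqI[of _ _ x]) simp_all
qed

lemma preimage_wordsD:
  assumes "u \<in> preimage_words X \<pi> w"
  shows "length u = length w" "word_image u = w"
proof -
  have u: "u \<in> words_X (length w)" "word_image u = w"
    using assms unfolding preimage_words_fibre[OF refl] by simp_all
  show "word_image u = w" by (rule u(2))
  obtain x where "u = prefix_word (length w) x" using u(1) by blast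
  then have "length u = length (prefix_word (length w) x)" by (rule arg_cong)
  then show "length u = length w" by simp
qed

lemma sum_words_X: "(\<Sum>w\<in>words_Y n. \<Sum>u\<in>preimage_words X \<pi> w. f u) = (\<Sum>u\<in>words_X n. (f u :: real))"
proof -
  have "(\<Sum>w\<in>words_Y n. \<Sum>u\<in>preimage_words X \<pi> w. f u) = (\<Sum>w\<in>words_Y n. \<Sum>u\<in>{u \<in> words_X n. word_image u = w}. f u)"
    by (intro sum.cong refl preimage_words_fibre) auto
  also have "\<dots> = (\<Sum>u\<in>words_X n. f u)"
    by (rule sum.group[OF finite_words_XY word_image_words])
  finally show ?thesis .
qed

section \<open>Sizes of fibres and image measures\<close>

definition log_fibre :: "nat list \<Rightarrow> real" where
  "log_fibre w = ln (real (card (preimage_words X \<pi> w)))"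

lemma finite_preimage_words: "finite (preimage_words X \<pi> w)"
  unfolding preimage_words_fibre[OF refl] using finite_words_XY by simp

lemma card_preimage_words:
  assumes "y \<in> Y"
  shows "1 \<le> card (preimage_words X \<pi> (prefix_word n y))" "card (preimage_words X \<pi> (prefix_word n y)) \<le> k ^ n"
proof -
  obtain x where x: "x \<in> X" "y = \<pi> x" using assms pi_image by blast
  then have "prefix_word n x \<in> preimage_words X \<pi> (prefix_word n y)"
    unfolding preimage_words_fibre[OF length_prefix_word] by (simp add: word_image_prefix)
  then show "1 \<le> card (preimage_words X \<pi> (prefix_word n y))"
    using finite_preimage_words by (metis One_nat_def Suc_leI card_gt_0_iff empty_iff)
  have "preimage_words X \<pi> (prefix_word n y) \<subseteq> words k n"
    unfolding preimage_words_fibre[OF length_prefix_word] using X.prefix_word_words by auto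
  then show "card (preimage_words X \<pi> (prefix_word n y)) \<le> k ^ n"
    using card_mono[OF finite_words] by (metis card_words)
qed

lemma log_fibre_bounds:
  assumes "y \<in> Y"
  shows "0 \<le> log_fibre (prefix_word n y)" "log_fibre (prefix_word n y) \<le> n * ln k"
proof -
  note c = card_preimage_words[OF assms, of n]
  show "0 \<le> log_fibre (prefix_word n y)" using c(1) by (simp add: log_fibre_def)
  have "real (card (preimage_words X \<pi> (prefix_word n y))) \<le> real (k ^ n)"
    using c(2) by (simp only: of_nat_le_iff)
  then have "log_fibre (prefix_word n y) \<le> ln (real (k ^ n))"
    unfolding log_fibre_def using c(1) by (intro ln_mono) linarith+
  also have "\<dots> = n * ln k" using X.k_pos by (simp add: ln_realpow)
  finally show "log_fibre (prefix_word n y) \<le> n * ln k" .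
qed

text \<open>Cutting a preimage word after \<open>m\<close> letters is injective, and its two parts
  are preimages of the two parts of the image word.\<close>

lemma log_fibre_subadditive:
  assumes "y \<in> Y"
  shows "log_fibre (prefix_word (m + n) y) \<le> log_fibre (prefix_word m y) + log_fibre (prefix_word n ((shift_map ^^ m) y))"
proof -
  let ?P = "preimage_words X \<pi>"
  let ?A = "?P (prefix_word (m + n) y)" and ?B = "?P (prefix_word m y)"
    and ?C = "?P (prefix_word n ((shift_map ^^ m) y))"
  note y' = Y.shift_pow_X[OF assms, of m]
  have split: "(take m u, drop m u) \<in> ?B \<times> ?C" if "u \<in> ?A" for u
  proof -
    have "u \<in> prefix_word (m + n) ` {x \<in> X. prefix_word (m + n) (\<pi> x) = prefix_word (m + n) y}"
      using that by (simp only: preimage_words_prefix)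
    then obtain x where x: "x \<in> X" "prefix_word (m + n) (\<pi> x) = prefix_word (m + n) y"
      and xu: "u = prefix_word (m + n) x" by blast
    have "prefix_word m (\<pi> x) = prefix_word m y"
      "prefix_word n (\<pi> ((shift_map ^^ m) x)) = prefix_word n ((shift_map ^^ m) y)"
      using x(2) unfolding prefix_word_add pi_shift_pow[OF x(1)] by simp_all
    then have "prefix_word m x \<in> ?B" "prefix_word n ((shift_map ^^ m) x) \<in> ?C"
      unfolding preimage_words_prefix using x(1) X.shift_pow_X[OF x(1)] by blast+
    then show ?thesis unfolding xu prefix_word_add by simp
  qed
  have "card ((\<lambda>u. (take m u, drop m u)) ` ?A) \<le> card (?B \<times> ?C)"
    by (intro card_mono finite_cartesian_product finite_preimage_words image_subsetI split)
  moreover have "inj_on (\<lambda>u. (take m u, drop m u)) ?A"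
    by (rule inj_onI) (metis append_take_drop_id prod.inject)
  ultimately have "card ?A \<le> card ?B * card ?C" by (simp add: card_image card_cartesian_product)
  then have "real (card ?A) \<le> real (card ?B) * real (card ?C)" by (metis of_nat_le_iff of_nat_mult)
  then have "ln (real (card ?A)) \<le> ln (real (card ?B) * real (card ?C))"
    using card_preimage_words(1)[OF assms, of "m + n"] by (intro ln_mono) auto
  also have "\<dots> = ln (real (card ?B)) + ln (real (card ?C))"
    using card_preimage_words(1)[OF assms, of m] card_preimage_words(1)[OF y', of n] by (subst ln_mult) auto
  finally show ?thesis by (simp add: log_fibre_def)
qed

lemma pi_measurable:
  assumes "sets \<mu> = sets (restrict_space borel X)"
  shows "\<pi> \<in> measurable \<mu> (restrict_space borel Y)"
proof -
  have "\<pi> \<in> measurable (restrict_space borel X) (restrict_space borel Y)"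
  proof (rule measurable_restrict_space2)
    show "\<pi> \<in> space (restrict_space borel X) \<rightarrow> Y" by (simp add: space_restrict_space pi_in)
    show "\<pi> \<in> measurable (restrict_space borel X) borel"
      by (rule borel_measurable_continuous_on_restrict[OF cont_pi])
  qed
  then show ?thesis unfolding measurable_cong_sets[OF assms refl] .
qed

lemma pushforward_invariant:
  assumes "\<mu> \<in> invariant_measures X"
  shows "pushforward Y \<pi> \<mu> \<in> invariant_measures Y"
proof -
  note \<mu> = X.invariantD[OF assms]
  let ?B = "restrict_space borel Y"
  note meas = pi_measurable[OF \<mu>(2)]
  have s: "sets (pushforward Y \<pi> \<mu>) = sets ?B" by (simp add: pushforward_def)
  have sh: "shift_map \<in> measurable ?B ?B" by (rule Y.measurable_shift) simp
  have "distr (pushforward Y \<pi> \<mu>) (pushforward Y \<pi> \<mu>) shift_map = distr (distr \<mu> ?B \<pi>) ?B shift_map"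
    unfolding pushforward_def by (intro distr_cong) auto
  also have "\<dots> = distr \<mu> ?B (shift_map \<circ> \<pi>)" by (rule distr_distr[OF sh meas])
  also have "\<dots> = distr \<mu> ?B (\<pi> \<circ> shift_map)"
    by (intro distr_cong) (auto simp: \<mu>(5) pi_shift)
  also have "\<dots> = distr (distr \<mu> \<mu> shift_map) ?B \<pi>" by (rule distr_distr[OF meas \<mu>(4), symmetric])
  also have "\<dots> = pushforward Y \<pi> \<mu>" by (simp add: \<mu>(3) pushforward_def)
  finally show ?thesis
    using prob_space.prob_space_distr[OF \<mu>(1) meas] s
    by (simp add: invariant_measures_def pushforward_def)
qed

lemma pi_vimage_cyl: "\<pi> -` cyl Y w \<inter> X = (\<Union>u\<in>preimage_words X \<pi> w. cyl X u)"
proof (intro equalityI subsetI)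
  fix x assume "x \<in> \<pi> -` cyl Y w \<inter> X"
  then have "x \<in> X" "prefix_word (length w) (\<pi> x) = w" by (simp_all add: cyl_def)
  then have "prefix_word (length w) x \<in> preimage_words X \<pi> w" "x \<in> cyl X (prefix_word (length w) x)"
    unfolding preimage_words_eq by (auto simp: cyl_def)
  then show "x \<in> (\<Union>u\<in>preimage_words X \<pi> w. cyl X u)" by blast
next
  fix x assume "x \<in> (\<Union>u\<in>preimage_words X \<pi> w. cyl X u)"
  then obtain u where u: "u \<in> preimage_words X \<pi> w" "x \<in> cyl X u" by blast
  note preimage_wordsD[OF u(1)]
  moreover have "x \<in> X" "prefix_word (length u) x = u" using u(2) by (simp_all add: cyl_def)
  ultimately have "prefix_word (length w) (\<pi> x) = w" using word_image_prefix[of x "length u"] by simp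
  then show "x \<in> \<pi> -` cyl Y w \<inter> X" using \<open>x \<in> X\<close> pi_in by (simp add: cyl_def)
qed

lemma measure_pi_vimage_cyl:
  assumes "finite_measure \<mu>" "sets \<mu> = sets (restrict_space borel X)"
  shows "measure \<mu> (\<pi> -` cyl Y w \<inter> X) = (\<Sum>u\<in>preimage_words X \<pi> w. measure \<mu> (cyl X u))"
  unfolding pi_vimage_cyl
proof (rule finite_measure.finite_measure_finite_Union[OF assms(1) finite_preimage_words])
  show "cyl X ` preimage_words X \<pi> w \<subseteq> sets \<mu>" using assms(2) X.cyl_in_sets by auto
  show "disjoint_family_on (cyl X) (preimage_words X \<pi> w)"
    unfolding disjoint_family_on_def
    by (intro ballI impI X.cyl_disjoint) (simp_all add: preimage_wordsD)
qed

lemma measure_pushforward_cyl: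
  assumes "finite_measure \<mu>" "sets \<mu> = sets (restrict_space borel X)"
  shows "measure (pushforward Y \<pi> \<mu>) (cyl Y w) = (\<Sum>u\<in>preimage_words X \<pi> w. measure \<mu> (cyl X u))"
  unfolding measure_pi_vimage_cyl[OF assms, symmetric] pushforward_def
  using measure_distr[OF pi_measurable[OF assms(2)] Y.cyl_in_sets[of w]] by (simp add: X.space_eq_X[OF assms(2)])

lemma block_entropy_words_X:
  assumes "prob_space \<mu>" "sets \<mu> = sets (restrict_space borel X)"
  shows "block_entropy \<mu> n = (\<Sum>u\<in>words_X n. eta (measure \<mu> (cyl X u)))"
  unfolding X.block_entropy_words[OF assms] by (rule X.sum_words_eq_sum_prefix_words) simp

lemma block_entropy_words_Y:
  assumes "prob_space m" "sets m = sets (restrict_space borel Y)"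
  shows "block_entropy m n = (\<Sum>u\<in>words_Y n. eta (measure m (cyl Y u)))"
  unfolding Y.block_entropy_words[OF assms] by (rule Y.sum_words_eq_sum_prefix_words) simp

lemma integral_log_fibre:
  assumes "prob_space m" "sets m = sets (restrict_space borel Y)"
  shows "(\<integral>y. log_fibre (prefix_word n y) \<partial>m) = (\<Sum>w\<in>words_Y n. measure m (cyl Y w) * log_fibre w)"
  unfolding Y.integral_prefix_word(2)[OF prob_space.finite_measure[OF assms(1)] assms(2)]
  by (subst mult.commute, rule Y.sum_words_eq_sum_prefix_words) simp

lemma block_entropy_le_pushforward:
  assumes "\<mu> \<in> invariant_measures X"
  shows "block_entropy \<mu> n \<le> block_entropy (pushforward Y \<pi> \<mu>) n
    + (\<integral>y. log_fibre (prefix_word n y) \<partial>(pushforward Y \<pi> \<mu>))"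
proof -
  note \<mu> = X.invariantD[OF assms]
  note m = Y.invariantD[OF pushforward_invariant[OF assms]]
  let ?m = "pushforward Y \<pi> \<mu>"
  have "block_entropy \<mu> n = (\<Sum>w\<in>words_Y n. \<Sum>u\<in>preimage_words X \<pi> w. eta (measure \<mu> (cyl X u)))"
    unfolding sum_words_X by (rule block_entropy_words_X[OF \<mu>(1,2)])
  \<comment> \<open>\<open>sum_eta_le_card\<close> on each fibre, whose total mass is the weight of
    \<open>w\<close> under the image measure.\<close>
  also have "\<dots> \<le> (\<Sum>w\<in>words_Y n. eta (measure ?m (cyl Y w)) + measure ?m (cyl Y w) * log_fibre w)"
    unfolding measure_pushforward_cyl[OF prob_space.finite_measure[OF \<mu>(1)] \<mu>(2)] log_fibre_def
    by (intro sum_mono sum_eta_le_card finite_preimage_words) simp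
  also have "\<dots> = block_entropy ?m n + (\<integral>y. log_fibre (prefix_word n y) \<partial>?m)"
    by (simp add: sum.distrib block_entropy_words_Y[OF m(1,2)] integral_log_fibre[OF m(1,2)])
  finally show ?thesis .
qed

end

section \<open>Lifting an invariant measure\<close>

context factor_loc
begin

text \<open>Lists that are not words of \<open>X\<close> also get a point of \<open>X\<close>,
  because \<open>orbit_average\<close> asks for a starting point in \<open>X\<close> at every
  index.\<close>

definition rep :: "nat list \<Rightarrow> (nat \<Rightarrow> nat)" where
  "rep u = (SOME x. x \<in> X \<and> (u \<in> words_X (length u) \<longrightarrow> prefix_word (length u) x = u))"

lemma rep: "rep u \<in> X" "u \<in> words_X n \<Longrightarrow> prefix_word n (rep u) = u"
proof -
  have "\<exists>x. x \<in> X \<and> (u \<in> words_X (length u) \<longrightarrow> prefix_word (length u) x = u)"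
  proof (cases "u \<in> words_X (length u)")
    case True
    then obtain x where "x \<in> X" "u = prefix_word (length u) x" by (rule imageE) blast
    then show ?thesis by (intro exI[of _ x]) (simp only: simp_thms)
  qed (use X.ne in blast)
  from someI_ex[OF this] have r: "rep u \<in> X" "u \<in> words_X (length u) \<Longrightarrow> prefix_word (length u) (rep u) = u"
    unfolding rep_def by blast+
  show "rep u \<in> X" by (rule r)
  assume u: "u \<in> words_X n"
  then have "length u = n" by auto
  then show "prefix_word n (rep u) = u" using r(2) u by simp
qed

lemma word_image_rep: "u \<in> words_X n \<Longrightarrow> word_image u = prefix_word n (\<pi> (rep u))"
  using word_image_prefix[OF rep(1), of n u] rep(2)[of u n] by simp

lemma sum_cyl_Y:
  assumes "prob_space m" "sets m = sets (restrict_space borel Y)"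
  shows "(\<Sum>w\<in>words_Y n. if w \<in> S then measure m (cyl Y w) else 0) = measure m {y \<in> Y. prefix_word n y \<in> S}"
proof -
  interpret prob_space m by (rule assms)
  have "{y \<in> Y. prefix_word n y \<in> S} = prefix_word n -` S \<inter> space m"
    by (auto simp: Y.space_eq_X[OF assms(2)])
  then have "measure m {y \<in> Y. prefix_word n y \<in> S} = (\<integral>y. indicator {y \<in> Y. prefix_word n y \<in> S} y \<partial>m)"
    by simp
  also have "\<dots> = (\<integral>y. indicator S (prefix_word n y) \<partial>m)"
    by (intro Bochner_Integration.integral_cong refl) (auto simp: indicator_def Y.space_eq_X[OF assms(2)])
  also have "\<dots> = (\<Sum>w\<in>words l n. indicator S w * measure m (cyl Y w))"
    by (rule Y.integral_prefix_word(2)[OF finite_measure_axioms assms(2)])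
  also have "\<dots> = (\<Sum>w\<in>words_Y n. indicator S w * measure m (cyl Y w))"
    by (rule Y.sum_words_eq_sum_prefix_words) simp
  also have "\<dots> = (\<Sum>w\<in>words_Y n. if w \<in> S then measure m (cyl Y w) else 0)"
    by (intro sum.cong refl) (simp add: indicator_def)
  finally show ?thesis by simp
qed

definition fibre_weight :: "(nat \<Rightarrow> nat) measure \<Rightarrow> nat \<Rightarrow> nat list \<Rightarrow> real" where
  "fibre_weight m n u = (if u \<in> words_X n
    then measure m (cyl Y (word_image u)) / card (preimage_words X \<pi> (word_image u)) else 0)"

definition fibre_pmf :: "(nat \<Rightarrow> nat) measure \<Rightarrow> nat \<Rightarrow> nat list pmf" where
  "fibre_pmf m n = embed_pmf (fibre_weight m n)"

lemma fibre_weight_eq: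
  assumes "w \<in> words_Y n" "u \<in> preimage_words X \<pi> w"
  shows "fibre_weight m n u = measure m (cyl Y w) / card (preimage_words X \<pi> w)"
proof -
  have "length w = n" using assms(1) by auto
  then show ?thesis using assms(2) preimage_words_fibre[of w n] by (simp add: fibre_weight_def)
qed

lemma card_fibre_pos:
  assumes "w \<in> words_Y n"
  shows "0 < card (preimage_words X \<pi> w)"
proof -
  obtain y where "y \<in> Y" "w = prefix_word n y" using assms by blast
  then show ?thesis using card_preimage_words(1)[of y n] by simp
qed

section \<open>Lifting a fixed invariant measure of the factor\<close>

context
  fixes m assumes m: "m \<in> invariant_measures Y"
begin

lemma pmf_fibre_pmf: "pmf (fibre_pmf m n) u = fibre_weight m n u"
proof -
  note mm = Y.invariantD[OF m]
  have nn: "0 \<le> fibre_weight m n u" for u by (simp add: fibre_weight_def)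
  have "(\<Sum>u\<in>words_X n. fibre_weight m n u) = (\<Sum>w\<in>words_Y n. \<Sum>u\<in>preimage_words X \<pi> w. fibre_weight m n u)"
    by (rule sum_words_X[symmetric])
  also have "\<dots> = (\<Sum>w\<in>words_Y n. if w \<in> UNIV then measure m (cyl Y w) else 0)"
  proof (intro sum.cong refl)
    fix w assume w: "w \<in> words_Y n"
    have "(\<Sum>u\<in>preimage_words X \<pi> w. fibre_weight m n u)
        = (\<Sum>u\<in>preimage_words X \<pi> w. measure m (cyl Y w) / card (preimage_words X \<pi> w))"
      by (intro sum.cong refl fibre_weight_eq[OF w])
    then show "(\<Sum>u\<in>preimage_words X \<pi> w. fibre_weight m n u) = (if w \<in> UNIV then measure m (cyl Y w) else 0)"
      using card_fibre_pos[OF w] by simp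
  qed
  also have "\<dots> = 1"
    unfolding sum_cyl_Y[OF mm(1,2)] using prob_space.prob_space[OF mm(1)] by (simp add: mm(5))
  finally have s: "(\<Sum>u\<in>words_X n. fibre_weight m n u) = 1" .
  have "(\<integral>\<^sup>+u. ennreal (fibre_weight m n u) \<partial>count_space UNIV) = (\<Sum>u\<in>words_X n. ennreal (fibre_weight m n u))"
    using finite_words_XY(1) by (intro nn_integral_count_space') (auto simp: fibre_weight_def)
  also have "\<dots> = 1" using s nn by (simp add: sum_ennreal)
  finally show ?thesis unfolding fibre_pmf_def by (rule pmf_embed_pmf[OF nn])
qed

lemma set_fibre_pmf: "set_pmf (fibre_pmf m n) \<subseteq> words_X n"
  by (auto simp: set_pmf_eq pmf_fibre_pmf fibre_weight_def split: if_splits)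

lemma finite_set_fibre_pmf: "finite (set_pmf (fibre_pmf m n))"
  by (rule finite_subset[OF set_fibre_pmf finite_words_XY(1)])

text \<open>Spreading mass inside the fibres does not change the total over a fibre, so the image
  word has the law of the \<open>n\<close>-prefix under \<open>m\<close>.\<close>

lemma prob_fibre_pmf_image:
  "measure_pmf.prob (fibre_pmf m n) {u. word_image u \<in> S} = measure m {y \<in> Y. prefix_word n y \<in> S}"
proof -
  let ?p = "fibre_pmf m n"
  have "measure_pmf.prob ?p {u. word_image u \<in> S} = measure_pmf.prob ?p ({u. word_image u \<in> S} \<inter> set_pmf ?p)"
    by (simp only: measure_Int_set_pmf)
  also have "{u. word_image u \<in> S} \<inter> set_pmf ?p = {u \<in> words_X n. word_image u \<in> S} \<inter> set_pmf ?p"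
    using set_fibre_pmf by auto
  also have "measure_pmf.prob ?p \<dots> = measure_pmf.prob ?p {u \<in> words_X n. word_image u \<in> S}"
    by (simp only: measure_Int_set_pmf)
  also have "\<dots> = (\<Sum>u\<in>{u \<in> words_X n. word_image u \<in> S}. fibre_weight m n u)"
    using finite_words_XY(1)[of n] by (subst measure_measure_pmf_finite) (simp_all add: pmf_fibre_pmf)
  also have "\<dots> = (\<Sum>u\<in>words_X n. if word_image u \<in> S then fibre_weight m n u else 0)"
    using finite_words_XY(1)[of n] by (rule sum.inter_filter)
  also have "\<dots> = (\<Sum>w\<in>words_Y n. \<Sum>u\<in>preimage_words X \<pi> w. if word_image u \<in> S then fibre_weight m n u else 0)"
    by (rule sum_words_X[symmetric])
  also have "\<dots> = (\<Sum>w\<in>words_Y n. if w \<in> S then measure m (cyl Y w) else 0)"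
  proof (intro sum.cong refl)
    fix w assume w: "w \<in> words_Y n"
    have "(\<Sum>u\<in>preimage_words X \<pi> w. if word_image u \<in> S then fibre_weight m n u else 0)
        = (\<Sum>u\<in>preimage_words X \<pi> w. if w \<in> S then measure m (cyl Y w) / card (preimage_words X \<pi> w) else 0)"
      by (intro sum.cong refl) (simp add: preimage_wordsD(2) fibre_weight_eq[OF w])
    then show "(\<Sum>u\<in>preimage_words X \<pi> w. if word_image u \<in> S then fibre_weight m n u else 0)
        = (if w \<in> S then measure m (cyl Y w) else 0)"
      using card_fibre_pos[OF w] by simp
  qed
  also have "\<dots> = measure m {y \<in> Y. prefix_word n y \<in> S}"
    using Y.invariantD[OF m] by (intro sum_cyl_Y)
  finally show ?thesis .
qed

abbreviation lifted_average :: "nat \<Rightarrow> (nat \<Rightarrow> nat) measure" where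
  "lifted_average n \<equiv> orbit_average X n (fibre_pmf m n) rep"

text \<open>The window read at time \<open>j\<close> lies inside the first \<open>n\<close> letters,
  so it is governed by the previous lemma, and invariance of \<open>m\<close> removes
  \<open>j\<close>.\<close>

lemma prob_fibre_pmf_cyl:
  assumes "j + length w \<le> n"
  shows "measure_pmf.prob (fibre_pmf m n) {u. (shift_map ^^ j) (rep u) \<in> \<pi> -` cyl Y w \<inter> X} = measure m (cyl Y w)"
proof -
  let ?p = "fibre_pmf m n" and ?S = "{v. take (length w) (drop j v) = w}"
  note mm = Y.invariantD[OF m]
  have sub: "take (length w) (drop j (prefix_word n y)) = prefix_word (length w) ((shift_map ^^ j) y)" for y
    unfolding prefix_word_shift using assms by (intro nth_equalityI) (auto simp: prefix_word_def)
  have "(shift_map ^^ j) (rep u) \<in> \<pi> -` cyl Y w \<inter> X \<longleftrightarrow> word_image u \<in> ?S" if "u \<in> words_X n" for u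
    using pi_in[OF X.shift_pow_X[OF rep(1)]] X.shift_pow_X[OF rep(1), of j u]
    by (simp add: cyl_def word_image_rep[OF that] sub pi_shift_pow[OF rep(1)])
  \<comment> \<open>The equivalence is known for words of \<open>X\<close> only; these carry all the
    mass.\<close>
  then have "{u. (shift_map ^^ j) (rep u) \<in> \<pi> -` cyl Y w \<inter> X} \<inter> set_pmf ?p = {u. word_image u \<in> ?S} \<inter> set_pmf ?p"
    using set_fibre_pmf by blast
  then have "measure_pmf.prob ?p {u. (shift_map ^^ j) (rep u) \<in> \<pi> -` cyl Y w \<inter> X} = measure_pmf.prob ?p {u. word_image u \<in> ?S}"
    by (metis measure_Int_set_pmf)
  also have "\<dots> = measure m {y \<in> Y. prefix_word n y \<in> ?S}" by (rule prob_fibre_pmf_image)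
  also have "{y \<in> Y. prefix_word n y \<in> ?S} = (shift_map ^^ j) -` cyl Y w \<inter> space m"
    using Y.shift_pow_X by (auto simp: mm(5) cyl_def sub)
  also have "measure m \<dots> = measure (distr m m (shift_map ^^ j)) (cyl Y w)"
    using Y.cyl_in_sets[of w] mm(2)
    by (subst measure_distr[OF Y.shift_pow_measure_preserving(1)[OF m]]) simp_all
  also have "\<dots> = measure m (cyl Y w)" by (simp add: Y.shift_pow_measure_preserving(2)[OF m])
  finally show ?thesis .
qed

text \<open>Only times \<open>j\<close> whose window reaches beyond \<open>n\<close> contribute, at
  most \<open>length w\<close> many, each with an error of at most 1. There the letters come from
  the arbitrary continuation chosen by \<open>rep\<close>.\<close>

lemma lifted_average_image:
  assumes n: "0 < n"
  shows "\<bar>measure (lifted_average n) (\<pi> -` cyl Y w \<inter> X) - measure m (cyl Y w)\<bar> \<le> length w / n"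
proof -
  define t where "t j = measure_pmf.prob (fibre_pmf m n) {u. (shift_map ^^ j) (rep u) \<in> \<pi> -` cyl Y w \<inter> X}
    - measure m (cyl Y w)" for j
  have "\<pi> -` cyl Y w \<inter> X \<in> sets (restrict_space borel X)"
    unfolding pi_vimage_cyl using X.cyl_in_sets finite_preimage_words by (intro sets.finite_UN) auto
  from X.measure_orbit_average[OF rep(1) n finite_set_fibre_pmf this]
  have "measure (lifted_average n) (\<pi> -` cyl Y w \<inter> X) - measure m (cyl Y w) = (\<Sum>j<n. t j) / n"
    using n by (simp add: t_def sum_subtractf field_simps)
  moreover have "\<bar>\<Sum>j<n. t j\<bar> \<le> length w"
  proof -
    have "\<bar>\<Sum>j<n. t j\<bar> \<le> (\<Sum>j<n. \<bar>t j\<bar>)" by (rule sum_abs)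
    also have "\<dots> \<le> (\<Sum>j<n. if n < j + length w then 1 else 0)"
    proof (intro sum_mono)
      fix j assume j: "j \<in> {..<n}"
      show "\<bar>t j\<bar> \<le> (if n < j + length w then 1 else 0)"
      proof (cases "j + length w \<le> n")
        case True
        then have "t j = 0" unfolding t_def prob_fibre_pmf_cyl[OF True] by simp
        then show ?thesis by simp
      next
        case False
        have "\<bar>t j\<bar> \<le> 1"
          unfolding t_def using measure_pmf.prob_le_1[of "fibre_pmf m n"]
            prob_space.prob_le_1[OF Y.invariantD(1)[OF m], of "cyl Y w"]
            measure_nonneg[of "measure_pmf (fibre_pmf m n)"] measure_nonneg[of m "cyl Y w"]
          by (smt (verit))
        then show ?thesis using False
          by (cases "n < j + length w") (auto simp: not_less)
      qed
    qed
    also have "\<dots> = real (card {j \<in> {..<n}. n < j + length w})" by (simp add: sum.inter_filter[symmetric])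
    also have "\<dots> \<le> length w"
    proof -
      have "{j \<in> {..<n}. n < j + length w} \<subseteq> {n - length w..<n}" by auto
      then have "card {j \<in> {..<n}. n < j + length w} \<le> card {n - length w..<n}" by (intro card_mono) auto
      then show ?thesis by simp
    qed
    finally show ?thesis .
  qed
  ultimately show ?thesis using n by (simp add: divide_right_mono)
qed

lemma simple_rep_block: "simple_function (measure_pmf p) (\<lambda>u. map (rep u) [a..<b])"
  "(\<lambda>u. map (rep u) [a..<b]) ` space (measure_pmf p) \<subseteq> words k (b - a)"
proof -
  show sub: "(\<lambda>u. map (rep u) [a..<b]) ` space (measure_pmf p) \<subseteq> words k (b - a)"
    using X.letters[OF rep(1)] by (auto simp: words_def)
  show "simple_function (measure_pmf p) (\<lambda>u. map (rep u) [a..<b])"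
    unfolding simple_function_def using finite_subset[OF sub] by simp
qed

text \<open>Equality in the chain rule: given its image, the word is uniformly distributed on the
  fibre. This is what the even spreading is for.\<close>

lemma Ent_fibre_pmf:
  "Ent (measure_pmf (fibre_pmf m n)) (\<lambda>u. map (rep u) [0..<n])
    = block_entropy m n + (\<integral>y. log_fibre (prefix_word n y) \<partial>m)"
proof -
  let ?p = "fibre_pmf m n"
  note mm = Y.invariantD[OF m]
  have "measure_pmf.prob ?p ((\<lambda>u. map (rep u) [0..<n]) -` {v} \<inter> space (measure_pmf ?p)) = fibre_weight m n v" for v
  proof -
    have "map (rep u) [0..<n] = u" if "u \<in> set_pmf ?p" for u
      using rep(2)[of u n] set_fibre_pmf that unfolding prefix_word_def by blast
    then have "(\<lambda>u. map (rep u) [0..<n]) -` {v} \<inter> set_pmf ?p = {v} \<inter> set_pmf ?p" by auto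
    then have "measure_pmf.prob ?p ((\<lambda>u. map (rep u) [0..<n]) -` {v}) = measure_pmf.prob ?p {v}"
      by (metis measure_Int_set_pmf)
    then show ?thesis by (simp add: measure_pmf_single pmf_fibre_pmf)
  qed
  then have "Ent (measure_pmf ?p) (\<lambda>u. map (rep u) [0..<n]) = (\<Sum>v\<in>words k n. eta (fibre_weight m n v))"
    using prob_space.Ent_superset[OF prob_space_measure_pmf finite_words simple_rep_block(2)[of 0 n ?p]]
    by simp
  also have "\<dots> = (\<Sum>u\<in>words_X n. eta (fibre_weight m n u))"
  proof (rule X.sum_words_eq_sum_prefix_words)
    fix w assume "cyl X w = {}"
    then have "w \<notin> words_X n" by (auto simp: cyl_empty_iff)
    then show "eta (fibre_weight m n w) = 0" by (simp add: fibre_weight_def)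
  qed
  also have "\<dots> = (\<Sum>w\<in>words_Y n. \<Sum>u\<in>preimage_words X \<pi> w. eta (fibre_weight m n u))"
    by (rule sum_words_X[symmetric])
  also have "\<dots> = (\<Sum>w\<in>words_Y n. eta (measure m (cyl Y w)) + measure m (cyl Y w) * log_fibre w)"
  proof (intro sum.cong refl)
    fix w assume w: "w \<in> words_Y n"
    let ?c = "card (preimage_words X \<pi> w)" and ?t = "measure m (cyl Y w)"
    have c: "0 < ?c" by (rule card_fibre_pos[OF w])
    have "(\<Sum>u\<in>preimage_words X \<pi> w. eta (fibre_weight m n u)) = (\<Sum>u\<in>preimage_words X \<pi> w. eta (?t / ?c))"
      by (intro sum.cong refl) (simp add: fibre_weight_eq[OF w])
    also have "\<dots> = - ?t * ln (?t / ?c)" using c by (simp add: eta_def)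
    also have "\<dots> = eta ?t + ?t * log_fibre w"
    proof (cases "?t = 0")
      case False
      then have "0 < ?t" by (simp add: zero_less_measure_iff)
      then show ?thesis using c by (simp add: eta_def log_fibre_def ln_div algebra_simps)
    qed (simp add: eta_def)
    finally show "(\<Sum>u\<in>preimage_words X \<pi> w. eta (fibre_weight m n u)) = eta ?t + ?t * log_fibre w" .
  qed
  also have "\<dots> = block_entropy m n + (\<integral>y. log_fibre (prefix_word n y) \<partial>m)"
    by (simp add: sum.distrib block_entropy_words_Y[OF mm(1,2)] integral_log_fibre[OF mm(1,2)])
  finally show ?thesis .
qed

text \<open>The averaged measure gives each word the mean of its probabilities at the times
  \<open>j\<close>, and \<open>eta\<close> is concave.\<close>

lemma sum_Ent_le_lifted_average:
  assumes n: "0 < n"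
  shows "(\<Sum>j<n. Ent (measure_pmf (fibre_pmf m n)) (\<lambda>u. map (rep u) [j..<j + q]))
    \<le> n * block_entropy (lifted_average n) q"
proof -
  let ?p = "fibre_pmf m n"
  note s = X.prob_space_orbit_average[OF rep(1)]
  define t where "t j w = measure_pmf.prob ?p {u. map (rep u) [j..<j + q] = w}" for j w
  have "Ent (measure_pmf ?p) (\<lambda>u. map (rep u) [j..<j + q]) = (\<Sum>w\<in>words k q. eta (t j w))" for j
    using prob_space.Ent_superset[OF prob_space_measure_pmf finite_words simple_rep_block(2)[of j "j + q" ?p]]
    by (simp add: t_def vimage_def)
  then have "(\<Sum>j<n. Ent (measure_pmf ?p) (\<lambda>u. map (rep u) [j..<j + q])) = (\<Sum>w\<in>words k q. \<Sum>j<n. eta (t j w))"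
    by (simp add: sum.swap[of _ "words k q"])
  also have "\<dots> \<le> (\<Sum>w\<in>words k q. n * eta (measure (lifted_average n) (cyl X w)))"
  proof (intro sum_mono)
    fix w assume "w \<in> words k q"
    then have q: "length w = q" by (simp add: words_def)
    have "{u. (shift_map ^^ j) (rep u) \<in> cyl X w} = {u. map (rep u) [j..<j + q] = w}" for j
      using X.shift_pow_X[OF rep(1)] by (simp add: cyl_def q prefix_word_shift)
    then have "measure (lifted_average n) (cyl X w) = (\<Sum>j<n. t j w) / n"
      using X.measure_orbit_average[OF rep(1) n finite_set_fibre_pmf X.cyl_in_sets] by (simp add: t_def)
    moreover have "(\<Sum>j<n. eta (t j w)) \<le> card {..<n} * eta ((\<Sum>j<n. t j w) / card {..<n})"
      using n by (intro eta_mean_concave) (auto simp: t_def)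
    ultimately show "(\<Sum>j<n. eta (t j w)) \<le> n * eta (measure (lifted_average n) (cyl X w))" by simp
  qed
  also have "\<dots> = n * block_entropy (lifted_average n) q"
    by (simp add: X.block_entropy_words[OF s] sum_distrib_left)
  finally show ?thesis .
qed

text \<open>Misiurewicz's estimate: the entropy of a window of letters is subadditive in the window,
  so the block bound compares the whole word with its windows of length \<open>q\<close>. Windows of
  at most \<open>q\<close> letters have entropy at most \<open>q * ln k\<close>, the constant
  \<open>C\<close> of the bound. Windows reaching beyond \<open>n\<close> make sense because
  \<open>rep u\<close> is infinite.\<close>

lemma block_entropy_lifted_average:
  assumes q: "0 < q" and n: "q < n"
  shows "(block_entropy m n + (\<integral>y. log_fibre (prefix_word n y) \<partial>m)) / n
    \<le> block_entropy (lifted_average n) q / q + (3 * real q + 2) * ln k * (1 / n)"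
proof -
  let ?p = "fibre_pmf m n"
  let ?g = "\<lambda>a b. Ent (measure_pmf ?p) (\<lambda>u. map (rep u) [a..<b])"
  have "real q * ?g 0 n \<le> (\<Sum>j<n. ?g j (j + q)) + (3 * real q + 2) * (q * ln k)"
  proof (rule subadditive_block_bound)
    fix a b c :: nat assume abc: "a < b" "b < c"
    note sf = simple_rep_block(1)[of ?p]
    have "?g a c \<le> Ent (measure_pmf ?p) (\<lambda>u. (map (rep u) [a..<b], map (rep u) [b..<c]))"
    proof (rule prob_space.Ent_le_if_factor[OF prob_space_measure_pmf simple_function_Pair[OF sf sf],
          where \<phi> = "\<lambda>(x, y). x @ y"])
      have "[a..<c] = [a..<b] @ [b..<c]"
        using upt_add_eq_append[of a b "c - b"] abc by simp
      then show "map (rep u) [a..<c] = (case (map (rep u) [a..<b], map (rep u) [b..<c]) of (x, y) \<Rightarrow> x @ y)" for u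
        by simp
    qed
    also have "\<dots> \<le> ?g a b + ?g b c"
      by (rule prob_space.Ent_Pair_le[OF prob_space_measure_pmf sf sf])
    finally show "?g a c \<le> ?g a b + ?g b c" .
  next
    fix a b assume ab: "a < b" "b \<le> a + q"
    have "?g a b \<le> ln (card (words k (b - a)))"
      by (rule prob_space.Ent_le_card[OF prob_space_measure_pmf simple_rep_block finite_words])
    also have "\<dots> = (b - a) * ln k" using X.k_pos by (simp add: card_words ln_realpow)
    also have "\<dots> \<le> q * ln k" using ab X.k_pos by (intro mult_right_mono) auto
    finally have "?g a b \<le> q * ln k" .
    moreover have "0 \<le> ?g a b" by (rule prob_space.Ent_nonneg[OF prob_space_measure_pmf])
    ultimately show "\<bar>?g a b\<bar> \<le> q * ln k" by linarith
  qed (use q n in auto)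
  also have "\<dots> \<le> n * block_entropy (lifted_average n) q + (3 * real q + 2) * (q * ln k)"
    using sum_Ent_le_lifted_average[of n q] n by simp
  finally have "q * ?g 0 n \<le> q * (n * (block_entropy (lifted_average n) q / q) + (3 * real q + 2) * ln k)"
    using q by (simp add: algebra_simps)
  then have "?g 0 n \<le> n * (block_entropy (lifted_average n) q / q) + (3 * real q + 2) * ln k"
    using q by simp
  then have "?g 0 n / n \<le> (n * (block_entropy (lifted_average n) q / q) + (3 * real q + 2) * ln k) / n"
    by (rule divide_right_mono) simp
  then show ?thesis using n by (simp add: Ent_fibre_pmf add_divide_distrib)
qed

text \<open>The estimate holds for each fixed \<open>q\<close> with the same limit \<open>c\<close>;
  its boundary term and the error in the projection vanish like \<open>1 / n\<close>. The value of
  \<open>c\<close> is identified only later.\<close>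

theorem exists_lift_block_entropy:
  assumes c: "(\<lambda>n. (block_entropy m n + (\<integral>y. log_fibre (prefix_word n y) \<partial>m)) / n) \<longlonglongrightarrow> c"
  obtains \<mu> where "\<mu> \<in> invariant_measures X" "pushforward Y \<pi> \<mu> = m" "\<And>q. 1 \<le> q \<Longrightarrow> c \<le> block_entropy \<mu> q / q"
proof -
  note mm = Y.invariantD[OF m]
  obtain r \<mu> where r: "strict_mono (r :: nat \<Rightarrow> nat)" and \<mu>: "\<mu> \<in> invariant_measures X"
    and lim: "\<And>w. (\<lambda>n. measure (lifted_average (r n)) (cyl X w)) \<longlonglongrightarrow> measure \<mu> (cyl X w)"
    by (rule X.orbit_average_subsequence[of "\<lambda>_. rep" "fibre_pmf m"]) (use rep(1) finite_set_fibre_pmf in auto)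
  note \<mu>\<mu> = X.invariantD[OF \<mu>]
  note s = X.prob_space_orbit_average[OF rep(1)]
  have r0: "(\<lambda>n. 1 / real (r n)) \<longlonglongrightarrow> 0"
    using LIMSEQ_subseq_LIMSEQ[OF lim_1_over_n r] by (simp add: comp_def)
  have "measure (pushforward Y \<pi> \<mu>) (cyl Y w) = measure m (cyl Y w)" for w
  proof -
    have "(\<lambda>n. measure (lifted_average (r n)) (\<pi> -` cyl Y w \<inter> X)) \<longlonglongrightarrow> measure (pushforward Y \<pi> \<mu>) (cyl Y w)"
      unfolding measure_pi_vimage_cyl[OF prob_space.finite_measure[OF s(1)] s(2)]
        measure_pushforward_cyl[OF prob_space.finite_measure[OF \<mu>\<mu>(1)] \<mu>\<mu>(2)]
      by (intro tendsto_sum lim)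
    moreover have "(\<lambda>n. measure (lifted_average (r n)) (\<pi> -` cyl Y w \<inter> X)) \<longlonglongrightarrow> measure m (cyl Y w)"
    proof (rule Lim_transform)
      have "(\<lambda>n. length w * (1 / real (r n))) \<longlonglongrightarrow> real (length w) * 0" by (intro tendsto_intros r0)
      then have "(\<lambda>n. length w * (1 / real (r n))) \<longlonglongrightarrow> 0" by simp
      then show "(\<lambda>n. measure (lifted_average (r n)) (\<pi> -` cyl Y w \<inter> X) - measure m (cyl Y w)) \<longlonglongrightarrow> 0"
      proof (rule Lim_null_comparison[rotated])
        have "norm (measure (lifted_average (r n)) (\<pi> -` cyl Y w \<inter> X) - measure m (cyl Y w)) \<le> length w * (1 / real (r n))"
          if "1 \<le> n" for n
          using lifted_average_image[of "r n" w] seq_suble[OF r, of n] that by (simp add: abs_minus_commute)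
        then show "\<forall>\<^sub>F n in sequentially. norm (measure (lifted_average (r n)) (\<pi> -` cyl Y w \<inter> X) - measure m (cyl Y w))
            \<le> length w * (1 / real (r n))"
          by (intro eventually_sequentiallyI[of 1])
      qed
    qed (rule tendsto_const)
    ultimately show ?thesis by (rule LIMSEQ_unique)
  qed
  then have push: "pushforward Y \<pi> \<mu> = m"
    using Y.invariantD[OF pushforward_invariant[OF \<mu>]] mm
    by (intro measure_eqI_cyl[of _ Y]) (auto intro: prob_space.finite_measure)
  have "c \<le> block_entropy \<mu> q / q" if q: "1 \<le> q" for q
  proof -
    have "c \<le> block_entropy \<mu> q / q + (3 * real q + 2) * ln k * 0"
    proof (rule LIMSEQ_le)
      show "(\<lambda>n. (block_entropy m (r n) + (\<integral>y. log_fibre (prefix_word (r n) y) \<partial>m)) / r n) \<longlonglongrightarrow> c"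
        using LIMSEQ_subseq_LIMSEQ[OF c r] by (simp add: comp_def)
      show "(\<lambda>n. block_entropy (lifted_average (r n)) q / q + (3 * real q + 2) * ln k * (1 / r n))
          \<longlonglongrightarrow> block_entropy \<mu> q / q + (3 * real q + 2) * ln k * 0"
        using X.tendsto_block_entropy[OF s \<mu>\<mu>(1,2) lim, of q] q by (intro tendsto_intros r0) auto
      have "q < r n" if "Suc q \<le> n" for n using seq_suble[OF r, of n] that by simp
      then show "\<exists>N. \<forall>n\<ge>N. (block_entropy m (r n) + (\<integral>y. log_fibre (prefix_word (r n) y) \<partial>m)) / r n
          \<le> block_entropy (lifted_average (r n)) q / q + (3 * real q + 2) * ln k * (1 / r n)"
        using q by (intro exI[of _ "Suc q"] allI impI block_entropy_lifted_average) auto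
    qed
    then show ?thesis by simp
  qed
  then show thesis using that[OF \<mu> push] by blast
qed

end

end

section \<open>The relative variational principle\<close>

context factor_loc
begin

lemma growth_ereal_eq: "growth_ereal X \<pi> y = limsup (\<lambda>n. ereal (log_fibre (prefix_word n y) / n))"
  by (simp add: growth_ereal_def log_fibre_def prefix_word_def)

lemma log_fibre_ratio_bounds:
  assumes "y \<in> Y"
  shows "0 \<le> log_fibre (prefix_word n y) / n" "log_fibre (prefix_word n y) / n \<le> ln k"
  using log_fibre_bounds[OF assms, of n] X.k_pos by (cases "n = 0"; simp add: field_simps)+

text \<open>The ratios stay in \<open>[0, ln k]\<close>, so \<open>real_of_ereal\<close> loses
  nothing on \<open>Y\<close>.\<close>

lemma growth_bounds:
  assumes y: "y \<in> Y"
  shows "growth_ereal X \<pi> y = ereal (growth X \<pi> y)" "0 \<le> growth X \<pi> y" "growth X \<pi> y \<le> ln k"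
proof -
  have up: "growth_ereal X \<pi> y \<le> ereal (ln k)"
    unfolding growth_ereal_eq by (rule Limsup_bounded) (simp add: log_fibre_ratio_bounds[OF y])
  have "0 \<le> liminf (\<lambda>n. ereal (log_fibre (prefix_word n y) / n))"
    by (rule Liminf_bounded) (simp add: log_fibre_ratio_bounds[OF y])
  also have "\<dots> \<le> growth_ereal X \<pi> y" unfolding growth_ereal_eq by (rule Liminf_le_Limsup) simp
  finally have lo: "0 \<le> growth_ereal X \<pi> y" .
  show "growth_ereal X \<pi> y = ereal (growth X \<pi> y)" "0 \<le> growth X \<pi> y" "growth X \<pi> y \<le> ln k"
    using up lo unfolding growth_def by (cases "growth_ereal X \<pi> y"; simp)+
qed

lemma growth_less_frequently:
  assumes y: "y \<in> Y" and c: "c < growth X \<pi> y"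
  obtains n where "N \<le> n" "c < log_fibre (prefix_word n y) / n"
proof -
  have "\<exists>n\<ge>N. c < log_fibre (prefix_word n y) / n"
  proof (rule ccontr)
    assume "\<not> (\<exists>n\<ge>N. c < log_fibre (prefix_word n y) / n)"
    then have "\<forall>\<^sub>F n in sequentially. ereal (log_fibre (prefix_word n y) / n) \<le> ereal c"
      by (intro eventually_sequentiallyI[of N]) (auto simp: not_less)
    then have "growth_ereal X \<pi> y \<le> ereal c" unfolding growth_ereal_eq by (rule Limsup_bounded)
    then show False using c by (simp add: growth_bounds(1)[OF y])
  qed
  then show thesis using that by blast
qed

lemma growth_measurable:
  assumes "sets m = sets (restrict_space borel Y)"
  shows "growth X \<pi> \<in> borel_measurable m"
proof -
  have "(\<lambda>y. log_fibre (prefix_word n y)) \<in> borel_measurable m" for n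
    by (rule measurable_compose[OF measurable_prefix_word[OF assms]]) simp
  then have "growth_ereal X \<pi> \<in> borel_measurable m"
    unfolding growth_ereal_eq[abs_def] by measurable
  then show ?thesis unfolding growth_def[abs_def] by measurable
qed

text \<open>By subadditivity, deleting the first letter of \<open>y\<close> divides the number of
  preimages by at most \<open>k\<close>, which the logarithmic rate does not see.\<close>

lemma growth_shift:
  assumes y: "y \<in> Y"
  shows "growth X \<pi> y \<le> growth X \<pi> (shift_map y)"
proof -
  let ?a = "\<lambda>n. log_fibre (prefix_word n y)" and ?b = "\<lambda>n. log_fibre (prefix_word n (shift_map y))"
  have b: "0 \<le> ?b n" for n using log_fibre_bounds(1)[OF Y.shift_X[OF y]] .
  have "?a (Suc n) / Suc n \<le> ln k * (1 / Suc n) + ?b n / n" if "1 \<le> n" for n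
  proof -
    have "?a (Suc n) \<le> ln k + ?b n"
      using log_fibre_subadditive[OF y, of 1 n] log_fibre_bounds(2)[OF y, of 1] by simp
    then have "?a (Suc n) / Suc n \<le> (ln k + ?b n) / Suc n" by (rule divide_right_mono) simp
    also have "\<dots> = ln k * (1 / Suc n) + ?b n / Suc n" by (simp add: add_divide_distrib)
    also have "?b n / Suc n \<le> ?b n / n" using b that by (intro divide_left_mono) auto
    finally show ?thesis by simp
  qed
  then have "limsup (\<lambda>n. ereal (?a (Suc n) / Suc n)) \<le> limsup (\<lambda>n. ereal (ln k * (1 / Suc n)) + ereal (?b n / n))"
    by (intro Limsup_mono eventually_sequentiallyI[of 1]) simp
  also have "\<dots> = 0 + limsup (\<lambda>n. ereal (?b n / n))"
  proof (rule ereal_limsup_lim_add)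
    have "(\<lambda>n. ln k * (1 / real (Suc n))) \<longlonglongrightarrow> ln k * 0"
      by (intro tendsto_intros) (rule LIMSEQ_Suc[OF lim_1_over_n])
    then show "(\<lambda>n. ereal (ln k * (1 / Suc n))) \<longlonglongrightarrow> 0" by (simp add: zero_ereal_def)
  qed simp
  finally have "growth_ereal X \<pi> y \<le> growth_ereal X \<pi> (shift_map y)"
    unfolding growth_ereal_eq using limsup_shift[of "\<lambda>n. ereal (?a n / n)"] by simp
  then show ?thesis by (simp add: growth_bounds(1)[OF y] growth_bounds(1)[OF Y.shift_X[OF y]])
qed

text \<open>Provides the pieces of the covering argument for the density
  \<open>log_fibre (prefix_word q y) / q\<close>: by definition of the limsup some large
  \<open>n\<close> nearly attains the growth rate, and the orbit bound passes to windows of length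
  \<open>q\<close>.\<close>

lemma growth_covering:
  assumes y: "y \<in> Y" and e: "0 < (e :: real)" and q: "0 < q"
  shows "\<exists>n\<ge>1. n * (growth X \<pi> y - e) \<le> (\<Sum>j<n. log_fibre (prefix_word q ((shift_map ^^ j) y)) / q)"
proof -
  \<comment> \<open>The boundary cost of the orbit bound after division by \<open>q\<close>;
    choosing \<open>n\<close> above \<open>2 * K / e\<close> absorbs it into
    \<open>n * e / 2\<close>.\<close>
  define K where "K = (3 * real q + 2) * ln k"
  obtain N :: nat where N: "2 * K / e < N" using reals_Archimedean2 by blast
  obtain n where n: "max N (Suc q) \<le> n" "growth X \<pi> y - e / 2 < log_fibre (prefix_word n y) / n"
    by (rule growth_less_frequently[OF y, of "growth X \<pi> y - e / 2" "max N (Suc q)"]) (use e in auto)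
  then have n0: "0 < n" "q < n" "N \<le> n" by auto
  have "real q * log_fibre (prefix_word n y)
      \<le> (\<Sum>j<n. log_fibre (prefix_word q ((shift_map ^^ j) y))) + (3 * real q + 2) * (q * ln k)"
  proof (rule Y.subadditive_orbit_bound[where c = "\<lambda>n y. log_fibre (prefix_word n y)"])
    fix i z assume z: "i \<le> q" "z \<in> Y"
    have "log_fibre (prefix_word i z) \<le> i * ln k" by (rule log_fibre_bounds[OF z(2)])
    also have "\<dots> \<le> q * ln k" using z X.k_pos by (intro mult_right_mono) auto
    finally show "\<bar>log_fibre (prefix_word i z)\<bar> \<le> q * ln k"
      using log_fibre_bounds(1)[OF z(2), of i] by linarith
  qed (use n0 q y log_fibre_subadditive in auto)
  then have "q * log_fibre (prefix_word n y) \<le> (\<Sum>j<n. log_fibre (prefix_word q ((shift_map ^^ j) y))) + q * K"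
    by (simp add: K_def algebra_simps)
  then have 1: "log_fibre (prefix_word n y) \<le> (\<Sum>j<n. log_fibre (prefix_word q ((shift_map ^^ j) y)) / q) + K"
    using q by (simp add: sum_divide_distrib[symmetric] field_simps)
  have "n * (growth X \<pi> y - e / 2) \<le> log_fibre (prefix_word n y)"
    using n(2) n0 by (simp add: field_simps)
  moreover have "K \<le> n * (e / 2)"
  proof -
    have "2 * K / e \<le> n" using N n0(3) by linarith
    then show ?thesis using e by (simp add: field_simps)
  qed
  ultimately have "n * (growth X \<pi> y - e) \<le> (\<Sum>j<n. log_fibre (prefix_word q ((shift_map ^^ j) y)) / q)"
    using 1 by (simp add: algebra_simps)
  then show ?thesis using n0 by (intro exI[of _ n]) auto
qed

lemma integrable_growth:
  assumes "m \<in> invariant_measures Y"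
  shows "integrable m (growth X \<pi>)" "integrable m (\<lambda>y. log_fibre (prefix_word n y))"
proof -
  note m = Y.invariantD[OF assms]
  interpret prob_space m by (rule m)
  show "integrable m (growth X \<pi>)"
    by (rule integrable_const_bound[of _ "ln k"]) (use growth_measurable[OF m(2)] growth_bounds in \<open>auto simp: m(5)\<close>)
  show "integrable m (\<lambda>y. log_fibre (prefix_word n y))"
    by (rule Y.integral_prefix_word(1)[OF finite_measure_axioms m(2)])
qed

lemma integral_growth_le:
  assumes "m \<in> invariant_measures Y" "0 < q"
  shows "(\<integral>y. growth X \<pi> y \<partial>m) \<le> (\<integral>y. log_fibre (prefix_word q y) \<partial>m) / q"
proof -
  note m = Y.invariantD[OF assms(1)]
  have "(\<integral>y. growth X \<pi> y \<partial>m) \<le> (\<integral>y. log_fibre (prefix_word q y) / q \<partial>m)"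
    by (rule prob_space.covering_integral_bound[OF m(1,4,3), where K = "ln k"])
      (use growth_measurable[OF m(2)] growth_bounds growth_shift growth_covering assms(2)
        log_fibre_ratio_bounds integrable_growth(2)[OF assms(1), of q] in \<open>auto simp: m(5)\<close>)
  then show ?thesis by simp
qed

text \<open>The upper bound is the reverse Fatou lemma with the constant \<open>ln k\<close> as
  majorant; the lower bound, \<open>integral_growth_le\<close>, holds for every single
  \<open>n\<close> and not just in the limit.\<close>

lemma integral_log_fibre_lim:
  assumes "m \<in> invariant_measures Y"
  shows "(\<lambda>n. (\<integral>y. log_fibre (prefix_word n y) \<partial>m) / n) \<longlonglongrightarrow> (\<integral>y. growth X \<pi> y \<partial>m)"
proof -
  note m = Y.invariantD[OF assms]
  interpret prob_space m by (rule m)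
  let ?u = "\<lambda>n. (\<integral>y. log_fibre (prefix_word n y) \<partial>m)"
  note int = integrable_growth[OF assms]
  have "limsup (\<lambda>n. \<integral>\<^sup>+y. ennreal (log_fibre (prefix_word n y) / n) \<partial>m)
      \<le> (\<integral>\<^sup>+y. limsup (\<lambda>n. ennreal (log_fibre (prefix_word n y) / n)) \<partial>m)"
  proof (rule nn_integral_limsup[where w = "\<lambda>_. ennreal (ln k)"])
    show "AE y in m. ennreal (log_fibre (prefix_word n y) / n) \<le> ennreal (ln k)" for n
      using log_fibre_ratio_bounds by (intro AE_I2 ennreal_leI) (simp add: m(5))
    show "(\<integral>\<^sup>+y. ennreal (ln k) \<partial>m) < \<infinity>" by (simp add: emeasure_space_1)
    show "(\<lambda>y. ennreal (log_fibre (prefix_word n y) / n)) \<in> borel_measurable m" for n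
      using int(2)[of n] by measurable
  qed simp
  also have "\<dots> \<le> (\<integral>\<^sup>+y. ennreal (growth X \<pi> y) \<partial>m)"
  proof (rule nn_integral_mono)
    fix y assume "y \<in> space m"
    then have y: "y \<in> Y" by (simp add: m(5))
    show "limsup (\<lambda>n. ennreal (log_fibre (prefix_word n y) / n)) \<le> ennreal (growth X \<pi> y)"
    \<comment> \<open>\<open>growth_ereal\<close> is a limsup in \<open>ereal\<close>, while the
      Fatou lemma works in \<open>ennreal\<close>; eventual bounds with a margin \<open>e\<close>
      carry over.\<close>
    proof (rule ennreal_le_epsilon)
      fix e :: real assume e: "0 < e"
      have "growth_ereal X \<pi> y < ereal (growth X \<pi> y + e)" using e by (simp add: growth_bounds(1)[OF y])
      then have "\<forall>\<^sub>F n in sequentially. ereal (log_fibre (prefix_word n y) / n) < ereal (growth X \<pi> y + e)"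
        unfolding growth_ereal_eq by (rule Limsup_lessD)
      then have "\<forall>\<^sub>F n in sequentially. ennreal (log_fibre (prefix_word n y) / n) \<le> ennreal (growth X \<pi> y + e)"
        by (rule eventually_mono) (simp add: ennreal_leI)
      then have "limsup (\<lambda>n. ennreal (log_fibre (prefix_word n y) / n)) \<le> ennreal (growth X \<pi> y + e)"
        by (rule Limsup_bounded)
      then show "limsup (\<lambda>n. ennreal (log_fibre (prefix_word n y) / n)) \<le> ennreal (growth X \<pi> y) + ennreal e"
        using growth_bounds(2)[OF y] e by (simp add: ennreal_plus)
    qed
  qed
  also have "\<dots> = ennreal (\<integral>y. growth X \<pi> y \<partial>m)"
    using int(1) growth_bounds(2) by (intro nn_integral_eq_integral AE_I2) (auto simp: m(5))
  finally have up: "limsup (\<lambda>n. ennreal (?u n / n)) \<le> ennreal (\<integral>y. growth X \<pi> y \<partial>m)"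
  proof -
    assume *: "limsup (\<lambda>n. \<integral>\<^sup>+y. ennreal (log_fibre (prefix_word n y) / n) \<partial>m) \<le> ennreal (\<integral>y. growth X \<pi> y \<partial>m)"
    have "(\<integral>\<^sup>+y. ennreal (log_fibre (prefix_word n y) / n) \<partial>m) = ennreal (?u n / n)" for n
      using int(2)[of n] log_fibre_ratio_bounds(1)
      by (subst nn_integral_eq_integral) (auto simp: m(5))
    then show ?thesis using * by simp
  qed
  show ?thesis
  proof (rule LIMSEQ_I)
    fix r :: real assume r: "0 < r"
    let ?F = "\<integral>y. growth X \<pi> y \<partial>m"
    have F0: "0 \<le> ?F" using growth_bounds(2) by (intro integral_nonneg_AE AE_I2) (simp add: m(5))
    have "ennreal ?F < ennreal (?F + r)" using F0 r by (intro ennreal_lessI) auto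
    with up have "limsup (\<lambda>n. ennreal (?u n / n)) < ennreal (?F + r)" by (rule order.strict_trans1)
    then have "\<forall>\<^sub>F n in sequentially. ennreal (?u n / n) < ennreal (?F + r)" by (rule Limsup_lessD)
    then obtain N where N: "\<And>n. N \<le> n \<Longrightarrow> ennreal (?u n / n) < ennreal (?F + r)"
      unfolding eventually_sequentially by blast
    have "norm (?u n / n - ?F) < r" if n: "max N 1 \<le> n" for n
    proof -
      have "?u n / n < ?F + r"
        using N[of n] n F0 r by (intro ennreal_less_iff[THEN iffD1, rotated])
          (auto intro!: divide_nonneg_nonneg integral_nonneg_AE AE_I2 log_fibre_bounds simp: m(5))
      moreover have "?F \<le> ?u n / n" using integral_growth_le[OF assms, of n] n by simp
      ultimately show ?thesis by (simp add: abs_less_iff)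
    qed
    then show "\<exists>no. \<forall>n\<ge>no. norm (?u n / n - ?F) < r" by blast
  qed
qed

theorem entropy_le_pushforward:
  assumes "\<mu> \<in> invariant_measures X"
  shows "entropy_of \<mu> \<le> entropy_of (pushforward Y \<pi> \<mu>) + ereal (\<integral>y. growth X \<pi> y \<partial>(pushforward Y \<pi> \<mu>))"
proof -
  let ?m = "pushforward Y \<pi> \<mu>"
  note m = pushforward_invariant[OF assms]
  obtain h where h: "entropy_of \<mu> = ereal h" "(\<lambda>n. block_entropy \<mu> n / n) \<longlonglongrightarrow> h"
    using X.entropy_of_block_entropy[OF assms] by metis
  obtain h' where h': "entropy_of ?m = ereal h'" "(\<lambda>n. block_entropy ?m n / n) \<longlonglongrightarrow> h'"
    using Y.entropy_of_block_entropy[OF m] by metis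
  have "h \<le> h' + (\<integral>y. growth X \<pi> y \<partial>?m)"
  proof (rule LIMSEQ_le[OF h(2)])
    show "(\<lambda>n. block_entropy ?m n / n + (\<integral>y. log_fibre (prefix_word n y) \<partial>?m) / n) \<longlonglongrightarrow> h' + (\<integral>y. growth X \<pi> y \<partial>?m)"
      by (intro tendsto_add h'(2) integral_log_fibre_lim[OF m])
    show "\<exists>N. \<forall>n\<ge>N. block_entropy \<mu> n / n \<le> block_entropy ?m n / n + (\<integral>y. log_fibre (prefix_word n y) \<partial>?m) / n"
      using block_entropy_le_pushforward[OF assms]
      by (auto simp: add_divide_distrib[symmetric] intro!: divide_right_mono)
  qed
  then show ?thesis by (simp add: h h')
qed

text \<open>\<open>?c\<close> bounds all block averages of the lift from below, hence its entropy;
  \<open>entropy_le_pushforward\<close> is the opposite inequality.\<close>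

theorem exists_max_entropy_lift:
  assumes m: "m \<in> invariant_measures Y"
  obtains \<mu> where "\<mu> \<in> invariant_measures X" "pushforward Y \<pi> \<mu> = m"
    "entropy_of \<mu> = entropy_of m + ereal (\<integral>y. growth X \<pi> y \<partial>m)"
proof -
  obtain h where h: "entropy_of m = ereal h" "(\<lambda>n. block_entropy m n / n) \<longlonglongrightarrow> h"
    using Y.entropy_of_block_entropy[OF m] by metis
  let ?c = "h + (\<integral>y. growth X \<pi> y \<partial>m)"
  have "(\<lambda>n. block_entropy m n / n + (\<integral>y. log_fibre (prefix_word n y) \<partial>m) / n) \<longlonglongrightarrow> ?c"
    by (intro tendsto_add h(2) integral_log_fibre_lim[OF m])
  then have "(\<lambda>n. (block_entropy m n + (\<integral>y. log_fibre (prefix_word n y) \<partial>m)) / n) \<longlonglongrightarrow> ?c"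
    by (simp add: add_divide_distrib)
  from exists_lift_block_entropy[OF m this] obtain \<mu> where \<mu>: "\<mu> \<in> invariant_measures X"
    "pushforward Y \<pi> \<mu> = m" "\<And>q. 1 \<le> q \<Longrightarrow> ?c \<le> block_entropy \<mu> q / q" by blast
  obtain h' where h': "entropy_of \<mu> = ereal h'" "(\<lambda>n. block_entropy \<mu> n / n) \<longlonglongrightarrow> h'"
    using X.entropy_of_block_entropy[OF \<mu>(1)] by metis
  have "?c \<le> h'" by (rule LIMSEQ_le_const[OF h'(2)]) (use \<mu>(3) in blast)
  moreover have "h' \<le> ?c" using entropy_le_pushforward[OF \<mu>(1)] by (simp add: \<mu>(2) h h')
  ultimately have "entropy_of \<mu> = entropy_of m + ereal (\<integral>y. growth X \<pi> y \<partial>m)" by (simp add: h h')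
  then show thesis by (rule that[OF \<mu>(1,2)])
qed

end

section \<open>Equilibrium states of factor potentials\<close>

lemma maximizes_over_cong:
  assumes "\<And>\<nu>. \<nu> \<in> S \<Longrightarrow> G \<nu> = H \<nu>"
  shows "maximizes_over S G \<mu> \<longleftrightarrow> maximizes_over S H \<mu>"
proof -
  have "(SUP \<nu>\<in>S. G \<nu>) = (SUP \<nu>\<in>S. H \<nu>)" using assms by (intro SUP_cong) auto
  then show ?thesis unfolding maximizes_over_def using assms by auto
qed

lemma subshift_locI:
  assumes "subshift X"
  obtains k where "subshift_loc X k"
  using assms unfolding subshift_def subshift_loc_def by blast

context subshift_loc
begin

text \<open>A continuous potential becomes an additive sequence with the same mean, so existence of
  its equilibrium states is a case of the subadditive theorem.\<close>

lemma birkhoff_sums_potential: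
  assumes \<phi>: "continuous_on X \<phi>"
  shows "subadditive_potential X (\<lambda>n x. \<Sum>j<n. \<phi> ((shift_map ^^ j) x))"
    "m \<in> invariant_measures X \<Longrightarrow> mean_integral (\<lambda>n x. \<Sum>j<n. \<phi> ((shift_map ^^ j) x)) m = ereal (\<integral>x. \<phi> x \<partial>m)"
proof -
  have sh: "continuous_on UNIV (\<lambda>x. (shift_map ^^ j) x)" for j
    unfolding shift_map_funpow by (intro continuous_on_coordinatewise_then_product continuous_on_product_coordinates)
  have "continuous_on X (\<lambda>x. \<phi> ((shift_map ^^ j) x))" for j
    by (rule continuous_on_compose2[OF \<phi> continuous_on_subset[OF sh]]) (auto intro: shift_pow_X)
  then have "continuous_on X (\<lambda>x. \<Sum>j<n. \<phi> ((shift_map ^^ j) x))" for n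
    by (intro continuous_on_sum)
  moreover have "(\<Sum>j<n + m. \<phi> ((shift_map ^^ j) x))
      = (\<Sum>j<n. \<phi> ((shift_map ^^ j) x)) + (\<Sum>j<m. \<phi> ((shift_map ^^ j) ((shift_map ^^ n) x)))" for n m x
  proof (induction m)
    case (Suc m)
    have "(shift_map ^^ (n + m)) x = (shift_map ^^ m) ((shift_map ^^ n) x)"
      by (simp add: shift_map_funpow ac_simps)
    then show ?case using Suc by simp
  qed simp
  ultimately show "subadditive_potential X (\<lambda>n x. \<Sum>j<n. \<phi> ((shift_map ^^ j) x))"
    unfolding subadditive_potential_def by simp
  assume m: "m \<in> invariant_measures X"
  note mm = invariantD[OF m]
  note T = shift_pow_measure_preserving[OF m]
  note int = continuous_integrable[OF \<phi> prob_space.finite_measure[OF mm(1)] mm(2)]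
  have i: "integrable m (\<lambda>x. \<phi> ((shift_map ^^ j) x))" "(\<integral>x. \<phi> ((shift_map ^^ j) x) \<partial>m) = (\<integral>x. \<phi> x \<partial>m)" for j
    using integrable_distr_eq[OF T(1) int(1), of j] integral_distr[OF T(1) int(1), of j] int(2) by (simp_all add: T(2))
  have "(\<lambda>n. ereal ((\<integral>x. (\<Sum>j<n. \<phi> ((shift_map ^^ j) x)) \<partial>m) / n)) \<longlonglongrightarrow> ereal (\<integral>x. \<phi> x \<partial>m)"
    by (intro tendsto_eventually eventually_sequentiallyI[of 1]) (simp add: i)
  then show "mean_integral (\<lambda>n x. \<Sum>j<n. \<phi> ((shift_map ^^ j) x)) m = ereal (\<integral>x. \<phi> x \<partial>m)"
    unfolding mean_integral_def by (rule limI)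
qed

lemma exists_equilibrium_state:
  assumes \<phi>: "continuous_on X \<phi>"
  shows "\<exists>m. equilibrium_state X \<phi> m"
proof -
  obtain m where "equilibrium_state_seq X (\<lambda>n x. \<Sum>j<n. \<phi> ((shift_map ^^ j) x)) m"
    using exists_equilibrium_state_seq[OF invariant_measures_nonempty birkhoff_sums_potential(1)[OF \<phi>]] by blast
  moreover have "equilibrium_state_seq X (\<lambda>n x. \<Sum>j<n. \<phi> ((shift_map ^^ j) x)) m \<longleftrightarrow> equilibrium_state X \<phi> m"
    unfolding equilibrium_state_seq_def equilibrium_state_def
    by (rule maximizes_over_cong) (simp add: birkhoff_sums_potential(2)[OF \<phi>])
  ultimately show ?thesis by blast
qed

end

section \<open>Transfer of equilibrium states along the factor map\<close>

context factor_loc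
begin

text \<open>The supremum over the measures above the image has the value given by the relative
  variational principle: the upper bound holds for each of them and a lift attains it.\<close>

lemma max_relative_entropy_iff:
  assumes \<mu>: "\<mu> \<in> invariant_measures X"
  shows "max_relative_entropy X Y \<pi> (pushforward Y \<pi> \<mu>) \<mu> \<longleftrightarrow>
    entropy_of \<mu> = entropy_of (pushforward Y \<pi> \<mu>) + ereal (\<integral>y. growth X \<pi> y \<partial>(pushforward Y \<pi> \<mu>))"
proof -
  let ?m = "pushforward Y \<pi> \<mu>"
  obtain \<mu>' where \<mu>': "\<mu>' \<in> invariant_measures X" "pushforward Y \<pi> \<mu>' = ?m"
    "entropy_of \<mu>' = entropy_of ?m + ereal (\<integral>y. growth X \<pi> y \<partial>?m)"
    by (rule exists_max_entropy_lift[OF pushforward_invariant[OF \<mu>]])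
  have "(SUP \<nu>\<in>{\<nu> \<in> invariant_measures X. pushforward Y \<pi> \<nu> = ?m}. entropy_of \<nu>)
      = entropy_of ?m + ereal (\<integral>y. growth X \<pi> y \<partial>?m)"
  proof (rule antisym)
    show "(SUP \<nu>\<in>{\<nu> \<in> invariant_measures X. pushforward Y \<pi> \<nu> = ?m}. entropy_of \<nu>)
        \<le> entropy_of ?m + ereal (\<integral>y. growth X \<pi> y \<partial>?m)"
    proof (rule SUP_least)
      fix \<nu> assume "\<nu> \<in> {\<nu> \<in> invariant_measures X. pushforward Y \<pi> \<nu> = ?m}"
      then show "entropy_of \<nu> \<le> entropy_of ?m + ereal (\<integral>y. growth X \<pi> y \<partial>?m)"
        using entropy_le_pushforward[of \<nu>] by auto
    qed
    show "entropy_of ?m + ereal (\<integral>y. growth X \<pi> y \<partial>?m)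
        \<le> (SUP \<nu>\<in>{\<nu> \<in> invariant_measures X. pushforward Y \<pi> \<nu> = ?m}. entropy_of \<nu>)"
      unfolding \<mu>'(3)[symmetric] using \<mu>' by (intro SUP_upper) auto
  qed
  then show ?thesis using \<mu> by (simp add: max_relative_entropy_def)
qed

text \<open>Both parts are cases of a functional \<open>G\<close> of the image measure.
  \<open>FX\<close> is at most \<open>FY\<close> at the image, with equality when the entropy over
  the image is maximal. Conversely equality forces maximality only at a finite value, since
  otherwise \<open>G\<close> cannot be cancelled.\<close>

theorem equilibrium_transfer:
  fixes G :: "(nat \<Rightarrow> nat) measure \<Rightarrow> ereal"
  defines "FX \<equiv> (\<lambda>\<mu>. entropy_of \<mu> - ereal (\<integral>y. growth X \<pi> y \<partial>(pushforward Y \<pi> \<mu>)) + G (pushforward Y \<pi> \<mu>))"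
    and "FY \<equiv> (\<lambda>m. entropy_of m + G m)"
  assumes G: "\<forall>m\<in>invariant_measures Y. G m \<noteq> \<infinity>"
    and ex: "maximizes_over (invariant_measures Y) FY m0"
  shows "(SUP \<mu>\<in>invariant_measures X. FX \<mu>) = (SUP m\<in>invariant_measures Y. FY m)"
    "\<exists>\<mu>. maximizes_over (invariant_measures X) FX \<mu>"
    "(SUP m\<in>invariant_measures Y. FY m) \<noteq> -\<infinity> \<Longrightarrow>
      maximizes_over (invariant_measures X) FX \<mu> \<longleftrightarrow>
      maximizes_over (invariant_measures Y) FY (pushforward Y \<pi> \<mu>) \<and>
      max_relative_entropy X Y \<pi> (pushforward Y \<pi> \<mu>) \<mu>"
proof -
  let ?S = "SUP m\<in>invariant_measures Y. FY m"
  have m0: "m0 \<in> invariant_measures Y" "FY m0 = ?S" using ex by (auto simp: maximizes_over_def)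
  have FX_le: "FX \<mu> \<le> FY (pushforward Y \<pi> \<mu>)" if \<mu>: "\<mu> \<in> invariant_measures X" for \<mu>
  proof -
    have "entropy_of \<mu> - ereal (\<integral>y. growth X \<pi> y \<partial>(pushforward Y \<pi> \<mu>)) \<le> entropy_of (pushforward Y \<pi> \<mu>)"
      using entropy_le_pushforward[OF \<mu>] by (simp add: ereal_minus_le)
    then show ?thesis unfolding FX_def FY_def by (rule add_right_mono)
  qed
  have FY_le: "FY m \<le> ?S" if "m \<in> invariant_measures Y" for m
    using that by (rule SUP_upper)
  have real_entropy: "\<exists>h. entropy_of m = ereal h" if "m \<in> invariant_measures Y" for m
    using Y.entropy_of_block_entropy[OF that] by metis
  obtain \<mu>0 where \<mu>0: "\<mu>0 \<in> invariant_measures X" "pushforward Y \<pi> \<mu>0 = m0"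
    "entropy_of \<mu>0 = entropy_of m0 + ereal (\<integral>y. growth X \<pi> y \<partial>m0)"
    by (rule exists_max_entropy_lift[OF m0(1)])
  have FX_eq: "FX \<mu> = FY (pushforward Y \<pi> \<mu>)"
    if "\<mu> \<in> invariant_measures X"
      "entropy_of \<mu> = entropy_of (pushforward Y \<pi> \<mu>) + ereal (\<integral>y. growth X \<pi> y \<partial>(pushforward Y \<pi> \<mu>))" for \<mu>
    using real_entropy[OF pushforward_invariant[OF that(1)]] that(2) by (auto simp: FX_def FY_def)
  have "FX \<mu>0 = ?S" using FX_eq[of \<mu>0] \<mu>0 m0(2) by simp
  then show sup: "(SUP \<mu>\<in>invariant_measures X. FX \<mu>) = ?S"
  proof (intro antisym)
    show "(SUP \<mu>\<in>invariant_measures X. FX \<mu>) \<le> ?S"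
      using FX_le FY_le pushforward_invariant by (intro SUP_least) (meson order_trans)
    assume "FX \<mu>0 = ?S"
    then show "?S \<le> (SUP \<mu>\<in>invariant_measures X. FX \<mu>)" using SUP_upper[OF \<mu>0(1), of FX] by simp
  qed
  then show "\<exists>\<mu>. maximizes_over (invariant_measures X) FX \<mu>"
    using \<mu>0(1) \<open>FX \<mu>0 = ?S\<close> unfolding maximizes_over_def by auto
  assume fin: "?S \<noteq> -\<infinity>"
  show "maximizes_over (invariant_measures X) FX \<mu> \<longleftrightarrow>
      maximizes_over (invariant_measures Y) FY (pushforward Y \<pi> \<mu>) \<and>
      max_relative_entropy X Y \<pi> (pushforward Y \<pi> \<mu>) \<mu>"
  proof (cases "\<mu> \<in> invariant_measures X")
    case False
    then show ?thesis by (simp add: maximizes_over_def max_relative_entropy_def)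
  next
    case True
    let ?m = "pushforward Y \<pi> \<mu>"
    note m = pushforward_invariant[OF True]
    show ?thesis unfolding max_relative_entropy_iff[OF True] unfolding maximizes_over_def sup
    proof (intro iffI conjI)
      assume "\<mu> \<in> invariant_measures X \<and> FX \<mu> = ?S"
      then have E: "FX \<mu> = ?S" by simp
      then have FY: "FY ?m = ?S" using FX_le[OF True] FY_le[OF m] by simp
      show "?m \<in> invariant_measures Y" by (rule m)
      show "FY ?m = ?S" by (rule FY)
      obtain h where h: "entropy_of ?m = ereal h" using real_entropy[OF m] by blast
      \<comment> \<open>\<open>\<infinity>\<close> is excluded by the assumption on \<open>G\<close>
        and \<open>-\<infinity>\<close> by \<open>fin\<close>, so the common term is real and
        cancels.\<close>
      obtain g where g: "G ?m = ereal g"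
        using bspec[OF G m] FY fin h by (cases "G ?m") (auto simp: FY_def)
      obtain h' where h': "entropy_of \<mu> = ereal h'"
        using X.entropy_of_block_entropy[OF True] by metis
      show "entropy_of \<mu> = entropy_of ?m + ereal (\<integral>y. growth X \<pi> y \<partial>?m)"
        using E FY[symmetric] by (simp add: FX_def FY_def h g h')
    next
      assume *: "(?m \<in> invariant_measures Y \<and> FY ?m = ?S)
        \<and> entropy_of \<mu> = entropy_of ?m + ereal (\<integral>y. growth X \<pi> y \<partial>?m)"
      show "\<mu> \<in> invariant_measures X" by (rule True)
      show "FX \<mu> = ?S" using FX_eq[OF True] * by simp
    qed
  qed
qed

lemma integral_pushforward:
  fixes f :: "(nat \<Rightarrow> nat) \<Rightarrow> real"
  assumes \<mu>: "\<mu> \<in> invariant_measures X" and f: "f \<in> borel_measurable (restrict_space borel Y)"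
  shows "(\<integral>x. f (\<pi> x) \<partial>\<mu>) = (\<integral>y. f y \<partial>(pushforward Y \<pi> \<mu>))"
  unfolding pushforward_def using integral_distr[OF pi_measurable[OF X.invariantD(2)[OF \<mu>]] f] by simp

lemma mean_integral_pushforward:
  assumes \<mu>: "\<mu> \<in> invariant_measures X" and \<Phi>: "subadditive_potential Y \<Phi>"
  shows "mean_integral (\<lambda>n x. \<Phi> n (\<pi> x)) \<mu> = mean_integral \<Phi> (pushforward Y \<pi> \<mu>)"
proof -
  \<comment> \<open>At \<open>n = 0\<close> both sides are 0 by division by zero; continuity of
    \<open>\<Phi> n\<close>, hence measurability, is known for \<open>n \<ge> 1\<close>
    only.\<close>
  have "(\<integral>x. \<Phi> n (\<pi> x) \<partial>\<mu>) / n = (\<integral>y. \<Phi> n y \<partial>(pushforward Y \<pi> \<mu>)) / n" for n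
  proof (cases "n = 0")
    case False
    then have "continuous_on Y (\<Phi> n)" using \<Phi> by (simp add: subadditive_potential_def)
    then show ?thesis
      by (simp add: integral_pushforward[OF \<mu> borel_measurable_continuous_on_restrict])
  qed simp
  then show ?thesis unfolding mean_integral_def by (simp only:)
qed

lemma integral_growth_pushforward:
  assumes "\<mu> \<in> invariant_measures X"
  shows "(\<integral>x. growth X \<pi> (\<pi> x) \<partial>\<mu>) = (\<integral>y. growth X \<pi> y \<partial>(pushforward Y \<pi> \<mu>))"
  by (rule integral_pushforward[OF assms growth_measurable[OF refl]])

lemma bounded_growth: "bounded (growth X \<pi> ` Y)"
  unfolding bounded_iff using growth_bounds by (intro exI[of _ "ln k"]) auto

theorem equilibrium_states_continuous:
  assumes \<phi>: "continuous_on Y \<phi>"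
  shows "(SUP \<mu>\<in>invariant_measures X. entropy_of \<mu> + ereal (\<integral>x. - growth X \<pi> (\<pi> x) + \<phi> (\<pi> x) \<partial>\<mu>))
      = (SUP m\<in>invariant_measures Y. entropy_of m + ereal (\<integral>y. \<phi> y \<partial>m))"
    "\<exists>\<mu>. equilibrium_state X (\<lambda>x. - growth X \<pi> (\<pi> x) + \<phi> (\<pi> x)) \<mu>"
    "equilibrium_state X (\<lambda>x. - growth X \<pi> (\<pi> x) + \<phi> (\<pi> x)) \<mu> \<longleftrightarrow>
      equilibrium_state Y \<phi> (pushforward Y \<pi> \<mu>) \<and>
      max_relative_entropy X Y \<pi> (pushforward Y \<pi> \<mu>) \<mu>"
proof -
  let ?G = "\<lambda>m. ereal (\<integral>y. \<phi> y \<partial>m)"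
  let ?FX = "\<lambda>\<mu>. entropy_of \<mu> - ereal (\<integral>y. growth X \<pi> y \<partial>(pushforward Y \<pi> \<mu>)) + ?G (pushforward Y \<pi> \<mu>)"
  obtain m0 where m0: "maximizes_over (invariant_measures Y) (\<lambda>m. entropy_of m + ?G m) m0"
    using Y.exists_equilibrium_state[OF \<phi>] unfolding equilibrium_state_def by blast
  have eq: "entropy_of \<mu> + ereal (\<integral>x. - growth X \<pi> (\<pi> x) + \<phi> (\<pi> x) \<partial>\<mu>) = ?FX \<mu>"
    if \<mu>: "\<mu> \<in> invariant_measures X" for \<mu>
  proof -
    note m = pushforward_invariant[OF \<mu>]
    note mm = Y.invariantD[OF m]
    have f: "(\<lambda>y. - growth X \<pi> y + \<phi> y) \<in> borel_measurable (restrict_space borel Y)"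
      using growth_measurable[OF refl] borel_measurable_continuous_on_restrict[OF \<phi>]
      by (intro borel_measurable_add borel_measurable_uminus)
    have "(\<integral>x. - growth X \<pi> (\<pi> x) + \<phi> (\<pi> x) \<partial>\<mu>) = (\<integral>y. - growth X \<pi> y + \<phi> y \<partial>(pushforward Y \<pi> \<mu>))"
      by (rule integral_pushforward[OF \<mu> f])
    also have "\<dots> = - (\<integral>y. growth X \<pi> y \<partial>(pushforward Y \<pi> \<mu>)) + (\<integral>y. \<phi> y \<partial>(pushforward Y \<pi> \<mu>))"
      using integrable_growth(1)[OF m] Y.continuous_integrable(2)[OF \<phi> prob_space.finite_measure[OF mm(1)] mm(2)]
      by simp
    finally show ?thesis by (cases "entropy_of \<mu>") simp_all
  qed
  \<comment> \<open>The supremum is attained at \<open>m0\<close>, where entropy and integral are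
    both real.\<close>
  have S: "(SUP m\<in>invariant_measures Y. entropy_of m + ?G m) \<noteq> -\<infinity>"
  proof -
    have "m0 \<in> invariant_measures Y" "(SUP m\<in>invariant_measures Y. entropy_of m + ?G m) = entropy_of m0 + ?G m0"
      using m0 by (simp_all add: maximizes_over_def)
    moreover from this(1) obtain h where "entropy_of m0 = ereal h" using Y.entropy_of_block_entropy by metis
    ultimately show ?thesis by simp
  qed
  have G: "\<forall>m\<in>invariant_measures Y. ?G m \<noteq> \<infinity>" by simp
  note T = equilibrium_transfer[where G = ?G, OF G m0]
  show "(SUP \<mu>\<in>invariant_measures X. entropy_of \<mu> + ereal (\<integral>x. - growth X \<pi> (\<pi> x) + \<phi> (\<pi> x) \<partial>\<mu>))
      = (SUP m\<in>invariant_measures Y. entropy_of m + ?G m)"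
    unfolding T(1)[symmetric] by (rule SUP_cong[OF refl eq])
  have es: "equilibrium_state X (\<lambda>x. - growth X \<pi> (\<pi> x) + \<phi> (\<pi> x)) \<mu> \<longleftrightarrow> maximizes_over (invariant_measures X) ?FX \<mu>" for \<mu>
    unfolding equilibrium_state_def by (rule maximizes_over_cong[OF eq])
  show "\<exists>\<mu>. equilibrium_state X (\<lambda>x. - growth X \<pi> (\<pi> x) + \<phi> (\<pi> x)) \<mu>"
    unfolding es by (rule T(2))
  show "equilibrium_state X (\<lambda>x. - growth X \<pi> (\<pi> x) + \<phi> (\<pi> x)) \<mu> \<longleftrightarrow>
      equilibrium_state Y \<phi> (pushforward Y \<pi> \<mu>) \<and> max_relative_entropy X Y \<pi> (pushforward Y \<pi> \<mu>) \<mu>"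
    unfolding es unfolding equilibrium_state_def by (rule T(3)[OF S])
qed

theorem equilibrium_states_subadditive:
  assumes \<Phi>: "subadditive_potential Y \<Phi>"
  shows "(SUP \<mu>\<in>invariant_measures X.
        entropy_of \<mu> - ereal (\<integral>x. growth X \<pi> (\<pi> x) \<partial>\<mu>) + mean_integral (\<lambda>n x. \<Phi> n (\<pi> x)) \<mu>)
      = (SUP m\<in>invariant_measures Y. entropy_of m + mean_integral \<Phi> m)"
    "\<exists>\<mu>. equilibrium_state_sum X (\<lambda>x. - growth X \<pi> (\<pi> x)) (\<lambda>n x. \<Phi> n (\<pi> x)) \<mu>"
    "subadditive_pressure Y \<Phi> \<noteq> -\<infinity> \<Longrightarrow>
      equilibrium_state_sum X (\<lambda>x. - growth X \<pi> (\<pi> x)) (\<lambda>n x. \<Phi> n (\<pi> x)) \<mu> \<longleftrightarrow>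
      equilibrium_state_seq Y \<Phi> (pushforward Y \<pi> \<mu>) \<and>
      max_relative_entropy X Y \<pi> (pushforward Y \<pi> \<mu>) \<mu>"
proof -
  let ?G = "mean_integral \<Phi>"
  let ?FX = "\<lambda>\<mu>. entropy_of \<mu> - ereal (\<integral>y. growth X \<pi> y \<partial>(pushforward Y \<pi> \<mu>)) + ?G (pushforward Y \<pi> \<mu>)"
  obtain m0 where m0: "maximizes_over (invariant_measures Y) (\<lambda>m. entropy_of m + ?G m) m0"
    using Y.exists_equilibrium_state_seq[OF Y.invariant_measures_nonempty \<Phi>]
    unfolding equilibrium_state_seq_def by blast
  \<comment> \<open>The mean integral is an infimum, bounded here by the integral of
    \<open>\<Phi> 1\<close>.\<close>
  have G: "\<forall>m\<in>invariant_measures Y. ?G m \<noteq> \<infinity>"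
    using Y.mean_integral_le[OF _ \<Phi>, of _ 1] by force
  note T = equilibrium_transfer[where G = ?G, OF G m0]
  have eq: "entropy_of \<mu> - ereal (\<integral>x. growth X \<pi> (\<pi> x) \<partial>\<mu>) + mean_integral (\<lambda>n x. \<Phi> n (\<pi> x)) \<mu> = ?FX \<mu>"
    if \<mu>: "\<mu> \<in> invariant_measures X" for \<mu>
    by (simp add: integral_growth_pushforward[OF \<mu>] mean_integral_pushforward[OF \<mu> \<Phi>])
  show "(SUP \<mu>\<in>invariant_measures X.
        entropy_of \<mu> - ereal (\<integral>x. growth X \<pi> (\<pi> x) \<partial>\<mu>) + mean_integral (\<lambda>n x. \<Phi> n (\<pi> x)) \<mu>)
      = (SUP m\<in>invariant_measures Y. entropy_of m + ?G m)"
    unfolding T(1)[symmetric] by (rule SUP_cong[OF refl eq])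
  have es: "equilibrium_state_sum X (\<lambda>x. - growth X \<pi> (\<pi> x)) (\<lambda>n x. \<Phi> n (\<pi> x)) \<mu>
      \<longleftrightarrow> maximizes_over (invariant_measures X) ?FX \<mu>" for \<mu>
    unfolding equilibrium_state_sum_def
    by (rule maximizes_over_cong)
      (simp add: integral_growth_pushforward mean_integral_pushforward[OF _ \<Phi>] minus_ereal_def)
  show "\<exists>\<mu>. equilibrium_state_sum X (\<lambda>x. - growth X \<pi> (\<pi> x)) (\<lambda>n x. \<Phi> n (\<pi> x)) \<mu>"
    unfolding es by (rule T(2))
  \<comment> \<open>The pressure enters through a measure of finite mean integral, which keeps the
    supremum away from \<open>-\<infinity>\<close>.\<close>
  assume "subadditive_pressure Y \<Phi> \<noteq> -\<infinity>"
  then obtain m where m: "m \<in> invariant_measures Y" "?G m \<noteq> -\<infinity>"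
    by (rule Y.exists_finite_mean_integral[OF \<Phi>])
  obtain h where h: "entropy_of m = ereal h" using Y.entropy_of_block_entropy[OF m(1)] by metis
  have "entropy_of m + ?G m \<le> (SUP m\<in>invariant_measures Y. entropy_of m + ?G m)"
    using m(1) by (rule SUP_upper)
  moreover have "entropy_of m + ?G m \<noteq> -\<infinity>" using m(2) h by simp
  ultimately have S: "(SUP m\<in>invariant_measures Y. entropy_of m + ?G m) \<noteq> -\<infinity>" by auto
  show "equilibrium_state_sum X (\<lambda>x. - growth X \<pi> (\<pi> x)) (\<lambda>n x. \<Phi> n (\<pi> x)) \<mu> \<longleftrightarrow>
      equilibrium_state_seq Y \<Phi> (pushforward Y \<pi> \<mu>) \<and> max_relative_entropy X Y \<pi> (pushforward Y \<pi> \<mu>) \<mu>"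
    unfolding es unfolding equilibrium_state_seq_def by (rule T(3)[OF S])
qed

end

theorem corollary3p9:
  fixes X Y :: "(nat \<Rightarrow> nat) set"
    and \<pi> :: "(nat \<Rightarrow> nat) \<Rightarrow> (nat \<Rightarrow> nat)"
    and F :: "(nat \<Rightarrow> nat) \<Rightarrow> real"
  assumes "shift_of_finite_type X" and "irreducible_shift X"
    and "subshift Y"
    and "factor_map X Y \<pi>" and "one_block X \<pi>"
  defines "F \<equiv> growth X \<pi>"
  shows
    "((\<forall>y\<in>Y. growth_ereal X \<pi> y = ereal (F y)) \<and>
      bounded (F ` Y) \<and> F \<in> borel_measurable (restrict_space borel Y) \<and>
      (\<forall>\<phi>. continuous_on Y \<phi> \<longrightarrow>
         (SUP \<mu>\<in>invariant_measures X.
            entropy_of \<mu> + ereal (\<integral>x. - F (\<pi> x) + \<phi> (\<pi> x) \<partial>\<mu>))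
         = (SUP m\<in>invariant_measures Y. entropy_of m + ereal (\<integral>y. \<phi> y \<partial>m)) \<and>
         {\<mu>. equilibrium_state X (\<lambda>x. - F (\<pi> x) + \<phi> (\<pi> x)) \<mu>} \<noteq> {} \<and>
         (\<forall>\<mu>. equilibrium_state X (\<lambda>x. - F (\<pi> x) + \<phi> (\<pi> x)) \<mu> \<longleftrightarrow>
            equilibrium_state Y \<phi> (pushforward Y \<pi> \<mu>) \<and>
            max_relative_entropy X Y \<pi> (pushforward Y \<pi> \<mu>) \<mu>)))
     \<and>
     (\<forall>\<Phi>. subadditive_potential Y \<Phi> \<longrightarrow>
         (SUP \<mu>\<in>invariant_measures X.
            entropy_of \<mu> - ereal (\<integral>x. F (\<pi> x) \<partial>\<mu>) + mean_integral (\<lambda>n x. \<Phi> n (\<pi> x)) \<mu>)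
         = (SUP m\<in>invariant_measures Y. entropy_of m + mean_integral \<Phi> m) \<and>
         {\<mu>. equilibrium_state_sum X (\<lambda>x. - F (\<pi> x)) (\<lambda>n x. \<Phi> n (\<pi> x)) \<mu>} \<noteq> {} \<and>
         (subadditive_pressure Y \<Phi> \<noteq> -\<infinity> \<longrightarrow>
            (\<forall>\<mu>. equilibrium_state_sum X (\<lambda>x. - F (\<pi> x)) (\<lambda>n x. \<Phi> n (\<pi> x)) \<mu> \<longleftrightarrow>
               equilibrium_state_seq Y \<Phi> (pushforward Y \<pi> \<mu>) \<and>
               max_relative_entropy X Y \<pi> (pushforward Y \<pi> \<mu>) \<mu>)))"
proof -
  have "subshift X" using assms(1) by (simp add: shift_of_finite_type_def)
  then obtain k where "subshift_loc X k" by (rule subshift_locI)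
  moreover obtain l where "subshift_loc Y l" using assms(3) by (rule subshift_locI)
  ultimately interpret factor_loc X k Y l \<pi>
    using assms(4,5) by (simp add: factor_loc_def factor_loc_axioms_def)
  show ?thesis
    unfolding F_def
    using growth_bounds(1) bounded_growth growth_measurable[OF refl]
      equilibrium_states_continuous equilibrium_states_subadditive
    by (intro conjI allI impI ballI) simp_all
qed

end
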